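(* Let $(M,\mathcal F)$ be a compact Riemannian manifold with an isoparametric foliation. Assume that $\mathrm{Spec}(M,\mathcal F)=\mathrm{Spec}_1(M)$. Then the isoparametric tube $\Omega_t$ fails the Pompeiu property for all $t\in S(\mathcal F)$.
   Context: $M$ is a compact connected Riemannian manifold without boundary, and $\Delta=-\mathrm{div}\,\nabla$ is its positive Laplacian. An isoparametric function on $M$ is a smooth function $F:M\to[a,b]$ with $F(M)=[a,b]$, $a<b$, such that $|\nabla F|^2=A\circ F$ and $\Delta F=B\circ F$ for some smooth functions $A,B:[a,b]\to\mathbb R$. The sets $M^+:=F^{-1}(a)$ and $M^-:=F^{-1}(b)$ are smooth closed submanifolds, called the focal sets; $F$ is called proper if both focal sets have codimension at least $2$ in $M$. All isoparametric functions are assumed proper. The isoparametric foliation $\mathcal F$ is the decomposition $M=\bigcup_{t\in[a,b]}F^{-1}(t)$ into level sets of $F$. Let $\rho(x)=\mathrm{dist}(x,M^+)$ and $D(\mathcal F)=\mathrm{dist}(M^+,M^-)$, so that $\rho:M\to[0,D(\mathcal F)]$; the leaves of $\mathcal F$ are also the level sets of $\rho$. For $t\in(0,D(\mathcal F))$ the isoparametric tube is $\Omega_t=\{x\in M:\rho(x)<t\}$. A function $f$ on $M$ is radial if $f=\psi\circ\rho$ for some $\psi:[0,D(\mathcal F)]\to\mathbb R$. $\mathrm{Spec}_1(M)$ is the set of distinct eigenvalues of $\Delta$ on $M$. An eigenvalue $\lambda\in\mathrm{Spec}_1(M)$ is radial if there is a (nonzero) radial eigenfunction associated to $\lambda$;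 $\mathrm{Spec}(M,\mathcal F)\subseteq\mathrm{Spec}_1(M)$ is the set of radial eigenvalues. The radial eigenvalues form an infinite sequence $0=\lambda_1<\lambda_2<\cdots$, and each $\lambda_k$ has exactly one radial eigenfunction $\phi_k$ up to scalar multiplication. Set $\Psi_k(t)=\int_{\Omega_t}\phi_k$, $S_k(\mathcal F)=\{t\in(0,D(\mathcal F)):\Psi_k(t)=0\}$, and $S(\mathcal F)=\bigcup_{k=1}^\infty S_k(\mathcal F)$. A bounded domain $\Omega\subseteq M$ has the Pompeiu property if the only continuous function $f:M\to\mathbb R$ with $\int_{h(\Omega)}f=0$ for all isometries $h$ of $M$ (integration with respect to the Riemannian measure) is $f=0$; otherwise $\Omega$ fails the Pompeiu property. *)

theory Defs
  imports "HOL-Analysis.Analysis"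
begin

section \<open>Smooth functions on open subsets of Euclidean space\<close>

primrec Ck_on :: "nat \<Rightarrow> ('a::euclidean_space \<Rightarrow> 'b::real_normed_vector) \<Rightarrow> 'a set \<Rightarrow> bool" where
  "Ck_on 0 f U \<longleftrightarrow> continuous_on U f"
| "Ck_on (Suc k) f U \<longleftrightarrow> (\<forall>x\<in>U. f differentiable (at x)) \<and>
     (\<forall>v. Ck_on k (\<lambda>x. frechet_derivative f (at x) v) U)"

text \<open>Only meant for open \<^term>\<open>U\<close>, since the derivatives are two-sided.\<close>

definition smooth_on :: "'a::euclidean_space set \<Rightarrow> ('a \<Rightarrow> 'b::real_normed_vector) \<Rightarrow> bool" where
  "smooth_on U f \<longleftrightarrow> (\<forall>k. Ck_on k f U)"

definition partial :: "'n \<Rightarrow> (real^'n::finite \<Rightarrow> real) \<Rightarrow> real^'n \<Rightarrow> real" where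
  "partial i f x = frechet_derivative f (at x) (axis i 1)"


section \<open>Riemannian manifolds\<close>

text \<open>The points of the manifold are the elements of the topological space \<^typ>\<open>'m\<close>; its dimension is
  the cardinality of \<^typ>\<open>'n\<close>. A chart consists of its domain and its coordinate map (which is
  arbitrary outside the domain).\<close>

type_synonym ('m, 'n) chart = "'m set \<times> ('m \<Rightarrow> real^'n)"

abbreviation cdom :: "('m, 'n::finite) chart \<Rightarrow> 'm set" where
  "cdom c \<equiv> fst c"

abbreviation coord :: "('m, 'n::finite) chart \<Rightarrow> 'm \<Rightarrow> real^'n" where
  "coord c \<equiv> snd c"

definition codom :: "('m, 'n::finite) chart \<Rightarrow> (real^'n) set" where
  "codom c = coord c ` cdom c"

definition param :: "('m, 'n::finite) chart \<Rightarrow> real^'n \<Rightarrow> 'm" where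
  "param c = inv_into (cdom c) (coord c)"

definition is_chart :: "('m::topological_space, 'n::finite) chart \<Rightarrow> bool" where
  "is_chart c \<longleftrightarrow> open (cdom c) \<and> open (codom c) \<and>
     homeomorphism (cdom c) (codom c) (coord c) (param c)"

definition smoothly_compatible ::
    "('m::topological_space, 'n::finite) chart \<Rightarrow> ('m, 'n) chart \<Rightarrow> bool" where
  "smoothly_compatible c d \<longleftrightarrow>
     smooth_on (coord c ` (cdom c \<inter> cdom d)) (coord d \<circ> param c) \<and>
     smooth_on (coord d ` (cdom c \<inter> cdom d)) (coord c \<circ> param d)"

text \<open>\<^term>\<open>gram M c x\<close> is the matrix of the components $g_{ij}$ of the metric in the chart
  \<^term>\<open>c\<close>, at the point with coordinates \<^term>\<open>x\<close>.\<close>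

record ('m, 'n::finite) riemannian =
  atlas :: "('m, 'n) chart set"
  gram :: "('m, 'n) chart \<Rightarrow> real^'n \<Rightarrow> real^'n^'n"

definition smooth_atlas :: "('m::topological_space, 'n::finite) chart set \<Rightarrow> bool" where
  "smooth_atlas \<A> \<longleftrightarrow> (\<forall>c\<in>\<A>. is_chart c) \<and> (\<Union>c\<in>\<A>. cdom c) = UNIV \<and>
     (\<forall>c\<in>\<A>. \<forall>d\<in>\<A>. smoothly_compatible c d)"

text \<open>The metric pulls back to itself under \<^term>\<open>h\<close>. For \<^term>\<open>h = id\<close> this is the
  transformation rule of the metric components under a change of coordinates.\<close>

definition preserves_metric :: "('m::topological_space, 'n::finite) riemannian \<Rightarrow> ('m \<Rightarrow> 'm) \<Rightarrow> bool" where
  "preserves_metric M h \<longleftrightarrow>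
     (\<forall>c\<in>atlas M. \<forall>d\<in>atlas M. \<forall>p\<in>cdom c. h p \<in> cdom d \<longrightarrow>
        (let J = jacobian (coord d \<circ> h \<circ> param c) (at (coord c p))
         in gram M c (coord c p) = transpose J ** gram M d (coord d (h p)) ** J))"

definition riemannian_manifold :: "('m::topological_space, 'n::finite) riemannian \<Rightarrow> bool" where
  "riemannian_manifold M \<longleftrightarrow> smooth_atlas (atlas M) \<and>
     (\<forall>c\<in>atlas M. smooth_on (codom c) (gram M c) \<and>
        (\<forall>x\<in>codom c. transpose (gram M c x) = gram M c x \<and>
           (\<forall>v. v \<noteq> 0 \<longrightarrow> v \<bullet> (gram M c x *v v) > 0))) \<and>
     preserves_metric M id"

definition smooth_function :: "('m::topological_space, 'n::finite) riemannian \<Rightarrow> ('m \<Rightarrow> real) \<Rightarrow> bool" where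
  "smooth_function M f \<longleftrightarrow> (\<forall>c\<in>atlas M. smooth_on (codom c) (f \<circ> param c))"

definition smooth_map :: "('m::topological_space, 'n::finite) riemannian \<Rightarrow> ('m \<Rightarrow> 'm) \<Rightarrow> bool" where
  "smooth_map M h \<longleftrightarrow> continuous_on UNIV h \<and>
     (\<forall>c\<in>atlas M. \<forall>d\<in>atlas M.
        smooth_on (coord c ` (cdom c \<inter> h -` cdom d)) (coord d \<circ> h \<circ> param c))"

definition isometry :: "('m::topological_space, 'n::finite) riemannian \<Rightarrow> ('m \<Rightarrow> 'm) \<Rightarrow> bool" where
  "isometry M h \<longleftrightarrow> bij h \<and> smooth_map M h \<and> smooth_map M (inv h) \<and> preserves_metric M h"

text \<open>The Riemannian measure, with density $\sqrt{\det g}$ in every chart. On a second countable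
  manifold these conditions determine exactly one Borel measure.\<close>

definition riemannian_measure ::
    "('m::topological_space, 'n::finite) riemannian \<Rightarrow> 'm measure \<Rightarrow> bool" where
  "riemannian_measure M \<mu> \<longleftrightarrow> sets \<mu> = sets borel \<and>
     (\<forall>c\<in>atlas M. \<forall>S\<in>sets borel. S \<subseteq> cdom c \<longrightarrow>
        emeasure \<mu> S =
          (\<integral>\<^sup>+x. ennreal (sqrt (det (gram M c x))) * indicator (coord c ` S) x \<partial>lborel))"


section \<open>Gradient, divergence and Laplacian\<close>

text \<open>Vector fields are given by their components in the coordinates of a chart.\<close>

definition grad_in :: "('m, 'n::finite) riemannian \<Rightarrow> ('m, 'n) chart \<Rightarrow> ('m \<Rightarrow> real) \<Rightarrow> real^'n \<Rightarrow> real^'n" where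
  "grad_in M c f x = matrix_inv (gram M c x) *v (\<chi> i. partial i (f \<circ> param c) x)"

definition div_in :: "('m, 'n::finite) riemannian \<Rightarrow> ('m, 'n) chart \<Rightarrow> (real^'n \<Rightarrow> real^'n) \<Rightarrow> real^'n \<Rightarrow> real" where
  "div_in M c X x =
     (\<Sum>i\<in>UNIV. partial i (\<lambda>y. sqrt (det (gram M c y)) * X y $ i) x) / sqrt (det (gram M c x))"

definition grad_norm_sq_is :: "('m, 'n::finite) riemannian \<Rightarrow> ('m \<Rightarrow> real) \<Rightarrow> ('m \<Rightarrow> real) \<Rightarrow> bool" where
  "grad_norm_sq_is M f k \<longleftrightarrow> (\<forall>c\<in>atlas M. \<forall>x\<in>codom c.
     grad_in M c f x \<bullet> (gram M c x *v grad_in M c f x) = k (param c x))"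

text \<open>$\Delta f = k$, for the positive Laplacian $\Delta = -\mathrm{div}\,\nabla$.\<close>

definition laplacian_is :: "('m, 'n::finite) riemannian \<Rightarrow> ('m \<Rightarrow> real) \<Rightarrow> ('m \<Rightarrow> real) \<Rightarrow> bool" where
  "laplacian_is M f k \<longleftrightarrow> (\<forall>c\<in>atlas M. \<forall>x\<in>codom c.
     - div_in M c (grad_in M c f) x = k (param c x))"

definition eigenfunction ::
    "('m::topological_space, 'n::finite) riemannian \<Rightarrow> real \<Rightarrow> ('m \<Rightarrow> real) \<Rightarrow> bool" where
  "eigenfunction M \<kappa> f \<longleftrightarrow>
     smooth_function M f \<and> f \<noteq> (\<lambda>_. 0) \<and> laplacian_is M f (\<lambda>p. \<kappa> * f p)"

definition spectrum :: "('m::topological_space, 'n::finite) riemannian \<Rightarrow> real set" where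
  "spectrum M = {\<kappa>. \<exists>f. eigenfunction M \<kappa> f}"


section \<open>Riemannian distance\<close>

definition piecewise_C1_curve ::
    "('m::topological_space, 'n::finite) riemannian \<Rightarrow> (real \<Rightarrow> 'm) \<Rightarrow> bool" where
  "piecewise_C1_curve M \<gamma> \<longleftrightarrow> continuous_on {0..1} \<gamma> \<and>
     (\<exists>S. finite S \<and>
        (\<forall>c\<in>atlas M. (coord c \<circ> \<gamma>) C1_differentiable_on {s \<in> {0<..<1} - S. \<gamma> s \<in> cdom c}))"

text \<open>The speed does not depend on the chart that is used at \<^term>\<open>\<gamma> s\<close>.\<close>

definition curve_speed :: "('m, 'n::finite) riemannian \<Rightarrow> (real \<Rightarrow> 'm) \<Rightarrow> real \<Rightarrow> real" where
  "curve_speed M \<gamma> s =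
     (let c = (SOME c. c \<in> atlas M \<and> \<gamma> s \<in> cdom c);
          v = vector_derivative (coord c \<circ> \<gamma>) (at s)
      in sqrt (v \<bullet> (gram M c (coord c (\<gamma> s)) *v v)))"

text \<open>As in the library notion of piecewise continuous differentiability, the derivative need not be
  bounded near the breakpoints, so the length may be infinite; this does not affect the infimum.\<close>

definition curve_length :: "('m, 'n::finite) riemannian \<Rightarrow> (real \<Rightarrow> 'm) \<Rightarrow> ennreal" where
  "curve_length M \<gamma> = (\<integral>\<^sup>+s. ennreal (curve_speed M \<gamma> s) * indicator {0..1} s \<partial>lborel)"

definition rdist :: "('m::topological_space, 'n::finite) riemannian \<Rightarrow> 'm \<Rightarrow> 'm \<Rightarrow> real" where
  "rdist M p q =
     enn2real (INF \<gamma>\<in>{\<gamma>. piecewise_C1_curve M \<gamma> \<and> \<gamma> 0 = p \<and> \<gamma> 1 = q}. curve_length M \<gamma>)"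

definition rsetdist :: "('m::topological_space, 'n::finite) riemannian \<Rightarrow> 'm set \<Rightarrow> 'm set \<Rightarrow> real" where
  "rsetdist M P Q = (INF (p, q)\<in>P \<times> Q. rdist M p q)"


section \<open>Isoparametric functions\<close>

definition isoparametric ::
    "('m::topological_space, 'n::finite) riemannian \<Rightarrow> ('m \<Rightarrow> real) \<Rightarrow> real \<Rightarrow> real \<Rightarrow> bool" where
  "isoparametric M F a b \<longleftrightarrow> smooth_function M F \<and> a < b \<and> range F = {a..b} \<and>
     (\<exists>A B :: real \<Rightarrow> real. \<exists>U. open U \<and> {a..b} \<subseteq> U \<and> smooth_on U A \<and> smooth_on U B \<and>
        grad_norm_sq_is M F (A \<circ> F) \<and> laplacian_is M F (B \<circ> F))"

text \<open>Embedded submanifolds, via slice charts. The codimension (the cardinality of \<^term>\<open>K\<close>) may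
  differ between connected components.\<close>

definition submanifold_codim_ge ::
    "('m::topological_space, 'n::finite) riemannian \<Rightarrow> nat \<Rightarrow> 'm set \<Rightarrow> bool" where
  "submanifold_codim_ge M k S \<longleftrightarrow> (\<forall>p\<in>S. \<exists>d K.
     is_chart d \<and> (\<forall>c\<in>atlas M. smoothly_compatible c d) \<and> p \<in> cdom d \<and> k \<le> card K \<and>
     coord d ` (cdom d \<inter> S) = codom d \<inter> {x. \<forall>i\<in>K. x $ i = 0})"

definition focal_plus :: "('m \<Rightarrow> real) \<Rightarrow> real \<Rightarrow> 'm set" where
  "focal_plus F a = F -` {a}"

definition focal_minus :: "('m \<Rightarrow> real) \<Rightarrow> real \<Rightarrow> 'm set" where
  "focal_minus F b = F -` {b}"

definition proper_isoparametric ::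
    "('m::topological_space, 'n::finite) riemannian \<Rightarrow> ('m \<Rightarrow> real) \<Rightarrow> real \<Rightarrow> real \<Rightarrow> bool" where
  "proper_isoparametric M F a b \<longleftrightarrow> isoparametric M F a b \<and>
     submanifold_codim_ge M 2 (focal_plus F a) \<and> submanifold_codim_ge M 2 (focal_minus F b)"

definition rho :: "('m::topological_space, 'n::finite) riemannian \<Rightarrow> ('m \<Rightarrow> real) \<Rightarrow> real \<Rightarrow> 'm \<Rightarrow> real" where
  "rho M F a x = rsetdist M {x} (focal_plus F a)"

definition focal_distance ::
    "('m::topological_space, 'n::finite) riemannian \<Rightarrow> ('m \<Rightarrow> real) \<Rightarrow> real \<Rightarrow> real \<Rightarrow> real" where
  "focal_distance M F a b = rsetdist M (focal_plus F a) (focal_minus F b)"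

definition tube :: "('m::topological_space, 'n::finite) riemannian \<Rightarrow> ('m \<Rightarrow> real) \<Rightarrow> real \<Rightarrow> real \<Rightarrow> 'm set" where
  "tube M F a t = {x. rho M F a x < t}"

definition radial ::
    "('m::topological_space, 'n::finite) riemannian \<Rightarrow> ('m \<Rightarrow> real) \<Rightarrow> real \<Rightarrow> ('m \<Rightarrow> real) \<Rightarrow> bool" where
  "radial M F a f \<longleftrightarrow> (\<exists>\<psi>. f = \<psi> \<circ> rho M F a)"

definition radial_spectrum ::
    "('m::topological_space, 'n::finite) riemannian \<Rightarrow> ('m \<Rightarrow> real) \<Rightarrow> real \<Rightarrow> real set" where
  "radial_spectrum M F a = {\<kappa>. \<exists>f. eigenfunction M \<kappa> f \<and> radial M F a f}"

text \<open>\<^term>\<open>\<kappa>\<close> is the \<^term>\<open>k\<close>-th smallest radial eigenvalue, counting from 1.\<close>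

definition kth_radial_eigenvalue ::
    "('m::topological_space, 'n::finite) riemannian \<Rightarrow> ('m \<Rightarrow> real) \<Rightarrow> real \<Rightarrow> nat \<Rightarrow> real \<Rightarrow> bool" where
  "kth_radial_eigenvalue M F a k \<kappa> \<longleftrightarrow> \<kappa> \<in> radial_spectrum M F a \<and>
     finite {\<mu> \<in> radial_spectrum M F a. \<mu> \<le> \<kappa>} \<and> card {\<mu> \<in> radial_spectrum M F a. \<mu> \<le> \<kappa>} = k"

text \<open>Radial eigenfunctions are unique up to scaling, so it does not matter which one is taken
  for \<^term>\<open>\<phi>\<close>.\<close>

definition zero_radii_k ::
    "('m::topological_space, 'n::finite) riemannian \<Rightarrow> 'm measure \<Rightarrow> ('m \<Rightarrow> real) \<Rightarrow> real \<Rightarrow> real \<Rightarrow>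
     nat \<Rightarrow> real set" where
  "zero_radii_k M vol F a b k =
     {t. 0 < t \<and> t < focal_distance M F a b \<and>
         (\<exists>\<kappa> \<phi>. kth_radial_eigenvalue M F a k \<kappa> \<and> eigenfunction M \<kappa> \<phi> \<and> radial M F a \<phi> \<and>
                 set_lebesgue_integral vol (tube M F a t) \<phi> = 0)}"

definition zero_radii ::
    "('m::topological_space, 'n::finite) riemannian \<Rightarrow> 'm measure \<Rightarrow> ('m \<Rightarrow> real) \<Rightarrow> real \<Rightarrow> real \<Rightarrow>
     real set" where
  "zero_radii M vol F a b = (\<Union>k\<in>{1..}. zero_radii_k M vol F a b k)"


section \<open>The Pompeiu property\<close>

definition pompeiu_property ::
    "('m::topological_space, 'n::finite) riemannian \<Rightarrow> 'm measure \<Rightarrow> 'm set \<Rightarrow> bool" where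
  "pompeiu_property M vol \<Omega> \<longleftrightarrow>
     (\<forall>f :: 'm \<Rightarrow> real. continuous_on UNIV f \<and>
        (\<forall>h. isometry M h \<longrightarrow> set_lebesgue_integral vol (h ` \<Omega>) f = 0) \<longrightarrow> f = (\<lambda>_. 0))"

end

theory Submission
  imports Defs
begin

text \<open>
  Let \<open>\<phi>\<close> be a radial eigenfunction with eigenvalue \<open>\<kappa>\<close> whose integral over the tube
  \<open>\<Omega>\<close> vanishes. Then \<open>\<phi>\<close> itself shows that the Pompeiu property fails: the integral of
  \<open>\<phi>\<close> over \<open>h(\<Omega>)\<close> is the integral over \<open>\<Omega>\<close> of \<open>u = \<phi> \<circ> h\<close>, another eigenfunction for
  \<open>\<kappa>\<close>, and such an integral always vanishes, for the following reason.

  The tube is a sublevel set \<open>{F < s}\<close>, and \<open>\<phi> = g(F)\<close> is a function of the level. By the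
  divergence theorem, \<open>\<kappa>\<close> times the integral of \<open>\<phi>\<close> over \<open>\<Omega>\<close> is, up to sign, the flux of
  the gradient of \<open>\<phi>\<close> through the boundary, which is a nonzero multiple of \<open>g'(s)\<close>. So \<open>g'(s) = 0\<close>
  (\<open>vanishing_flux\<close>): on the boundary of \<open>\<Omega>\<close> the function \<open>\<phi>\<close> is a constant \<open>c = g(s)\<close> and
  its gradient vanishes. Hence Green's identity on \<open>\<Omega>\<close> for \<open>u\<close> and \<open>\<phi> - c\<close> has no boundary
  terms, and as both \<open>u\<close> and \<open>\<phi>\<close> have eigenvalue \<open>\<kappa>\<close>, all that it leaves is that
  \<open>\<kappa> c\<close> times the integral of \<open>u\<close> over \<open>\<Omega>\<close> is zero (\<open>integral_tube_eigenfunction\<close>). Here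
  \<open>c \<noteq> 0\<close>, because \<open>g\<close> solves a linear differential equation of second order and would
  otherwise vanish identically (\<open>radial_eigenfunction_Cauchy_zero\<close>), and \<open>\<kappa> \<noteq> 0\<close>, because for
  \<open>\<kappa> = 0\<close> the flux through every level is zero, so that \<open>\<phi>\<close> is a nonzero constant, whose
  integral over \<open>\<Omega>\<close> is not zero.

  Integrals over the boundary are expressed through cutoff functions of \<open>F\<close> that drop from 1
  to 0 just below the level \<open>s\<close>. With them, only Green's identity on the whole manifold is
  used, where the test function need only be continuously differentiable (\<open>Green\<close>, from
  a partition of unity). The eigenfunction \<open>\<phi> \<circ> h\<close> is only tested weakly
  (\<open>eigenfunction_isometry_weak\<close>), which reduces the invariance of the Laplacian to that of the
  inner product of gradients (\<open>grad_prod_compose\<close>) and of the measure (\<open>isometry_distr\<close>).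

  That the tube is a sublevel set (\<open>tube_level\<close>) comes from \<open>|\<nabla>F|\<^sup>2 = A(F)\<close>. Here \<open>A > 0\<close> between
  the extreme levels (\<open>A_pos\<close>), and with \<open>G' = 1 / \<surd>A\<close> the distance from the focal
  set is \<open>G(F)\<close> up to a constant. A curve between two levels is at least as long as the
  difference of their values of \<open>G\<close>, since \<open>G(F)\<close> has a gradient of length 1
  (\<open>curve_length_ge\<close>). Conversely, steepest descent gives curves of nearly this length; instead
  of integral curves of the gradient, short line segments are combined by a compactness
  argument (\<open>descent\<close>).
\<close>

section \<open>Continuously differentiable functions on Euclidean space\<close>

text \<open>Continuity is required of each directional derivative separately. In finite dimension this
  amounts to continuity of the derivative as a linear map.\<close>

definition C1_on :: "'a::euclidean_space set \<Rightarrow> ('a \<Rightarrow> 'b::real_normed_vector) \<Rightarrow> bool" where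
  "C1_on U f \<longleftrightarrow> (\<forall>x\<in>U. f differentiable at x) \<and>
     (\<forall>v. continuous_on U (\<lambda>x. frechet_derivative f (at x) v))"

lemma C1_onI:
  assumes "\<And>x. x \<in> U \<Longrightarrow> (f has_derivative f' x) (at x)"
    and "\<And>v. continuous_on U (\<lambda>x. f' x v)"
  shows "C1_on U f"
  unfolding C1_on_def
proof (intro conjI ballI allI)
  fix x assume "x \<in> U"
  then show "f differentiable at x"
    using assms(1) differentiableI by blast
next
  fix v
  have "continuous_on U (\<lambda>x. frechet_derivative f (at x) v) = continuous_on U (\<lambda>x. f' x v)"
    by (rule continuous_on_cong) (use frechet_derivative_at[OF assms(1)] in auto)
  then show "continuous_on U (\<lambda>x. frechet_derivative f (at x) v)"
    using assms(2) by simp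
qed

lemma C1_on_has_derivative:
  assumes "C1_on U f" "x \<in> U"
  shows "(f has_derivative frechet_derivative f (at x)) (at x)"
  using assms by (simp add: C1_on_def frechet_derivative_works[symmetric])

lemma C1_on_continuous_deriv:
  "C1_on U f \<Longrightarrow> continuous_on U (\<lambda>x. frechet_derivative f (at x) v)"
  by (simp add: C1_on_def)

lemma C1_on_continuous_on:
  assumes "C1_on U f"
  shows "continuous_on U f"
  using assms unfolding C1_on_def
  by (auto intro!: continuous_at_imp_continuous_on dest: differentiable_imp_continuous_within)

lemma C1_on_subset: "C1_on U f \<Longrightarrow> V \<subseteq> U \<Longrightarrow> C1_on V f"
  unfolding C1_on_def by (meson continuous_on_subset subsetD)

lemma C1_on_cong:
  assumes "open U" "\<And>x. x \<in> U \<Longrightarrow> f x = g x" "C1_on U g"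
  shows "C1_on U f"
proof (rule C1_onI)
  fix x assume "x \<in> U"
  then show "(f has_derivative frechet_derivative g (at x)) (at x)"
    using C1_on_has_derivative[OF assms(3)] assms(1,2)
    by (metis has_derivative_transform_within_open)
qed (rule C1_on_continuous_deriv[OF assms(3)])

lemma C1_on_const [simp]: "C1_on U (\<lambda>x. c)"
  by (rule C1_onI[where f'="\<lambda>x v. 0"]) auto

lemma C1_on_bounded_linear:
  assumes "bounded_linear L" "C1_on U f"
  shows "C1_on U (\<lambda>x. L (f x))"
proof (rule C1_onI)
  fix x assume "x \<in> U"
  then show "((\<lambda>x. L (f x)) has_derivative (\<lambda>v. L (frechet_derivative f (at x) v))) (at x)"
    by (intro bounded_linear.has_derivative[OF assms(1)] C1_on_has_derivative[OF assms(2)])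
next
  fix v show "continuous_on U (\<lambda>x. L (frechet_derivative f (at x) v))"
    by (intro bounded_linear.continuous_on[OF assms(1)] C1_on_continuous_deriv[OF assms(2)])
qed

lemma C1_on_add:
  assumes "C1_on U f" "C1_on U g"
  shows "C1_on U (\<lambda>x. f x + g x)"
  by (rule C1_onI[where f'="\<lambda>x v. frechet_derivative f (at x) v + frechet_derivative g (at x) v"])
    (auto intro!: derivative_eq_intros C1_on_has_derivative continuous_intros
       C1_on_continuous_deriv assms)

lemma C1_on_mult:
  fixes f g :: "'a::euclidean_space \<Rightarrow> real"
  assumes "C1_on U f" "C1_on U g"
  shows "C1_on U (\<lambda>x. f x * g x)"
  by (rule C1_onI[where f'="\<lambda>x v. f x * frechet_derivative g (at x) v
                                  + frechet_derivative f (at x) v * g x"])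
    (auto intro!: derivative_eq_intros C1_on_has_derivative continuous_intros
       C1_on_continuous_deriv C1_on_continuous_on[OF assms(1)] C1_on_continuous_on[OF assms(2)] assms)

lemma C1_on_sum:
  assumes "\<And>i. i \<in> I \<Longrightarrow> C1_on U (f i)"
  shows "C1_on U (\<lambda>x. \<Sum>i\<in>I. f i x)"
  using assms by (induction I rule: infinite_finite_induct) (auto intro: C1_on_add)

lemma C1_on_prod:
  fixes f :: "'i \<Rightarrow> 'a::euclidean_space \<Rightarrow> real"
  assumes "\<And>i. i \<in> I \<Longrightarrow> C1_on U (f i)"
  shows "C1_on U (\<lambda>x. \<Prod>i\<in>I. f i x)"
  using assms by (induction I rule: infinite_finite_induct) (auto intro: C1_on_mult)

lemma C1_on_real_comp:
  fixes f :: "'a::euclidean_space \<Rightarrow> real"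
  assumes "C1_on U f" "\<And>x. x \<in> U \<Longrightarrow> (q has_real_derivative q' (f x)) (at (f x))"
    and "continuous_on (f ` U) q'"
  shows "C1_on U (\<lambda>x. q (f x))"
proof (rule C1_onI)
  fix x assume x: "x \<in> U"
  show "((\<lambda>x. q (f x)) has_derivative (\<lambda>v. q' (f x) * frechet_derivative f (at x) v)) (at x)"
    using has_derivative_compose[OF C1_on_has_derivative[OF assms(1) x], of q "(*) (q' (f x))"]
      assms(2)[OF x] by (simp add: has_field_derivative_def)
next
  fix v show "continuous_on U (\<lambda>x. q' (f x) * frechet_derivative f (at x) v)"
    by (intro continuous_intros C1_on_continuous_deriv assms
        continuous_on_compose2[OF assms(3) C1_on_continuous_on[OF assms(1)]]) auto
qed

lemma C1_on_inverse:
  fixes f :: "'a::euclidean_space \<Rightarrow> real"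
  assumes "C1_on U f" "\<And>x. x \<in> U \<Longrightarrow> f x \<noteq> 0"
  shows "C1_on U (\<lambda>x. inverse (f x))"
  by (rule C1_on_real_comp[where q=inverse and q'="\<lambda>y. - (inverse y ^ 2)"])
    (use assms in \<open>auto intro!: derivative_eq_intros continuous_intros simp: power2_eq_square\<close>)

lemma C1_on_divide:
  fixes f g :: "'a::euclidean_space \<Rightarrow> real"
  assumes "C1_on U f" "C1_on U g" "\<And>x. x \<in> U \<Longrightarrow> g x \<noteq> 0"
  shows "C1_on U (\<lambda>x. f x / g x)"
  unfolding divide_inverse by (intro C1_on_mult C1_on_inverse assms)

lemma C1_on_sqrt:
  fixes f :: "'a::euclidean_space \<Rightarrow> real"
  assumes "C1_on U f" "\<And>x. x \<in> U \<Longrightarrow> f x > 0"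
  shows "C1_on U (\<lambda>x. sqrt (f x))"
  by (rule C1_on_real_comp[where q=sqrt and q'="\<lambda>y. inverse (sqrt y) / 2"])
    (use assms in \<open>force intro!: derivative_eq_intros continuous_intros\<close>)+

lemma linear_eq_sum_Basis:
  fixes L :: "'a::euclidean_space \<Rightarrow> 'b::real_normed_vector"
  assumes "linear L"
  shows "L v = (\<Sum>b\<in>Basis. (v \<bullet> b) *\<^sub>R L b)"
proof -
  have "L v = L (\<Sum>b\<in>Basis. (v \<bullet> b) *\<^sub>R b)" by (simp add: euclidean_representation)
  also have "\<dots> = (\<Sum>b\<in>Basis. (v \<bullet> b) *\<^sub>R L b)"
    using assms by (simp add: linear_sum linear_scale)
  finally show ?thesis .
qed

lemma C1_on_deriv_continuous_compose:
  fixes f :: "'b::euclidean_space \<Rightarrow> 'c::real_normed_vector"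
  assumes "C1_on V f" "continuous_on U T" "T ` U \<subseteq> V" "continuous_on U w"
  shows "continuous_on U (\<lambda>x. frechet_derivative f (at (T x)) (w x))"
proof -
  have "continuous_on U (\<lambda>x. \<Sum>b\<in>Basis. (w x \<bullet> b) *\<^sub>R frechet_derivative f (at (T x)) b)"
    by (intro continuous_intros assms
        continuous_on_compose2[OF C1_on_continuous_deriv[OF assms(1)] assms(2,3)])
  moreover have "frechet_derivative f (at (T x)) (w x) =
      (\<Sum>b\<in>Basis. (w x \<bullet> b) *\<^sub>R frechet_derivative f (at (T x)) b)" if "x \<in> U" for x
    using that assms(1,3) C1_on_has_derivative has_derivative_linear
    by (intro linear_eq_sum_Basis) blast
  ultimately show ?thesis
    by (simp cong: continuous_on_cong)
qed

lemma C1_on_compose: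
  fixes f :: "'b::euclidean_space \<Rightarrow> 'c::real_normed_vector"
  assumes "C1_on V f" "C1_on U T" "T ` U \<subseteq> V"
  shows "C1_on U (\<lambda>x. f (T x))"
proof (rule C1_onI)
  fix x assume x: "x \<in> U"
  show "((\<lambda>x. f (T x)) has_derivative
      (\<lambda>v. frechet_derivative f (at (T x)) (frechet_derivative T (at x) v))) (at x)"
    using has_derivative_compose[OF C1_on_has_derivative[OF assms(2) x]
        C1_on_has_derivative[OF assms(1)]] x assms(3) by blast
next
  fix v show "continuous_on U
      (\<lambda>x. frechet_derivative f (at (T x)) (frechet_derivative T (at x) v))"
    by (intro C1_on_deriv_continuous_compose[OF assms(1)] C1_on_continuous_on[OF assms(2)]
        assms C1_on_continuous_deriv[OF assms(2)])
qed

lemma smooth_on_imp_C1_on: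
  assumes "smooth_on U f"
  shows "C1_on U f"
proof -
  have "Ck_on (Suc 0) f U" using assms unfolding smooth_on_def by blast
  then show ?thesis by (simp add: C1_on_def)
qed

lemma smooth_on_frechet_derivative:
  assumes "smooth_on U f"
  shows "smooth_on U (\<lambda>x. frechet_derivative f (at x) v)"
  unfolding smooth_on_def
proof
  fix k
  have "Ck_on (Suc k) f U" using assms unfolding smooth_on_def by blast
  then show "Ck_on k (\<lambda>x. frechet_derivative f (at x) v) U" by simp
qed

lemma C1_on_det:
  fixes A :: "'a::euclidean_space \<Rightarrow> real^'n^'n"
  assumes "\<And>i j. C1_on U (\<lambda>x. A x $ i $ j)"
  shows "C1_on U (\<lambda>x. det (A x))"
  unfolding det_def by (intro C1_on_sum C1_on_mult C1_on_prod assms C1_on_const)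

lemma
  fixes A :: "real^'n^'n"
  assumes "det A \<noteq> 0"
  shows matrix_mul_matrix_inv: "A ** matrix_inv A = mat 1"
    and matrix_inv_mul_matrix: "matrix_inv A ** A = mat 1"
proof -
  have "\<exists>B. A ** B = mat 1 \<and> B ** A = mat 1"
    using assms invertible_det_nz[of A] by (simp add: invertible_def)
  then have "A ** matrix_inv A = mat 1 \<and> matrix_inv A ** A = mat 1"
    unfolding matrix_inv_def by (rule someI_ex)
  then show "A ** matrix_inv A = mat 1" "matrix_inv A ** A = mat 1" by auto
qed

text \<open>Cramer's rule makes it visible that the solution of a linear system is as smooth as its
  coefficients.\<close>

lemma matrix_inv_cramer:
  fixes A :: "real^'n^'n"
  assumes "det A \<noteq> 0"
  shows "matrix_inv A *v b = (\<chi> k. det (\<chi> i j. if j = k then b $ i else A $ i $ j) / det A)"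
proof -
  have "A *v (matrix_inv A *v b) = b"
    using matrix_mul_matrix_inv[OF assms] by (simp add: matrix_vector_mul_assoc)
  then show ?thesis using cramer[OF assms] by blast
qed

lemma C1_on_matrix_inv:
  fixes A :: "'a::euclidean_space \<Rightarrow> real^'n^'n"
  assumes "\<And>i j. C1_on U (\<lambda>x. A x $ i $ j)" "\<And>i. C1_on U (\<lambda>x. b x $ i)"
    and nz: "\<And>x. x \<in> U \<Longrightarrow> det (A x) \<noteq> 0" and "open U"
  shows "C1_on U (\<lambda>x. (matrix_inv (A x) *v b x) $ k)"
proof (rule C1_on_cong[OF \<open>open U\<close>])
  show "(matrix_inv (A x) *v b x) $ k =
     det (\<chi> i j. if j = k then b x $ i else A x $ i $ j) / det (A x)" if "x \<in> U" for x
    using matrix_inv_cramer[OF nz[OF that]] by simp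
  have "C1_on U (\<lambda>x. (\<chi> i j. if j = k then b x $ i else A x $ i $ j) $ i $ j)" for i j
    by (cases "j = k") (simp_all add: assms)
  then show "C1_on U (\<lambda>x. det (\<chi> i j. if j = k then b x $ i else A x $ i $ j) / det (A x))"
    by (intro C1_on_divide C1_on_det assms nz)
qed

lemma C1_on_locally:
  assumes "\<And>x. x \<in> U \<Longrightarrow> \<exists>V. open V \<and> x \<in> V \<and> C1_on V f"
  shows "C1_on U f"
  unfolding C1_on_def
proof (intro conjI ballI allI)
  fix x assume "x \<in> U"
  then show "f differentiable at x" using assms unfolding C1_on_def by blast
next
  fix v
  show "continuous_on U (\<lambda>x. frechet_derivative f (at x) v)"
  proof (rule continuous_at_imp_continuous_on, rule ballI)
    fix x assume "x \<in> U"
    then obtain V where "open V" "x \<in> V" "C1_on V f" using assms by blast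
    then show "isCont (\<lambda>x. frechet_derivative f (at x) v) x"
      using C1_on_continuous_deriv continuous_on_eq_continuous_at by blast
  qed
qed

section \<open>Integrals of derivatives\<close>

text \<open>The integral of a difference quotient vanishes because Lebesgue measure is translation
  invariant, and the difference quotients converge boundedly to the derivative.\<close>

lemma integral_derivative_compact_support:
  fixes f :: "'a::euclidean_space \<Rightarrow> real"
  assumes C1: "C1_on UNIV f" and supp: "\<And>x. norm x > R \<Longrightarrow> f x = 0"
  shows "integrable lborel (\<lambda>x. frechet_derivative f (at x) v)" (is ?th1)
    and "integral\<^sup>L lborel (\<lambda>x. frechet_derivative f (at x) v) = 0" (is ?th2)
proof -
  define D where "D = (\<lambda>x. frechet_derivative f (at x))"
  have D: "(f has_derivative D x) (at x)" for x
    unfolding D_def using C1_on_has_derivative[OF C1] by simp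
  have contf: "continuous_on UNIV f" using C1_on_continuous_on[OF C1] .
  define S where "S = cball (0::'a) (R + norm v)"
  have "bounded ((\<lambda>x. D x v) ` S)"
    unfolding D_def S_def
    by (intro compact_imp_bounded compact_continuous_image
        continuous_on_subset[OF C1_on_continuous_deriv[OF C1]]) auto
  then obtain B where B: "\<And>x. x \<in> S \<Longrightarrow> \<bar>D x v\<bar> \<le> B" unfolding bounded_iff by auto
  have Dout: "D x v = 0" if "norm x > R" for x
  proof -
    have "eventually (\<lambda>y. y \<in> {y. norm y > R}) (nhds x)"
      by (rule eventually_nhds_in_open) (use that in \<open>auto intro: open_Collect_less continuous_intros\<close>)
    then have ev: "eventually (\<lambda>y. f y = 0) (nhds x)"
      by eventually_elim (auto simp: supp)
    have "(f has_derivative (\<lambda>_. 0)) (at x)"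
      by (rule has_derivative_transform_eventually[OF has_derivative_const])
        (use ev supp[OF that] in \<open>auto simp: eventually_at_filter elim: eventually_mono\<close>)
    then show ?thesis using has_derivative_unique[OF D] by metis
  qed
  have B': "\<bar>D x v\<bar> \<le> max B 0" for x
  proof (cases "norm x > R")
    case False
    then have "x \<in> S" by (simp add: S_def) (smt (verit) norm_ge_zero)
    then show ?thesis using B by fastforce
  qed (simp add: Dout)
  define q where "q = (\<lambda>(n::nat) x. (f (x + v /\<^sub>R real (Suc n)) - f x) * real (Suc n))"
  have shift: "((\<lambda>t. f (x + t *\<^sub>R v)) has_real_derivative D (x + t *\<^sub>R v) v) (at t)" for x t
  proof -
    have "((\<lambda>t. x + t *\<^sub>R v) has_derivative (\<lambda>h. h *\<^sub>R v)) (at t)"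
      by (auto intro!: derivative_eq_intros)
    from has_derivative_compose[OF this D]
    have "((\<lambda>t. f (x + t *\<^sub>R v)) has_derivative (\<lambda>h. D (x + t *\<^sub>R v) (h *\<^sub>R v))) (at t)" .
    moreover have "D (x + t *\<^sub>R v) (h *\<^sub>R v) = D (x + t *\<^sub>R v) v * h" for h
      using linear_scale[OF has_derivative_linear[OF D]] by simp
    ultimately show ?thesis by (simp add: has_field_derivative_def)
  qed
  have qb: "\<bar>q n x\<bar> \<le> max B 0 * indicator S x" for n x
  proof (cases "x \<in> S")
    case True
    obtain t where t: "f (x + (1 / real (Suc n)) *\<^sub>R v) - f (x + 0 *\<^sub>R v)
        = (1 / real (Suc n) - 0) * D (x + t *\<^sub>R v) v"
      using MVT2[of 0 "1 / real (Suc n)" "\<lambda>t. f (x + t *\<^sub>R v)" "\<lambda>t. D (x + t *\<^sub>R v) v"] shift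
      by auto
    then have "q n x = D (x + t *\<^sub>R v) v"
      by (simp add: q_def inverse_eq_divide field_simps)
    then show ?thesis using B' True by simp
  next
    case False
    then have "norm x > R + norm v" by (auto simp: S_def)
    moreover have "norm (x + v /\<^sub>R real (Suc n)) \<ge> norm x - norm v"
    proof -
      have "norm (v /\<^sub>R real (Suc n)) \<le> norm v"
        by (simp add: divide_simps mult_left_le mult_le_cancel_left1 algebra_simps)
      then show ?thesis using norm_triangle_ineq4[of "x + v /\<^sub>R real (Suc n)" "v /\<^sub>R real (Suc n)"]
        by simp
    qed
    moreover have "norm v \<ge> 0" by simp
    ultimately have "norm x > R" "norm (x + v /\<^sub>R real (Suc n)) > R" by linarith+
    then show ?thesis using supp False by (simp add: q_def)
  qed
  have lim: "(\<lambda>n. q n x) \<longlonglongrightarrow> D x v" for x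
  proof -
    have "((\<lambda>h. (f (x + h *\<^sub>R v) - f x) / h) \<longlongrightarrow> D x v) (at 0)"
      using shift[of x 0] by (simp add: has_field_derivative_iff)
    then have "((\<lambda>n. (f (x + inverse (real (Suc n)) *\<^sub>R v) - f x) / inverse (real (Suc n)))
        \<longlonglongrightarrow> D x v)"
      by (rule filterlim_compose)
        (auto simp: filterlim_at simp del: of_nat_Suc intro!: LIMSEQ_inverse_real_of_nat)
    then show ?thesis unfolding q_def by (simp add: field_simps)
  qed
  have intf: "integrable lborel f"
  proof -
    have "set_integrable lborel (cball 0 R) f"
      unfolding set_integrable_def
      by (rule borel_integrable_compact) (use contf continuous_on_subset in auto)
    moreover have "f = (\<lambda>x. indicator (cball 0 R) x *\<^sub>R f x)"
      using supp by (auto simp: indicator_def fun_eq_iff)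
    ultimately show ?thesis unfolding set_integrable_def by simp
  qed
  have "integral\<^sup>L lborel (q n) = 0" for n
  proof -
    have 1: "integral\<^sup>L lborel (\<lambda>x. f (x + w)) = integral\<^sup>L lborel f" for w
      unfolding add.commute[of _ w]
      by (subst lborel_distr_plus[of w, symmetric], subst integral_distr)
        (use intf in auto)
    have 2: "integrable lborel (\<lambda>x. f (x + w))" for w
      unfolding add.commute[of _ w]
      using intf lborel_distr_plus[of w] integrable_distr[of "(+) w" lborel borel f] by simp
    define w where "w = v /\<^sub>R real (Suc n)"
    have "integral\<^sup>L lborel (q n) = integral\<^sup>L lborel (\<lambda>x. f (x + w) - f x) * real (Suc n)"
      unfolding q_def w_def[symmetric] by (rule integral_mult_left_zero)
    also have "\<dots> = 0"
      using Bochner_Integration.integral_diff[OF 2[of w] intf] 1[of w] by simp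
    finally show ?thesis .
  qed
  note 0 = this
  have conv: "integrable lborel (\<lambda>x. D x v)"
    "(\<lambda>n. integral\<^sup>L lborel (q n)) \<longlonglongrightarrow> integral\<^sup>L lborel (\<lambda>x. D x v)"
  proof -
    have m1: "(\<lambda>x. D x v) \<in> borel_measurable lborel"
      unfolding D_def using C1_on_continuous_deriv[OF C1]
      by (simp add: borel_measurable_continuous_onI)
    have m2: "q n \<in> borel_measurable lborel" for n
      unfolding q_def
      by (simp, intro borel_measurable_continuous_onI continuous_intros
          continuous_on_compose2[OF contf]) auto
    have w: "integrable lborel (\<lambda>x. max B 0 * indicator S x)"
      unfolding S_def by (auto intro!: integrable_mult_right integrable_real_indicator
          emeasure_lborel_cball_finite)
    have l: "AE x in lborel. (\<lambda>n. q n x) \<longlonglongrightarrow> D x v"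
      and b: "\<And>n. AE x in lborel. norm (q n x) \<le> max B 0 * indicator S x"
      using lim qb by auto
    show "integrable lborel (\<lambda>x. D x v)" by (rule integrable_dominated_convergence[OF m1 m2 w l b])
    show "(\<lambda>n. integral\<^sup>L lborel (q n)) \<longlonglongrightarrow> integral\<^sup>L lborel (\<lambda>x. D x v)"
      by (rule integral_dominated_convergence[OF m1 m2 w l b])
  qed
  show ?th1 using conv(1) by (simp only: D_def)
  have "(\<lambda>n::nat. 0 :: real) \<longlonglongrightarrow> integral\<^sup>L lborel (\<lambda>x. D x v)"
    using conv(2) by (simp only: 0)
  then show ?th2 by (simp only: LIMSEQ_const_iff D_def)
qed

section \<open>Positive definite matrices\<close>

lemma matrix_transpose_inner:
  fixes G :: "real^'n^'n"
  shows "(G *v v) \<bullet> w = v \<bullet> (transpose G *v w)"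
  by (metis dot_lmul_matrix inner_commute transpose_matrix_vector)

lemma continuous_on_det:
  fixes A :: "'a::topological_space \<Rightarrow> real^'n^'n"
  assumes "\<And>i j. continuous_on S (\<lambda>x. A x $ i $ j)"
  shows "continuous_on S (\<lambda>x. det (A x))"
  unfolding det_def by (intro continuous_intros assms)

locale positive_definite =
  fixes G :: "real^'n^'n"
  assumes sym: "transpose G = G" and pos: "\<And>v. v \<noteq> 0 \<Longrightarrow> v \<bullet> (G *v v) > 0"
begin

lemma inner_sym: "(G *v v) \<bullet> w = v \<bullet> (G *v w)"
  using matrix_transpose_inner[of G v w] sym by simp

lemma nonneg: "v \<bullet> (G *v v) \<ge> 0"
  using pos[of v] by (cases "v = 0") auto

lemma det_nz: "det G \<noteq> 0"
proof -
  have "v = 0" if "G *v v = 0" for v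
    using pos[of v] that by force
  then show ?thesis
    by (metis invertible_det_nz invertible_left_inverse matrix_left_invertible_ker)
qed

text \<open>The determinant does not vanish on the segment from the identity to the matrix.\<close>

lemma det_pos: "det G > 0"
proof (rule ccontr)
  assume "\<not> det G > 0"
  define H where "H t = t *\<^sub>R G + (1 - t) *\<^sub>R (mat 1 :: real^'n^'n)" for t
  have "\<exists>t\<ge>0. t \<le> 1 \<and> det (H t) = 0"
  proof (rule IVT2')
    show "det (H 1) \<le> 0" using \<open>\<not> det G > 0\<close> by (simp add: H_def)
    show "0 \<le> det (H 0)" by (simp add: H_def)
    show "continuous_on {0..1} (\<lambda>t. det (H t))"
      unfolding H_def by (intro continuous_on_det continuous_intros)
  qed auto
  then obtain t where t: "0 \<le> t" "t \<le> 1" "det (H t) = 0" by auto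
  interpret H: positive_definite "H t"
  proof
    show "transpose (H t) = H t"
      using sym by (simp add: H_def transpose_def vec_eq_iff mat_def)
    fix v :: "real^'n" assume v: "v \<noteq> 0"
    have "v \<bullet> (H t *v v) = t * (v \<bullet> (G *v v)) + (1 - t) * (v \<bullet> v)"
      by (simp add: H_def matrix_vector_mult_add_rdistrib inner_add_right scaleR_matrix_vector_assoc[symmetric])
    moreover have "t * (v \<bullet> (G *v v)) + (1 - t) * (v \<bullet> v) > 0"
    proof (cases "t = 0")
      case False
      then have "t * (v \<bullet> (G *v v)) > 0" using t pos[OF v] by auto
      then show ?thesis using t by (simp add: add_pos_nonneg)
    qed (use v in simp)
    ultimately show "v \<bullet> (H t *v v) > 0" by simp
  qed
  show False using H.det_nz t by simp
qed

lemma mult_inv: "G *v (matrix_inv G *v b) = b"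
  using matrix_mul_matrix_inv[OF det_nz] by (simp add: matrix_vector_mul_assoc)

lemma inv_sym: "(matrix_inv G *v b) \<bullet> b' = b \<bullet> (matrix_inv G *v b')"
  by (metis inner_sym mult_inv)

text \<open>The dual norm of a covector \<open>b\<close> is the norm of the vector that represents it, which is
  the solution \<open>X\<close> of \<open>G X = b\<close>.\<close>

lemma Cauchy_Schwarz:
  "(b \<bullet> v)\<^sup>2 \<le> (b \<bullet> (matrix_inv G *v b)) * (v \<bullet> (G *v v))"
proof -
  define X where "X = matrix_inv G *v b"
  define q where "q = X \<bullet> (G *v X)"
  define r where "r = v \<bullet> (G *v X)"
  have b: "b = G *v X" by (simp add: X_def mult_inv)
  have q: "b \<bullet> X = q" and r: "b \<bullet> v = r"
    unfolding b q_def r_def by (simp_all add: inner_commute)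
  show ?thesis
  proof (cases "X = 0")
    case False
    then have "q > 0" using pos q_def by blast
    have "0 \<le> (q *\<^sub>R v - r *\<^sub>R X) \<bullet> (G *v (q *\<^sub>R v - r *\<^sub>R X))" by (rule nonneg)
    also have "\<dots> = q\<^sup>2 * (v \<bullet> (G *v v)) - 2 * q * r\<^sup>2 + r\<^sup>2 * q"
    proof -
      have "X \<bullet> (G *v v) = r" unfolding r_def by (metis inner_commute inner_sym)
      then show ?thesis
        by (simp add: matrix_vector_mult_diff_distrib matrix_vector_mult_scaleR inner_diff_left
            inner_diff_right r_def[symmetric] q_def[symmetric] power2_eq_square algebra_simps)
    qed
    also have "\<dots> = q * (q * (v \<bullet> (G *v v)) - r\<^sup>2)"
      by (simp add: power2_eq_square algebra_simps)
    finally have "r\<^sup>2 \<le> q * (v \<bullet> (G *v v))"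
      using \<open>q > 0\<close> by (simp add: zero_le_mult_iff)
    then show ?thesis using q r by (simp add: X_def)
  qed (use b in simp)
qed

end


section \<open>Charts\<close>

lemma is_chart_facts:
  assumes "is_chart c"
  shows "open (cdom c)" "open (codom c)"
    "\<And>p. p \<in> cdom c \<Longrightarrow> param c (coord c p) = p" "\<And>x. x \<in> codom c \<Longrightarrow> coord c (param c x) = x"
    "\<And>p. p \<in> cdom c \<Longrightarrow> coord c p \<in> codom c" "\<And>x. x \<in> codom c \<Longrightarrow> param c x \<in> cdom c"
    "continuous_on (cdom c) (coord c)" "continuous_on (codom c) (param c)"
    "inj_on (coord c) (cdom c)"
proof -
  have h: "homeomorphism (cdom c) (codom c) (coord c) (param c)"
    using assms by (simp add: is_chart_def)
  show "open (cdom c)" "open (codom c)" using assms by (simp_all add: is_chart_def)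
  show p: "param c (coord c p) = p" if "p \<in> cdom c" for p
    using h that by (simp add: homeomorphism_apply1)
  show "coord c (param c x) = x" if "x \<in> codom c" for x
    using h that by (simp add: homeomorphism_apply2)
  show "coord c p \<in> codom c" if "p \<in> cdom c" for p using that by (simp add: codom_def)
  show "param c x \<in> cdom c" if "x \<in> codom c" for x
    using h that homeomorphism_image2 by blast
  show "continuous_on (cdom c) (coord c)" "continuous_on (codom c) (param c)"
    using h by (auto simp: homeomorphism_def)
  show "inj_on (coord c) (cdom c)" using p by (rule inj_on_inverseI)
qed

lemma chart_image_open:
  assumes "is_chart c" "open W"
  shows "open (coord c ` (cdom c \<inter> W))"
proof -
  note c = is_chart_facts[OF assms(1)]
  have "coord c ` (cdom c \<inter> W) = codom c \<inter> param c -` W"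
  proof (intro equalityI subsetI)
    fix x assume "x \<in> codom c \<inter> param c -` W"
    then have "x = coord c (param c x)" "param c x \<in> cdom c \<inter> W" using c by auto
    then show "x \<in> coord c ` (cdom c \<inter> W)" by blast
  qed (use c in auto)
  then show ?thesis
    using continuous_on_open_vimage[OF c(2)] c(8) assms(2) by (metis Int_commute)
qed

section \<open>Gradients in coordinates\<close>

definition chart_diff :: "('m, 'n::finite) chart \<Rightarrow> ('m \<Rightarrow> real) \<Rightarrow> real^'n \<Rightarrow> real^'n" where
  "chart_diff c f x = (\<chi> i. partial i (f \<circ> param c) x)"

text \<open>The Riemannian inner product of two gradients is the differential of one function applied to
  the gradient of the other.\<close>

definition grad_prod_in ::
    "('m, 'n::finite) riemannian \<Rightarrow> ('m, 'n) chart \<Rightarrow> ('m \<Rightarrow> real) \<Rightarrow> ('m \<Rightarrow> real) \<Rightarrow> real^'n \<Rightarrow> real" where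
  "grad_prod_in M c f h x = chart_diff c f x \<bullet> grad_in M c h x"

text \<open>The same at a point of the manifold. The value does not depend on the chosen chart,
  by \<open>grad_prod_eq\<close> below.\<close>

definition grad_prod ::
    "('m, 'n::finite) riemannian \<Rightarrow> ('m \<Rightarrow> real) \<Rightarrow> ('m \<Rightarrow> real) \<Rightarrow> 'm \<Rightarrow> real" where
  "grad_prod M f h p = (let c = (SOME c. c \<in> atlas M \<and> p \<in> cdom c) in grad_prod_in M c f h (coord c p))"

definition C1_fun :: "('m::topological_space, 'n::finite) riemannian \<Rightarrow> ('m \<Rightarrow> real) \<Rightarrow> bool" where
  "C1_fun M f \<longleftrightarrow> (\<forall>c\<in>atlas M. C1_on (codom c) (f \<circ> param c))"

lemma grad_in_alt: "grad_in M c f x = matrix_inv (gram M c x) *v chart_diff c f x"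
  by (simp add: grad_in_def chart_diff_def)

lemma has_derivative_chart_diff:
  assumes "(f \<circ> param c) differentiable at x"
  shows "((f \<circ> param c) has_derivative (\<lambda>v. chart_diff c f x \<bullet> v)) (at x)"
proof -
  let ?D = "frechet_derivative (f \<circ> param c) (at x)"
  have D: "((f \<circ> param c) has_derivative ?D) (at x)"
    using assms frechet_derivative_works by blast
  have "?D v = chart_diff c f x \<bullet> v" for v
  proof -
    have "?D v = ?D (\<Sum>i\<in>UNIV. v $ i *\<^sub>R axis i 1)"
      by (metis basis_expansion scalar_mult_eq_scaleR)
    also have "\<dots> = (\<Sum>i\<in>UNIV. v $ i *\<^sub>R ?D (axis i 1))"
      using has_derivative_linear[OF D] by (simp add: linear_sum linear_scale)
    finally show ?thesis
      by (simp add: chart_diff_def partial_def inner_vec_def mult.commute)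
  qed
  then show ?thesis using D by (metis (no_types, lifting) ext)
qed

lemma chart_diff_unique:
  assumes "((f \<circ> param c) has_derivative (\<lambda>v. w \<bullet> v)) (at x)"
  shows "chart_diff c f x = w"
proof -
  have "frechet_derivative (f \<circ> param c) (at x) = (\<lambda>v. w \<bullet> v)"
    using frechet_derivative_at[OF assms] by simp
  then show ?thesis
    by (simp add: chart_diff_def partial_def vec_eq_iff inner_axis)
qed

lemma smooth_function_imp_C1_fun: "smooth_function M f \<Longrightarrow> C1_fun M f"
  by (simp add: smooth_function_def C1_fun_def smooth_on_imp_C1_on)

lemma C1_fun_const [simp]: "C1_fun M (\<lambda>x. k)"
  by (simp add: C1_fun_def o_def)

lemma C1_fun_add: "C1_fun M f \<Longrightarrow> C1_fun M g \<Longrightarrow> C1_fun M (\<lambda>x. f x + g x)"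
  by (simp add: C1_fun_def o_def C1_on_add)

lemma C1_fun_mult: "C1_fun M f \<Longrightarrow> C1_fun M g \<Longrightarrow> C1_fun M (\<lambda>x. f x * g x)"
  by (simp add: C1_fun_def o_def C1_on_mult)

lemma C1_fun_sum: "(\<And>i. i \<in> I \<Longrightarrow> C1_fun M (f i)) \<Longrightarrow> C1_fun M (\<lambda>x. \<Sum>i\<in>I. f i x)"
  by (simp add: C1_fun_def o_def C1_on_sum)

locale riemannian_mfd =
  fixes M :: "('m::t2_space, 'n::finite) riemannian"
  assumes riemannian: "riemannian_manifold M"
begin

lemma chart: "c \<in> atlas M \<Longrightarrow> is_chart c"
  using riemannian by (simp add: riemannian_manifold_def smooth_atlas_def)

lemmas chart_facts = is_chart_facts[OF chart]

lemma ex_chart: "\<exists>c\<in>atlas M. p \<in> cdom c"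
  using riemannian unfolding riemannian_manifold_def smooth_atlas_def by blast

lemma ex_chart_coord: "\<exists>c\<in>atlas M. \<exists>x\<in>codom c. p = param c x"
  using ex_chart[of p] chart_facts(3,5) by metis

lemma gram_pd: "c \<in> atlas M \<Longrightarrow> x \<in> codom c \<Longrightarrow> positive_definite (gram M c x)"
  using riemannian unfolding riemannian_manifold_def positive_definite_def by blast

lemma gram_C1: "c \<in> atlas M \<Longrightarrow> C1_on (codom c) (gram M c)"
  using riemannian unfolding riemannian_manifold_def by (simp add: smooth_on_imp_C1_on)

lemma gram_entry_C1:
  assumes "c \<in> atlas M"
  shows "C1_on (codom c) (\<lambda>x. gram M c x $ i $ j)"
  using C1_on_bounded_linear[OF bounded_linear_vec_nth[of j]
      C1_on_bounded_linear[OF bounded_linear_vec_nth[of i] gram_C1[OF assms]]] .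

lemma det_gram_pos: "c \<in> atlas M \<Longrightarrow> x \<in> codom c \<Longrightarrow> det (gram M c x) > 0"
  using gram_pd positive_definite.det_pos by blast

lemma sqrt_det_gram_C1:
  assumes "c \<in> atlas M"
  shows "C1_on (codom c) (\<lambda>x. sqrt (det (gram M c x)))"
  by (intro C1_on_sqrt C1_on_det gram_entry_C1 det_gram_pos assms)

lemma continuous_on_charts:
  fixes f :: "'m \<Rightarrow> 'b::topological_space"
  assumes "\<And>c. c \<in> atlas M \<Longrightarrow> continuous_on (codom c) (f \<circ> param c)"
  shows "continuous_on UNIV f"
proof (rule continuous_at_imp_continuous_on, rule ballI)
  fix p
  obtain c where c: "c \<in> atlas M" "p \<in> cdom c" using ex_chart by blast
  note cf = chart_facts[OF c(1)]
  have "continuous_on (cdom c) ((f \<circ> param c) \<circ> coord c)"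
    using continuous_on_compose[OF cf(7), of "f \<circ> param c"] assms[OF c(1)]
    by (simp add: codom_def)
  then have "continuous_on (cdom c) f"
    by (rule continuous_on_eq) (simp add: cf)
  then show "isCont f p" using c cf(1) continuous_on_eq_continuous_at by blast
qed

lemma C1_fun_D: "C1_fun M f \<Longrightarrow> c \<in> atlas M \<Longrightarrow> C1_on (codom c) (f \<circ> param c)"
  by (simp add: C1_fun_def)

lemma C1_fun_continuous:
  assumes "C1_fun M f"
  shows "continuous_on UNIV f"
  by (rule continuous_on_charts) (rule C1_on_continuous_on[OF C1_fun_D[OF assms]])

lemma C1_fun_has_derivative:
  assumes "C1_fun M f" "c \<in> atlas M" "x \<in> codom c"
  shows "((f \<circ> param c) has_derivative (\<lambda>v. chart_diff c f x \<bullet> v)) (at x)"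
  using has_derivative_chart_diff C1_fun_D[OF assms(1,2)] assms(3) unfolding C1_on_def by blast

lemma C1_fun_along_line:
  assumes "C1_fun M f" "c \<in> atlas M" "x + t *\<^sub>R v \<in> codom c"
  shows "((\<lambda>t. f (param c (x + t *\<^sub>R v))) has_real_derivative chart_diff c f (x + t *\<^sub>R v) \<bullet> v) (at t)"
proof -
  have "((\<lambda>t. x + t *\<^sub>R v) has_derivative (\<lambda>h. h *\<^sub>R v)) (at t)"
    by (auto intro!: derivative_eq_intros)
  from has_derivative_compose[OF this C1_fun_has_derivative[OF assms]]
  have "((\<lambda>t. (f \<circ> param c) (x + t *\<^sub>R v)) has_derivative
      (\<lambda>h. chart_diff c f (x + t *\<^sub>R v) \<bullet> (h *\<^sub>R v))) (at t)" .
  moreover have "(\<lambda>h. chart_diff c f (x + t *\<^sub>R v) \<bullet> (h *\<^sub>R v)) = (*) (chart_diff c f (x + t *\<^sub>R v) \<bullet> v)"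
    by (auto simp: fun_eq_iff)
  ultimately show ?thesis by (simp add: has_field_derivative_def)
qed

lemma C1_fun_real_comp:
  assumes "C1_fun M f" "\<And>x. (q has_real_derivative q' (f x)) (at (f x))"
    and "continuous_on (range f) q'"
  shows "C1_fun M (\<lambda>x. q (f x))"
  unfolding C1_fun_def
proof
  fix c assume "c \<in> atlas M"
  have "continuous_on ((f \<circ> param c) ` codom c) q'"
    using assms(3) by (rule continuous_on_subset) auto
  then show "C1_on (codom c) ((\<lambda>x. q (f x)) \<circ> param c)"
    using C1_on_real_comp[of "codom c" "f \<circ> param c" q q'] C1_fun_D[OF assms(1) \<open>c \<in> atlas M\<close>]
      assms(2) by (simp add: o_def)
qed

lemma C1_fun_divide:
  assumes "C1_fun M f" "C1_fun M g" "\<And>x. g x \<noteq> 0"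
  shows "C1_fun M (\<lambda>x. f x / g x)"
  using assms by (simp add: C1_fun_def o_def C1_on_divide)

lemma chart_diff_add:
  assumes "C1_fun M f" "C1_fun M h" "c \<in> atlas M" "x \<in> codom c"
  shows "chart_diff c (\<lambda>p. f p + h p) x = chart_diff c f x + chart_diff c h x"
  by (rule chart_diff_unique)
    (use has_derivative_add[OF C1_fun_has_derivative[OF assms(1,3,4)] C1_fun_has_derivative[OF assms(2,3,4)]]
      in \<open>simp add: o_def inner_add_left\<close>)

lemma chart_diff_mult:
  assumes "C1_fun M f" "C1_fun M h" "c \<in> atlas M" "x \<in> codom c"
  shows "chart_diff c (\<lambda>p. f p * h p) x = f (param c x) *\<^sub>R chart_diff c h x + h (param c x) *\<^sub>R chart_diff c f x"
  by (rule chart_diff_unique)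
    (use has_derivative_mult[OF C1_fun_has_derivative[OF assms(1,3,4)] C1_fun_has_derivative[OF assms(2,3,4)]]
      in \<open>simp add: o_def inner_add_left mult.commute\<close>)

lemma chart_diff_comp:
  assumes "C1_fun M f" "c \<in> atlas M" "x \<in> codom c"
    and "(q has_real_derivative q') (at (f (param c x)))"
  shows "chart_diff c (\<lambda>p. q (f p)) x = q' *\<^sub>R chart_diff c f x"
  by (rule chart_diff_unique)
    (use has_derivative_compose[OF C1_fun_has_derivative[OF assms(1-3)], of q "(*) q'"] assms(4)
      in \<open>simp add: o_def has_field_derivative_def\<close>)

lemma grad_prod_in_comm:
  assumes "c \<in> atlas M" "x \<in> codom c"
  shows "grad_prod_in M c f h x = grad_prod_in M c h f x"
  unfolding grad_prod_in_def grad_in_alt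
  using positive_definite.inv_sym[OF gram_pd[OF assms]] by (metis inner_commute)

lemma chart_diff_C1:
  assumes "smooth_function M f" "c \<in> atlas M"
  shows "C1_on (codom c) (\<lambda>x. chart_diff c f x $ i)"
proof -
  have "smooth_on (codom c) (f \<circ> param c)" using assms by (simp add: smooth_function_def)
  from smooth_on_imp_C1_on[OF smooth_on_frechet_derivative[OF this]]
  show ?thesis by (simp add: chart_diff_def partial_def)
qed

lemma grad_in_C1:
  assumes "smooth_function M f" "c \<in> atlas M"
  shows "C1_on (codom c) (\<lambda>x. grad_in M c f x $ i)"
  unfolding grad_in_def
proof (rule C1_on_matrix_inv)
  show "C1_on (codom c) (\<lambda>x. gram M c x $ i $ j)" for i j
    by (rule gram_entry_C1[OF assms(2)])
  show "C1_on (codom c) (\<lambda>x. (\<chi> i. partial i (f \<circ> param c) x) $ i)" for i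
    using chart_diff_C1[OF assms] by (simp add: chart_diff_def)
  show "det (gram M c x) \<noteq> 0" if "x \<in> codom c" for x
    using det_gram_pos[OF assms(2) that] by simp
  show "open (codom c)" using chart_facts(2)[OF assms(2)] .
qed

lemma grad_in_continuous:
  assumes "C1_fun M f" "c \<in> atlas M"
  shows "continuous_on (codom c) (grad_in M c f)"
proof -
  have "continuous_on (codom c) (\<lambda>x. \<chi> k. det (\<chi> i j. if j = k then chart_diff c f x $ i
      else gram M c x $ i $ j) / det (gram M c x))"
  proof (intro continuous_on_vec_lambda continuous_on_divide continuous_on_det ballI)
    fix k i j
    have "continuous_on (codom c) (\<lambda>x. if j = k then chart_diff c f x $ i else gram M c x $ i $ j)"
      using C1_on_continuous_deriv[OF C1_fun_D[OF assms]]
        C1_on_continuous_on[OF gram_entry_C1[OF assms(2)]]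
      by (cases "j = k") (simp_all add: chart_diff_def partial_def)
    then show "continuous_on (codom c) (\<lambda>x. (\<chi> i j. if j = k then chart_diff c f x $ i
      else gram M c x $ i $ j) $ i $ j)" by simp
  next
    show "det (gram M c x) \<noteq> 0" if "x \<in> codom c" for x
      using det_gram_pos[OF assms(2) that] by simp
  qed (rule C1_on_continuous_on[OF gram_entry_C1[OF assms(2)]])
  moreover have "(\<chi> k. det (\<chi> i j. if j = k then chart_diff c f x $ i
      else gram M c x $ i $ j) / det (gram M c x)) = grad_in M c f x" if "x \<in> codom c" for x
    using matrix_inv_cramer[of "gram M c x"] det_gram_pos[OF assms(2) that]
    by (simp add: grad_in_alt)
  ultimately show ?thesis by (rule continuous_on_eq)
qed

lemma chart_diff_continuous:
  assumes "C1_fun M f" "c \<in> atlas M"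
  shows "continuous_on (codom c) (chart_diff c f)"
  unfolding chart_diff_def partial_def
  by (intro continuous_intros C1_on_continuous_deriv C1_fun_D assms)

text \<open>In charts around a point and its image, the coordinate expression \<open>S\<close> of a smooth map is only
  meaningful on the coordinates \<open>V\<close> of points that are mapped into the second chart.\<close>

lemma smooth_map_local:
  assumes T: "smooth_map M T" and "c \<in> atlas M" "d \<in> atlas M"
  defines "V \<equiv> coord c ` (cdom c \<inter> T -` cdom d)" and "S \<equiv> coord d \<circ> T \<circ> param c"
  shows "open V" "C1_on V S" "\<And>x. x \<in> V \<Longrightarrow> x \<in> codom c \<and> S x \<in> codom d \<and> param d (S x) = T (param c x)"
proof -
  have "open (T -` cdom d)"
    using T chart_facts(1)[OF assms(3)] unfolding smooth_map_def
    by (metis continuous_on_open_vimage inf_top.right_neutral open_UNIV)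
  then show "open V" unfolding V_def by (rule chart_image_open[OF chart[OF assms(2)]])
  show "C1_on V S"
    using T assms(2,3) unfolding smooth_map_def V_def S_def by (intro smooth_on_imp_C1_on) blast
  show "\<And>x. x \<in> V \<Longrightarrow> x \<in> codom c \<and> S x \<in> codom d \<and> param d (S x) = T (param c x)"
    using chart_facts[OF assms(2)] chart_facts[OF assms(3)] unfolding V_def S_def by auto
qed

lemma C1_fun_compose:
  assumes T: "smooth_map M T" and f: "C1_fun M f"
  shows "C1_fun M (f \<circ> T)"
  unfolding C1_fun_def
proof (intro ballI C1_on_locally)
  fix c x assume c: "c \<in> atlas M" "x \<in> codom c"
  obtain d where d: "d \<in> atlas M" "T (param c x) \<in> cdom d" using ex_chart by blast
  let ?V = "coord c ` (cdom c \<inter> T -` cdom d)"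
  note L = smooth_map_local[OF T c(1) d(1)]
  have "C1_on ?V (\<lambda>x. (f \<circ> param d) ((coord d \<circ> T \<circ> param c) x))"
    by (rule C1_on_compose[OF C1_fun_D[OF f d(1)] L(2)]) (use L(3) in blast)
  then have "C1_on ?V (f \<circ> T \<circ> param c)"
    by (rule C1_on_cong[OF L(1), rotated]) (use L(3) in auto)
  moreover have "x \<in> ?V"
    using c d chart_facts[OF c(1)] by (intro image_eqI[of _ _ "param c x"]) auto
  ultimately show "\<exists>V. open V \<and> x \<in> V \<and> C1_on V (f \<circ> T \<circ> param c)" using L(1) by blast
qed

text \<open>The case of the identity says that the product does not depend on the chart, the general
  case that it is invariant under isometries.\<close>

lemma grad_prod_in_compose:
  assumes T: "smooth_map M T" "preserves_metric M T"
    and f: "C1_fun M f" and h: "C1_fun M h"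
    and c: "c \<in> atlas M" and d: "d \<in> atlas M" and p: "p \<in> cdom c" "T p \<in> cdom d"
  shows "grad_prod_in M c (f \<circ> T) (h \<circ> T) (coord c p) = grad_prod_in M d f h (coord d (T p))"
proof -
  let ?V = "coord c ` (cdom c \<inter> T -` cdom d)"
  define S where "S = coord d \<circ> T \<circ> param c"
  define x where "x = coord c p"
  define J where "J = jacobian S (at x)"
  note L = smooth_map_local[OF T(1) c d, folded S_def]
  have xV: "x \<in> ?V" using p by (auto simp: x_def)
  have pc: "param c x = p" using chart_facts[OF c] p by (simp add: x_def)
  have Sx: "S x = coord d (T p)" by (simp add: S_def pc)
  have x: "x \<in> codom c" using xV L(3) by blast
  have Sxd: "S x \<in> codom d" using L(3) xV by blast
  have SD: "(S has_derivative (\<lambda>v. J *v v)) (at x)"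
    using jacobian_works[of S "at x"] L(2) xV unfolding J_def C1_on_def by blast
  have diff: "chart_diff c (k \<circ> T) x = transpose J *v chart_diff d k (S x)" if "C1_fun M k" for k
  proof (rule chart_diff_unique)
    have "((\<lambda>y. (k \<circ> param d) (S y)) has_derivative (\<lambda>v. chart_diff d k (S x) \<bullet> (J *v v))) (at x)"
      by (rule has_derivative_compose[OF SD C1_fun_has_derivative[OF that d Sxd]])
    then have "((\<lambda>y. (k \<circ> param d) (S y)) has_derivative (\<lambda>v. (transpose J *v chart_diff d k (S x)) \<bullet> v)) (at x)"
      using matrix_transpose_inner[of "transpose J"] by simp
    then show "(k \<circ> T \<circ> param c has_derivative (\<lambda>v. (transpose J *v chart_diff d k (S x)) \<bullet> v)) (at x)"
      by (rule has_derivative_transform_within_open[OF _ L(1) xV]) (use L(3) in auto)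
  qed
  have G: "gram M c x = transpose J ** gram M d (S x) ** J"
    using T(2) c d p unfolding preserves_metric_def Let_def J_def S_def x_def
    using pc x_def by (simp add: o_def)
  interpret gc: positive_definite "gram M c x" using gram_pd[OF c x] .
  interpret gd: positive_definite "gram M d (S x)" using gram_pd[OF d Sxd] .
  have "det J \<noteq> 0" using gc.det_nz unfolding G by (auto simp: det_mul)
  \<comment> \<open>the gradient is pushed forward by the Jacobian\<close>
  have "J *v grad_in M c (h \<circ> T) x = grad_in M d h (S x)"
  proof -
    let ?X = "grad_in M c (h \<circ> T) x" and ?Y = "matrix_inv J *v grad_in M d h (S x)"
    have JY: "J *v ?Y = grad_in M d h (S x)"
      using matrix_mul_matrix_inv[OF \<open>det J \<noteq> 0\<close>] by (simp add: matrix_vector_mul_assoc)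
    have "gram M c x *v ?Y = transpose J *v (gram M d (S x) *v (J *v ?Y))"
      unfolding G by (simp add: matrix_vector_mul_assoc matrix_mul_assoc)
    also have "\<dots> = gram M c x *v ?X"
      unfolding JY by (simp add: grad_in_alt gd.mult_inv gc.mult_inv diff[OF h])
    finally have "?Y = ?X"
      using matrix_inv_mul_matrix[OF gc.det_nz] by (metis matrix_vector_mul_assoc matrix_vector_mul_lid)
    then show ?thesis using JY by simp
  qed
  then show "grad_prod_in M c (f \<circ> T) (h \<circ> T) (coord c p) = grad_prod_in M d f h (coord d (T p))"
    unfolding grad_prod_in_def x_def[symmetric] Sx[symmetric] diff[OF f]
    using matrix_transpose_inner[of "transpose J"] by simp
qed

lemma smooth_map_id: "smooth_map M id"
proof -
  have "smooth_on (coord c ` (cdom c \<inter> cdom d)) (coord d \<circ> param c)"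
    if "c \<in> atlas M" "d \<in> atlas M" for c d
    using riemannian that
    unfolding riemannian_manifold_def smooth_atlas_def smoothly_compatible_def by blast
  then show ?thesis unfolding smooth_map_def by simp
qed

lemma preserves_metric_id: "preserves_metric M id"
  using riemannian by (simp add: riemannian_manifold_def)

lemma grad_prod_eq:
  assumes "C1_fun M f" "C1_fun M h" "c \<in> atlas M" "p \<in> cdom c"
  shows "grad_prod M f h p = grad_prod_in M c f h (coord c p)"
proof -
  let ?d = "SOME c. c \<in> atlas M \<and> p \<in> cdom c"
  have "?d \<in> atlas M \<and> p \<in> cdom ?d" by (rule someI_ex) (use ex_chart in blast)
  then show ?thesis
    using grad_prod_in_compose[OF smooth_map_id preserves_metric_id assms(1,2), of ?d c p] assms
    by (simp add: grad_prod_def)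
qed

lemma grad_prod_param:
  assumes "C1_fun M f" "C1_fun M h" "c \<in> atlas M" "x \<in> codom c"
  shows "grad_prod M f h (param c x) = grad_prod_in M c f h x"
  using grad_prod_eq[OF assms(1-3), of "param c x"] chart_facts[OF assms(3)] assms(4) by simp

lemma grad_prod_compose:
  assumes "smooth_map M T" "preserves_metric M T" "C1_fun M f" "C1_fun M h"
  shows "grad_prod M (f \<circ> T) (h \<circ> T) p = grad_prod M f h (T p)"
proof -
  obtain c where c: "c \<in> atlas M" "p \<in> cdom c" using ex_chart by blast
  obtain d where d: "d \<in> atlas M" "T p \<in> cdom d" using ex_chart by blast
  note C1 = C1_fun_compose[OF assms(1,3)] C1_fun_compose[OF assms(1,4)]
  show ?thesis
    using grad_prod_eq[OF C1 c] grad_prod_eq[OF assms(3,4) d]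
      grad_prod_in_compose[OF assms c(1) d(1) c(2) d(2)] by simp
qed

lemma grad_prod_comm:
  assumes "C1_fun M f" "C1_fun M h"
  shows "grad_prod M f h p = grad_prod M h f p"
proof -
  obtain c x where c: "c \<in> atlas M" "x \<in> codom c" and p: "p = param c x"
    using ex_chart_coord by metis
  show ?thesis unfolding p using grad_prod_in_comm[OF c] assms c by (simp add: grad_prod_param)
qed

lemma grad_prod_continuous:
  assumes "C1_fun M f" "C1_fun M h"
  shows "continuous_on UNIV (grad_prod M f h)"
proof (rule continuous_on_charts)
  fix c assume c: "c \<in> atlas M"
  have "continuous_on (codom c) (grad_prod_in M c f h)"
    unfolding grad_prod_in_def
    by (intro continuous_intros chart_diff_continuous grad_in_continuous assms c)
  then show "continuous_on (codom c) (grad_prod M f h \<circ> param c)"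
    by (rule continuous_on_eq) (simp add: grad_prod_param[OF assms c])
qed

lemma grad_prod_C1_fun:
  assumes "smooth_function M f" "smooth_function M h"
  shows "C1_fun M (grad_prod M f h)"
  unfolding C1_fun_def
proof
  fix c assume c: "c \<in> atlas M"
  note C1 = smooth_function_imp_C1_fun[OF assms(1)] smooth_function_imp_C1_fun[OF assms(2)]
  show "C1_on (codom c) (grad_prod M f h \<circ> param c)"
  proof (rule C1_on_cong[OF chart_facts(2)[OF c]])
    show "(grad_prod M f h \<circ> param c) x = (\<Sum>i\<in>UNIV. chart_diff c f x $ i * grad_in M c h x $ i)"
      if "x \<in> codom c" for x
      using grad_prod_param[OF C1 c that] by (simp add: grad_prod_in_def inner_vec_def)
    show "C1_on (codom c) (\<lambda>x. \<Sum>i\<in>UNIV. chart_diff c f x $ i * grad_in M c h x $ i)"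
      by (intro C1_on_sum C1_on_mult chart_diff_C1 grad_in_C1 assms c)
  qed
qed

lemma grad_prod_mult:
  assumes "C1_fun M f" "C1_fun M g" "C1_fun M h"
  shows "grad_prod M (\<lambda>p. f p * g p) h p = f p * grad_prod M g h p + g p * grad_prod M f h p"
proof -
  obtain c x where c: "c \<in> atlas M" "x \<in> codom c" and p: "p = param c x"
    using ex_chart_coord by metis
  show ?thesis
    using chart_diff_mult[OF assms(1,2) c] assms c
    by (simp add: p grad_prod_param C1_fun_mult grad_prod_in_def inner_add_left)
qed

lemma grad_prod_add:
  assumes "C1_fun M f" "C1_fun M g" "C1_fun M h"
  shows "grad_prod M (\<lambda>p. f p + g p) h p = grad_prod M f h p + grad_prod M g h p"
proof -
  obtain c x where c: "c \<in> atlas M" "x \<in> codom c" and p: "p = param c x"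
    using ex_chart_coord by metis
  show ?thesis
    using chart_diff_add[OF assms(1,2) c] assms c
    by (simp add: p grad_prod_param C1_fun_add grad_prod_in_def inner_add_left)
qed

lemma grad_prod_real_comp:
  assumes "C1_fun M f" "C1_fun M h" "C1_fun M (\<lambda>p. q (f p))"
    and "(q has_real_derivative q') (at (f p))"
  shows "grad_prod M (\<lambda>p. q (f p)) h p = q' * grad_prod M f h p"
proof -
  obtain c x where c: "c \<in> atlas M" "x \<in> codom c" and p: "p = param c x"
    using ex_chart_coord by metis
  show ?thesis
    using chart_diff_comp[OF assms(1) c] assms c
    by (simp add: p grad_prod_param grad_prod_in_def)
qed

lemma grad_prod_const [simp]:
  assumes "C1_fun M h"
  shows "grad_prod M (\<lambda>p. k) h p = 0"
  using grad_prod_real_comp[OF C1_fun_const[of M 0] assms, of "\<lambda>_. k" 0] by simp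

end

section \<open>Change of variables\<close>

text \<open>Enumerating a finite index type turns it into a well-order. Through this copy, the change of
  variables theorem for well-ordered coordinate indices applies to arbitrary ones.\<close>

typedef 'n ordered_copy = "UNIV :: 'n set" ..

instance ordered_copy :: (finite) finite
proof
  have "surj (Abs_ordered_copy :: 'a \<Rightarrow> _)"
    by (metis Rep_ordered_copy_inverse surjI)
  then show "finite (UNIV :: 'a ordered_copy set)" by (metis finite finite_imageI)
qed

definition enumeration :: "'n::finite \<Rightarrow> nat" where
  "enumeration = (SOME f. inj f)"

lemma inj_enumeration: "inj (enumeration :: 'n::finite \<Rightarrow> nat)"
proof -
  have "\<exists>f :: 'n \<Rightarrow> nat. inj f"
    using finite_imp_inj_to_nat_seg[of "UNIV :: 'n set"] by auto
  then show ?thesis unfolding enumeration_def by (rule someI_ex)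
qed

instantiation ordered_copy :: (finite) wellorder
begin

definition "x \<le> y \<longleftrightarrow> enumeration (Rep_ordered_copy x) \<le> enumeration (Rep_ordered_copy y)"

definition "x < y \<longleftrightarrow> enumeration (Rep_ordered_copy x) < enumeration (Rep_ordered_copy y)"

instance
proof
  fix x y z :: "'a ordered_copy"
  show "(x < y) = (x \<le> y \<and> \<not> y \<le> x)"
    unfolding less_eq_ordered_copy_def less_ordered_copy_def by linarith
  show "x \<le> x" unfolding less_eq_ordered_copy_def by simp
  show "x \<le> z" if "x \<le> y" "y \<le> z"
    using that unfolding less_eq_ordered_copy_def by linarith
  show "x \<le> y \<or> y \<le> x" unfolding less_eq_ordered_copy_def by linarith
  show "x = y" if "x \<le> y" "y \<le> x"
  proof -
    have "enumeration (Rep_ordered_copy x) = enumeration (Rep_ordered_copy y)"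
      using that unfolding less_eq_ordered_copy_def by linarith
    then show ?thesis using inj_enumeration Rep_ordered_copy_inject by (metis injD)
  qed
next
  fix P :: "'a ordered_copy \<Rightarrow> bool" and x
  assume step: "\<And>x. (\<And>y. y < x \<Longrightarrow> P y) \<Longrightarrow> P x"
  show "P x"
  proof (induction x rule: measure_induct_rule[of "\<lambda>x. enumeration (Rep_ordered_copy x)"])
    case (less x)
    show ?case
    proof (rule step)
      fix y assume "y < x"
      then show "P y" using less unfolding less_ordered_copy_def by blast
    qed
  qed
qed

end

lemma bij_Rep_ordered_copy: "bij (Rep_ordered_copy :: 'n ordered_copy \<Rightarrow> 'n)"
  by (metis Abs_ordered_copy_inverse Rep_ordered_copy_inverse UNIV_I bijI' )

lemmas ordered_copy_inverses [simp] = Rep_ordered_copy_inverse Abs_ordered_copy_inverse[OF UNIV_I]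

definition to_copy :: "real^'n::finite \<Rightarrow> real^'n ordered_copy" where
  "to_copy x = (\<chi> i. x $ Rep_ordered_copy i)"

definition of_copy :: "real^'n ordered_copy \<Rightarrow> real^'n::finite" where
  "of_copy x = (\<chi> i. x $ Abs_ordered_copy i)"

lemma copy_inverses [simp]: "of_copy (to_copy x) = x" "to_copy (of_copy y) = y"
  by (simp_all add: to_copy_def of_copy_def)

lemma linear_to_copy: "linear to_copy" and linear_of_copy: "linear of_copy"
  by (auto intro!: linearI simp: to_copy_def of_copy_def vec_eq_iff)

lemma bounded_linear_to_copy: "bounded_linear to_copy"
  and bounded_linear_of_copy: "bounded_linear of_copy"
  using linear_to_copy linear_of_copy by (simp_all add: linear_conv_bounded_linear)

lemma borel_measurable_of_copy [measurable]: "of_copy \<in> borel_measurable borel"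
  by (simp add: borel_measurable_continuous_onI linear_continuous_on bounded_linear_of_copy)

lemma prod_Basis_cart: "(\<Prod>b\<in>Basis. (x :: real^'n) \<bullet> b) = (\<Prod>i\<in>UNIV. x $ i)"
proof -
  have "(\<Prod>b\<in>Basis. x \<bullet> b) = (\<Prod>b\<in>range (\<lambda>i. axis i 1). x \<bullet> b)"
    by (rule prod.cong) (auto simp: Basis_vec_def)
  also have "\<dots> = (\<Prod>i\<in>UNIV. x \<bullet> axis i 1)"
    by (subst prod.reindex) (auto simp: inj_on_def axis_eq_axis)
  finally show ?thesis by (simp add: inner_axis)
qed

lemma lborel_of_copy: "distr lborel borel (of_copy :: real^'n ordered_copy \<Rightarrow> real^'n::finite) = lborel"
proof (rule lborel_eqI[symmetric])
  fix l u :: "real^'n" assume le: "\<And>b. b \<in> Basis \<Longrightarrow> l \<bullet> b \<le> u \<bullet> b"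
  have le': "l $ i \<le> u $ i" for i
    using le[of "axis i 1"] by (auto simp: inner_axis Basis_vec_def)
  have "of_copy -` box l u = box (to_copy l) (to_copy u)"
  proof (intro equalityI subsetI)
    fix x assume x: "x \<in> of_copy -` box l u"
    have "l $ Rep_ordered_copy i < x $ i \<and> x $ i < u $ Rep_ordered_copy i" for i
    proof -
      have "l $ Rep_ordered_copy i < of_copy x $ Rep_ordered_copy i"
        "of_copy x $ Rep_ordered_copy i < u $ Rep_ordered_copy i"
        using x by (simp_all add: mem_box_cart)
      then show ?thesis by (simp add: of_copy_def)
    qed
    then show "x \<in> box (to_copy l) (to_copy u)" by (simp add: mem_box_cart to_copy_def)
  next
    fix x assume x: "x \<in> box (to_copy l) (to_copy u)"
    have "l $ i < of_copy x $ i \<and> of_copy x $ i < u $ i" for i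
    proof -
      have "to_copy l $ Abs_ordered_copy i < x $ Abs_ordered_copy i"
        "x $ Abs_ordered_copy i < to_copy u $ Abs_ordered_copy i"
        using x by (simp_all add: mem_box_cart)
      then show ?thesis by (simp add: of_copy_def to_copy_def)
    qed
    then show "x \<in> of_copy -` box l u" by (simp add: mem_box_cart)
  qed
  moreover have "emeasure lborel (box (to_copy l) (to_copy u)) = (\<Prod>b\<in>Basis. (to_copy u - to_copy l) \<bullet> b)"
    by (rule emeasure_lborel_box) (auto simp: Basis_vec_def inner_axis to_copy_def le')
  moreover have "(\<Prod>i\<in>UNIV. (to_copy u - to_copy l) $ i) = (\<Prod>i\<in>UNIV. (u - l) $ i)"
    using prod.reindex_bij_betw[OF bij_Rep_ordered_copy, of "\<lambda>i. (u - l) $ i"]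
    by (simp add: to_copy_def)
  ultimately show "emeasure (distr lborel borel of_copy) (box l u) = (\<Prod>b\<in>Basis. (u - l) \<bullet> b)"
    by (simp add: emeasure_distr prod_Basis_cart)
qed simp

text \<open>Conjugation with the bijection matches the permutations of the two index types and
  preserves their signs.\<close>

lemma det_reindex:
  fixes A :: "real^'n^'n" and e :: "'k::finite \<Rightarrow> 'n::finite"
  assumes "bij e"
  shows "det (\<chi> i j. A $ e i $ e j) = det A"
proof -
  let ?U = "UNIV :: 'k set" and ?V = "UNIV :: 'n set"
  have bb: "bij_betw e ?U ?V" using assms by simp
  have bi: "bij_betw (inv e) ?V ?U" using assms by (simp add: bij_imp_bij_inv)
  have bij: "bij_betw (map_permutation ?U e) {p. p permutes ?U} {p. p permutes ?V}"
  proof (rule bij_betw_byWitness[where f'="map_permutation ?V (inv e)"])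
    show "\<forall>p\<in>{p. p permutes ?U}. map_permutation ?V (inv e) (map_permutation ?U e p) = p"
      using map_permutation_compose_inv[OF bb, of _ "inv e"] assms by (simp add: bij_is_inj)
    show "\<forall>p\<in>{p. p permutes ?V}. map_permutation ?U e (map_permutation ?V (inv e) p) = p"
      using map_permutation_compose_inv[OF bi, of _ e] assms by (simp add: bij_is_surj surj_f_inv_f)
    show "map_permutation ?U e ` {p. p permutes ?U} \<subseteq> {p. p permutes ?V}"
      using map_permutation_permutes[OF bb] by auto
    show "map_permutation ?V (inv e) ` {p. p permutes ?V} \<subseteq> {p. p permutes ?U}"
      using map_permutation_permutes[OF bi] by auto
  qed
  have "det A = (\<Sum>p | p permutes ?U. of_int (sign (map_permutation ?U e p)) *
      (\<Prod>i\<in>?V. A $ i $ map_permutation ?U e p i))"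
    unfolding det_def by (rule sum.reindex_bij_betw[OF bij, symmetric])
  also have "\<dots> = (\<Sum>p | p permutes ?U. of_int (sign p) * (\<Prod>i\<in>?U. A $ e i $ e (p i)))"
  proof (rule sum.cong, rule refl)
    fix p assume p: "p \<in> {p. p permutes ?U}"
    have inj: "inj_on e ?U" using assms bij_is_inj by auto
    have "(\<Prod>i\<in>?V. A $ i $ map_permutation ?U e p i) = (\<Prod>i\<in>?U. A $ e i $ map_permutation ?U e p (e i))"
      by (rule prod.reindex_bij_betw[OF bb, symmetric])
    also have "\<dots> = (\<Prod>i\<in>?U. A $ e i $ e (p i))"
      by (simp add: map_permutation_apply[OF inj])
    finally show "of_int (sign (map_permutation ?U e p)) * (\<Prod>i\<in>?V. A $ i $ map_permutation ?U e p i)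
        = of_int (sign p) * (\<Prod>i\<in>?U. A $ e i $ e (p i))"
      using sign_map_permutation[OF inj] p by simp
  qed
  finally show ?thesis unfolding det_def by simp
qed

lemma nn_integral_change_of_variables_wellorder:
  fixes T :: "real^'k::{finite,wellorder} \<Rightarrow> real^'k::_" and r s :: "real^'k::_ \<Rightarrow> real"
  assumes E: "E \<in> sets borel" and TE: "T ` E \<in> sets borel" and inj: "inj_on T E"
    and der: "\<And>x. x \<in> E \<Longrightarrow> (T has_derivative T' x) (at x within E)"
    and r: "r \<in> borel_measurable borel" "\<And>y. r y \<ge> 0"
    and s: "\<And>x. x \<in> E \<Longrightarrow> s x = \<bar>det (matrix (T' x))\<bar> * r (T x)"
    and fin: "(\<integral>\<^sup>+y. ennreal (r y) * indicator (T ` E) y \<partial>lborel) < \<infinity>"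
  shows "(\<integral>\<^sup>+x. ennreal (s x) * indicator E x \<partial>lborel) = (\<integral>\<^sup>+y. ennreal (r y) * indicator (T ` E) y \<partial>lborel)"
proof -
  define b where "b = integral (T ` E) r"
  have ind: "ennreal (g x) * indicator S x = ennreal (indicator S x *\<^sub>R g x)" for g and S :: "(real^'k::_) set" and x
    by (auto simp: indicator_def)
  have "set_integrable lborel (T ` E) r"
    unfolding set_integrable_def
    by (rule integrableI_nonneg) (use r TE fin in \<open>auto simp: ind\<close>)
  then have ri: "r absolutely_integrable_on (T ` E)"
    unfolding set_integrable_def
    by (subst integrable_completion) (use r TE in auto)
  have "(\<lambda>x. \<bar>det (matrix (T' x))\<bar> *\<^sub>R (vec (r (T x)) :: real^1)) absolutely_integrable_on E \<and>
     integral E (\<lambda>x. \<bar>det (matrix (T' x))\<bar> *\<^sub>R (vec (r (T x)) :: real^1)) = vec b"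
    by (subst has_absolute_integral_change_of_variables[where f="\<lambda>y. vec (r y) :: real^1", OF _ der inj])
      (use E ri in \<open>auto simp: b_def absolutely_integrable_on_1_iff integral_on_1_eq\<close>)
  then have 1: "(\<lambda>x. \<bar>det (matrix (T' x))\<bar> * r (T x)) absolutely_integrable_on E"
    and 2: "integral E (\<lambda>x. \<bar>det (matrix (T' x))\<bar> * r (T x)) = b"
    by (auto simp: absolutely_integrable_on_1_iff integral_on_1_eq vec_eq_iff)
  have conv: "(\<integral>\<^sup>+x. ennreal (g x) * indicator S x \<partial>lborel) = ennreal (integral S g)"
    if "g absolutely_integrable_on S" "\<And>x. x \<in> S \<Longrightarrow> g x \<ge> 0" for g :: "real^'k::_ \<Rightarrow> real" and S
  proof -
    have "(\<integral>\<^sup>+x. ennreal (g x) * indicator S x \<partial>lborel) = (\<integral>\<^sup>+x. ennreal (indicator S x *\<^sub>R g x) \<partial>lebesgue)"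
      by (simp add: nn_integral_completion ind)
    also have "\<dots> = ennreal (integral\<^sup>L lebesgue (\<lambda>x. indicator S x *\<^sub>R g x))"
      by (rule nn_integral_eq_integral)
        (use that in \<open>auto simp: set_integrable_def indicator_def\<close>)
    also have "\<dots> = ennreal (integral S g)"
      using set_lebesgue_integral_eq_integral(2)[OF that(1)] by (simp add: set_lebesgue_integral_def)
    finally show ?thesis .
  qed
  have "(\<integral>\<^sup>+x. ennreal (s x) * indicator E x \<partial>lborel) =
      (\<integral>\<^sup>+x. ennreal (\<bar>det (matrix (T' x))\<bar> * r (T x)) * indicator E x \<partial>lborel)"
    by (rule nn_integral_cong) (auto simp: indicator_def s)
  then show ?thesis
    using conv[OF 1] conv[OF ri] 2 r(2) by (simp add: b_def)
qed

text \<open>The function \<open>s\<close> stands for the integrand on the left, so that its measurability can be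
  known for other reasons than that of the determinant.\<close>

lemma nn_integral_change_of_variables:
  fixes T :: "real^'n::finite \<Rightarrow> real^'n" and r s :: "real^'n \<Rightarrow> real"
  assumes E: "E \<in> sets borel" and TE: "T ` E \<in> sets borel" and inj: "inj_on T E"
    and der: "\<And>x. x \<in> E \<Longrightarrow> (T has_derivative T' x) (at x within E)"
    and r: "r \<in> borel_measurable borel" "\<And>y. r y \<ge> 0"
    and s: "\<And>x. x \<in> E \<Longrightarrow> s x = \<bar>det (matrix (T' x))\<bar> * r (T x)"
    and s_meas: "(\<lambda>x. s x * indicator E x) \<in> borel_measurable borel"
    and fin: "(\<integral>\<^sup>+y. ennreal (r y) * indicator (T ` E) y \<partial>lborel) < \<infinity>"
  shows "(\<integral>\<^sup>+x. ennreal (s x) * indicator E x \<partial>lborel) = (\<integral>\<^sup>+y. ennreal (r y) * indicator (T ` E) y \<partial>lborel)"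
proof -
  define E' where "E' = of_copy -` E"
  define S where "S = to_copy \<circ> T \<circ> of_copy"
  define S' where "S' x = to_copy \<circ> T' (of_copy x) \<circ> of_copy" for x
  have SE: "S ` E' = of_copy -` (T ` E)"
  proof (intro equalityI subsetI)
    fix y assume "y \<in> of_copy -` (T ` E)"
    then obtain x where "x \<in> E" "of_copy y = T x" by auto
    then show "y \<in> S ` E'"
      by (intro image_eqI[of _ _ "to_copy x"]) (auto simp: S_def E'_def dest: arg_cong[of _ _ to_copy])
  qed (auto simp: S_def E'_def)
  have conv: "(\<integral>\<^sup>+y. ennreal (g y) * indicator A y \<partial>lborel) =
      (\<integral>\<^sup>+y. ennreal (g (of_copy y)) * indicator (of_copy -` A) y \<partial>lborel)"
    if "(\<lambda>y. g y * indicator A y) \<in> borel_measurable borel" for g :: "real^'n \<Rightarrow> real" and A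
  proof -
    have i: "ennreal (g y) * indicator A y = ennreal (g y * indicator A y)" for y
      by (auto simp: indicator_def)
    have "(\<integral>\<^sup>+y. ennreal (g y * indicator A y) \<partial>lborel) =
        (\<integral>\<^sup>+y. ennreal (g (of_copy y) * indicator A (of_copy y)) \<partial>lborel)"
      by (subst lborel_of_copy[symmetric], subst nn_integral_distr) (use that in auto)
    also have "\<dots> = (\<integral>\<^sup>+y. ennreal (g (of_copy y)) * indicator (of_copy -` A) y \<partial>lborel)"
      by (rule nn_integral_cong) (auto simp: indicator_def)
    finally show ?thesis unfolding i .
  qed
  have meas: "(\<lambda>y. r y * indicator (T ` E) y) \<in> borel_measurable borel" using r TE by measurable
  have detS: "det (matrix (S' x)) = det (matrix (T' (of_copy x)))" for x
  proof -
    have "matrix (S' x) = (\<chi> i j. matrix (T' (of_copy x)) $ Rep_ordered_copy i $ Rep_ordered_copy j)"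
    proof -
      have "of_copy (axis j 1) = axis (Rep_ordered_copy j) 1" for j :: "'n ordered_copy"
        by (auto simp: of_copy_def axis_def vec_eq_iff)
      then show ?thesis
        by (simp add: matrix_def S'_def to_copy_def)
    qed
    then show ?thesis using det_reindex[OF bij_Rep_ordered_copy] by metis
  qed
  have "(\<integral>\<^sup>+x. ennreal (s (of_copy x)) * indicator E' x \<partial>lborel) =
      (\<integral>\<^sup>+y. ennreal (r (of_copy y)) * indicator (S ` E') y \<partial>lborel)"
  proof (rule nn_integral_change_of_variables_wellorder[where T'=S'])
    show "E' \<in> sets borel"
      unfolding E'_def using E measurable_sets[OF borel_measurable_of_copy] by auto
    show "S ` E' \<in> sets borel"
      unfolding SE using TE measurable_sets[OF borel_measurable_of_copy] by auto
    show "inj_on S E'"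
    proof (rule inj_onI)
      fix x y assume xy: "x \<in> E'" "y \<in> E'" "S x = S y"
      then have "T (of_copy x) = T (of_copy y)"
        unfolding S_def comp_apply by (metis copy_inverses(1))
      then have "of_copy x = of_copy y" using inj xy by (auto simp: E'_def inj_on_def)
      then show "x = y" by (metis copy_inverses(2))
    qed
    show "(S has_derivative S' x) (at x within E')" if "x \<in> E'" for x
    proof -
      have "surj of_copy" by (rule surjI[of _ to_copy]) simp
      then have "of_copy ` E' = E" unfolding E'_def by (rule surj_image_vimage_eq)
      then have "(T has_derivative T' (of_copy x)) (at (of_copy x) within of_copy ` E')"
        using der that by (simp add: E'_def)
      then have "((T \<circ> of_copy) has_derivative (T' (of_copy x) \<circ> of_copy)) (at x within E')"
        by (intro diff_chain_within bounded_linear_imp_has_derivative bounded_linear_of_copy)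
      from bounded_linear.has_derivative[OF bounded_linear_to_copy this]
      show ?thesis by (simp add: S_def S'_def o_def)
    qed
    show "(\<lambda>y. r (of_copy y)) \<in> borel_measurable borel" using r by measurable
    show "s (of_copy x) = \<bar>det (matrix (S' x))\<bar> * r (of_copy (S x))" if "x \<in> E'" for x
      using s[of "of_copy x"] that by (simp add: detS S_def E'_def)
    show "(\<integral>\<^sup>+y. ennreal (r (of_copy y)) * indicator (S ` E') y \<partial>lborel) < \<infinity>"
      using fin conv[OF meas] by (simp add: SE)
  qed (use r in auto)
  then show ?thesis
    using conv[OF meas, folded SE] conv[OF s_meas, folded E'_def] by simp
qed

section \<open>Integration on a compact Riemannian manifold\<close>

locale compact_riemannian = riemannian_mfd M
  for M :: "('m::{t2_space,second_countable_topology}, 'n::finite) riemannian" +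
  fixes vol :: "'m measure"
  assumes vol: "riemannian_measure M vol" and compact: "compact (UNIV :: 'm set)"
begin

text \<open>Extended by zero, so that densities and integrals over a chart live on the whole Euclidean
  space.\<close>

definition chart_density :: "('m, 'n) chart \<Rightarrow> real^'n \<Rightarrow> real" where
  "chart_density c x = (if x \<in> codom c then sqrt (det (gram M c x)) else 0)"

lemma sets_vol [measurable_cong]: "sets vol = sets borel"
  using vol by (simp add: riemannian_measure_def)

lemma space_vol [simp]: "space vol = UNIV"
  using sets_eq_imp_space_eq[OF sets_vol] by simp

lemma chart_density_nonneg: "c \<in> atlas M \<Longrightarrow> chart_density c x \<ge> 0"
  using det_gram_pos[of c x] by (auto simp: chart_density_def intro: less_imp_le)

lemma chart_density_measurable:
  assumes "c \<in> atlas M"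
  shows "chart_density c \<in> borel_measurable borel"
  unfolding chart_density_def
  by (rule borel_measurable_continuous_on_if)
    (use chart_facts(2)[OF assms] C1_on_continuous_on[OF sqrt_det_gram_C1[OF assms]] in auto)

lemma emeasure_vol_chart:
  assumes "c \<in> atlas M" "S \<in> sets borel" "S \<subseteq> cdom c"
  shows "emeasure vol S = (\<integral>\<^sup>+x. ennreal (chart_density c x) * indicator (coord c ` S) x \<partial>lborel)"
proof -
  have "emeasure vol S = (\<integral>\<^sup>+x. ennreal (sqrt (det (gram M c x))) * indicator (coord c ` S) x \<partial>lborel)"
    using vol assms unfolding riemannian_measure_def by blast
  also have "\<dots> = (\<integral>\<^sup>+x. ennreal (chart_density c x) * indicator (coord c ` S) x \<partial>lborel)"
    by (rule nn_integral_cong)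
      (use assms chart_facts(5)[OF assms(1)] in \<open>auto simp: indicator_def chart_density_def\<close>)
  finally show ?thesis .
qed

lemma borel_coord_image:
  assumes c: "c \<in> atlas M" and S: "S \<in> sets borel"
  shows "coord c ` (cdom c \<inter> S) \<in> sets borel"
proof -
  note cf = chart_facts[OF c]
  have "param c \<in> borel_measurable (restrict_space borel (codom c))"
    by (rule borel_measurable_continuous_on_restrict) (rule cf)
  from measurable_sets[OF this S]
  have "param c -` S \<inter> codom c \<in> sets borel"
    using cf(2) by (simp add: space_restrict_space sets_restrict_space_iff)
  moreover have "coord c ` (cdom c \<inter> S) = param c -` S \<inter> codom c"
  proof (intro equalityI subsetI)
    fix x assume "x \<in> param c -` S \<inter> codom c"
    then show "x \<in> coord c ` (cdom c \<inter> S)"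
      using cf by (intro image_eqI[of _ _ "param c x"]) auto
  qed (use cf in auto)
  ultimately show ?thesis by simp
qed

lemma cdom_measurable: "c \<in> atlas M \<Longrightarrow> cdom c \<in> sets vol"
  by (simp add: sets_vol chart_facts(1) borel_open)

lemma vol_in_chart:
  assumes c: "c \<in> atlas M"
  shows "density vol (indicator (cdom c)) =
    distr (density lborel (\<lambda>x. ennreal (chart_density c x))) borel
      (\<lambda>x. if x \<in> codom c then param c x else undefined)" (is "_ = distr ?D borel ?p")
proof (rule measure_eqI)
  note cf = chart_facts[OF c]
  have p [measurable]: "?p \<in> borel_measurable borel"
    by (rule borel_measurable_continuous_on_if) (use cf in auto)
  fix S assume "S \<in> sets (density vol (indicator (cdom c)))"
  then have S: "S \<in> sets borel" by (simp add: sets_vol)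
  have cS: "cdom c \<inter> S \<in> sets borel" using cf(1) S by auto
  have "emeasure (density vol (indicator (cdom c))) S = (\<integral>\<^sup>+x. indicator (cdom c) x * indicator S x \<partial>vol)"
    by (subst emeasure_density) (use S c in \<open>simp_all add: sets_vol[symmetric] cdom_measurable borel_measurable_indicator\<close>)
  also have "\<dots> = (\<integral>\<^sup>+x. indicator (cdom c \<inter> S) x \<partial>vol)"
    by (rule nn_integral_cong) (auto simp: indicator_def)
  also have "\<dots> = emeasure vol (cdom c \<inter> S)" using cS by (simp add: sets_vol)
  also have "\<dots> = (\<integral>\<^sup>+x. ennreal (chart_density c x) * indicator (coord c ` (cdom c \<inter> S)) x \<partial>lborel)"
    by (rule emeasure_vol_chart[OF c cS]) simp
  also have "\<dots> = (\<integral>\<^sup>+x. ennreal (chart_density c x) * indicator (?p -` S) x \<partial>lborel)"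
  proof (rule nn_integral_cong)
    fix x
    have "x \<in> coord c ` (cdom c \<inter> S) \<longleftrightarrow> ?p x \<in> S" if x: "x \<in> codom c"
    proof
      assume "?p x \<in> S"
      then show "x \<in> coord c ` (cdom c \<inter> S)"
        using cf x by (intro image_eqI[of _ _ "param c x"]) auto
    qed (use x cf in auto)
    then show "ennreal (chart_density c x) * indicator (coord c ` (cdom c \<inter> S)) x =
        ennreal (chart_density c x) * indicator (?p -` S) x"
      by (cases "x \<in> codom c") (auto simp: chart_density_def indicator_def)
  qed
  also have "\<dots> = emeasure ?D (?p -` S)"
    by (subst emeasure_density) (use chart_density_measurable[OF c] S measurable_sets[OF p S] in auto)
  also have "\<dots> = emeasure (distr ?D borel ?p) S"
    by (subst emeasure_distr) (use S p in auto)
  finally show "emeasure (density vol (indicator (cdom c))) S = emeasure (distr ?D borel ?p) S" .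
qed (simp add: sets_vol)

lemma integral_chart:
  fixes g :: "'m \<Rightarrow> real"
  assumes c: "c \<in> atlas M" and g: "g \<in> borel_measurable borel"
  shows "(\<integral>p. indicator (cdom c) p * g p \<partial>vol) = (\<integral>x. chart_density c x * g (param c x) \<partial>lborel)"
proof -
  let ?p = "\<lambda>x. if x \<in> codom c then param c x else undefined"
  note cf = chart_facts[OF c]
  have p [measurable]: "?p \<in> borel_measurable borel"
    by (rule borel_measurable_continuous_on_if) (use cf in auto)
  have gv: "g \<in> borel_measurable vol" using g by (simp add: measurable_cong_sets[OF sets_vol])
  have "(\<integral>p. indicator (cdom c) p * g p \<partial>vol) = (\<integral>p. g p \<partial>density vol (\<lambda>p. ennreal (indicator (cdom c) p)))"
    by (subst integral_real_density) (use c gv in \<open>simp_all add: cdom_measurable borel_measurable_indicator\<close>)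
  also have "(\<lambda>p. ennreal (indicator (cdom c) p)) = indicator (cdom c)"
    by (auto simp: indicator_def)
  also have "(\<integral>p. g p \<partial>density vol (indicator (cdom c))) =
      (\<integral>x. g (?p x) \<partial>density lborel (\<lambda>x. ennreal (chart_density c x)))"
    unfolding vol_in_chart[OF c] by (rule integral_distr) (use g p in auto)
  also have "\<dots> = (\<integral>x. chart_density c x * g (?p x) \<partial>lborel)"
    by (rule integral_real_density)
      (use g p chart_density_measurable[OF c] chart_density_nonneg[OF c] in auto)
  also have "\<dots> = (\<integral>x. chart_density c x * g (param c x) \<partial>lborel)"
    by (rule Bochner_Integration.integral_cong) (auto simp: chart_density_def)
  finally show ?thesis .
qed

lemma ex_chart_ball:
  obtains c r where "c \<in> atlas M" "p \<in> cdom c" "r > 0" "cball (coord c p) r \<subseteq> codom c"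
proof -
  obtain c where c: "c \<in> atlas M" "p \<in> cdom c" using ex_chart by blast
  then show ?thesis
    using that open_contains_cball[of "codom c"] chart_facts(2,5)[OF c(1)] c(2) by metis
qed

lemma param_ball_open:
  assumes "c \<in> atlas M" "U \<subseteq> codom c" "open U"
  shows "open (param c ` U)"
proof -
  note cf = chart_facts[OF assms(1)]
  have "param c ` U = cdom c \<inter> coord c -` U"
  proof (intro equalityI subsetI)
    fix p assume "p \<in> cdom c \<inter> coord c -` U"
    then show "p \<in> param c ` U" using cf by (intro image_eqI[of _ _ "coord c p"]) auto
  qed (use cf assms(2) in auto)
  then show ?thesis
    using continuous_on_open_vimage[OF cf(1)] cf(7) assms(3) by (metis Int_commute)
qed

lemma vol_chart_compact_finite:
  assumes c: "c \<in> atlas M" and K: "compact K" "K \<subseteq> codom c"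
  shows "emeasure vol (param c ` K) < \<infinity>"
proof -
  note cf = chart_facts[OF c]
  have "compact (param c ` K)"
    using K cf(8) by (meson compact_continuous_image continuous_on_subset)
  then have S: "param c ` K \<in> sets borel" by (simp add: borel_compact)
  have sub: "param c ` K \<subseteq> cdom c" and img: "coord c ` param c ` K = K"
    using cf(4,6) K(2) by (auto simp: image_image subset_iff)
  have "bounded ((\<lambda>x. sqrt (det (gram M c x))) ` K)"
    using compact_continuous_image[OF continuous_on_subset[OF C1_on_continuous_on[OF sqrt_det_gram_C1[OF c]] K(2)] K(1)]
      compact_imp_bounded by blast
  then obtain B where B: "\<And>x. x \<in> K \<Longrightarrow> \<bar>sqrt (det (gram M c x))\<bar> \<le> B"
    unfolding bounded_iff by auto
  have "emeasure vol (param c ` K) = (\<integral>\<^sup>+x. ennreal (chart_density c x) * indicator K x \<partial>lborel)"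
    using emeasure_vol_chart[OF c S sub] img by simp
  also have "\<dots> \<le> (\<integral>\<^sup>+x. ennreal B * indicator K x \<partial>lborel)"
    by (rule nn_integral_mono)
      (use B K(2) in \<open>force simp: indicator_def chart_density_def intro: ennreal_leI\<close>)
  also have "\<dots> = ennreal B * emeasure lborel K"
    using K(1) by (subst nn_integral_cmult_indicator) (auto simp: borel_compact)
  also have "\<dots> < \<infinity>"
    using emeasure_bounded_finite[OF compact_imp_bounded[OF K(1)]] by (simp add: ennreal_mult_less_top)
  finally show ?thesis .
qed

lemma finite_chart_ball_cover:
  "\<exists>I c x r. finite (I :: 'm set) \<and>
     (\<forall>p\<in>I. c p \<in> atlas M \<and> (0::real) < r p \<and> cball (x p) (r p) \<subseteq> codom (c p)) \<and>
     (\<Union>p\<in>I. param (c p) ` ball (x p) (r p)) = UNIV"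
proof -
  have "\<forall>p. \<exists>c x r. c \<in> atlas M \<and> r > 0 \<and> cball x r \<subseteq> codom c \<and> p \<in> param c ` ball x r"
  proof
    fix p
    obtain c r where c: "c \<in> atlas M" "p \<in> cdom c" "r > 0" "cball (coord c p) r \<subseteq> codom c"
      by (rule ex_chart_ball)
    have "p \<in> param c ` ball (coord c p) r"
      using chart_facts(3)[OF c(1,2)] c(3) by (intro image_eqI[of _ _ "coord c p"]) auto
    then show "\<exists>c x r. c \<in> atlas M \<and> r > 0 \<and> cball x r \<subseteq> codom c \<and> p \<in> param c ` ball x r"
      using c by blast
  qed
  then obtain c x r where "\<forall>p. c p \<in> atlas M \<and> r p > (0::real) \<and> cball (x p) (r p) \<subseteq> codom (c p)
      \<and> p \<in> param (c p) ` ball (x p) (r p)"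
    unfolding choice_iff by blast
  then have *: "\<And>p. c p \<in> atlas M" "\<And>p. r p > 0" "\<And>p. cball (x p) (r p) \<subseteq> codom (c p)"
    "\<And>p. p \<in> param (c p) ` ball (x p) (r p)" by blast+
  have "open (param (c p) ` ball (x p) (r p))" for p
    by (rule param_ball_open[OF *(1)]) (use *(3)[of p] ball_subset_cball in auto)
  moreover have "UNIV \<subseteq> (\<Union>p\<in>UNIV. param (c p) ` ball (x p) (r p))" using *(4) by blast
  ultimately obtain I where I: "finite I" "UNIV \<subseteq> (\<Union>p\<in>I. param (c p) ` ball (x p) (r p))"
    by (rule compactE_image[OF compact])
  show ?thesis
  proof (intro exI conjI)
    show "finite I" by fact
    show "\<forall>p\<in>I. c p \<in> atlas M \<and> 0 < r p \<and> cball (x p) (r p) \<subseteq> codom (c p)"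
      using *(1-3) by blast
    show "(\<Union>p\<in>I. param (c p) ` ball (x p) (r p)) = UNIV" using I(2) by blast
  qed
qed

lemma finite_vol: "finite_measure vol"
proof
  obtain I c x r where "finite (I :: 'm set) \<and>
     (\<forall>p\<in>I. c p \<in> atlas M \<and> (0::real) < r p \<and> cball (x p) (r p) \<subseteq> codom (c p)) \<and>
     (\<Union>p\<in>I. param (c p) ` ball (x p) (r p)) = UNIV"
    using finite_chart_ball_cover by blast
  then have I: "finite I" "\<And>p. p \<in> I \<Longrightarrow> c p \<in> atlas M" "\<And>p. p \<in> I \<Longrightarrow> r p > 0"
    "\<And>p. p \<in> I \<Longrightarrow> cball (x p) (r p) \<subseteq> codom (c p)" "(\<Union>p\<in>I. param (c p) ` ball (x p) (r p)) = UNIV"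
    by blast+
  have meas: "param (c p) ` cball (x p) (r p) \<in> sets borel" if "p \<in> I" for p
    using I(2,4)[OF that] chart_facts(8)[OF I(2)[OF that]]
    by (meson borel_compact compact_cball compact_continuous_image continuous_on_subset)
  have "emeasure vol UNIV \<le> emeasure vol (\<Union>p\<in>I. param (c p) ` cball (x p) (r p))"
  proof (rule emeasure_mono)
    show "UNIV \<subseteq> (\<Union>p\<in>I. param (c p) ` cball (x p) (r p))"
      unfolding I(5)[symmetric] by (intro UN_mono image_mono ball_subset_cball order_refl)
    show "(\<Union>p\<in>I. param (c p) ` cball (x p) (r p)) \<in> sets vol"
      unfolding sets_vol using I(1) meas by (rule sets.finite_UN)
  qed
  also have "\<dots> \<le> (\<Sum>p\<in>I. emeasure vol (param (c p) ` cball (x p) (r p)))"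
    by (rule emeasure_subadditive_finite) (use I(1) meas in \<open>auto simp: sets_vol\<close>)
  also have "\<dots> < \<infinity>"
    using vol_chart_compact_finite I by (simp add: less_top)
  finally show "emeasure vol (space vol) \<noteq> \<infinity>" by simp
qed

sublocale finite_measure vol by (rule finite_vol)

lemma continuous_integrable:
  fixes f :: "'m \<Rightarrow> real"
  assumes "continuous_on UNIV f"
  shows "integrable vol f"
proof -
  have "bounded (f ` UNIV)"
    using compact_continuous_image[OF assms compact] compact_imp_bounded by blast
  then obtain B where "\<And>x. norm (f x) \<le> B" unfolding bounded_iff by auto
  then show ?thesis
    by (intro integrable_const_bound[of _ B])
      (use borel_measurable_continuous_onI[OF assms] in \<open>auto simp: measurable_cong_sets[OF sets_vol]\<close>)
qed

lemma vol_open_pos: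
  assumes "open U" "U \<noteq> {}"
  shows "measure vol U > 0"
proof -
  obtain p where p: "p \<in> U" using assms by blast
  obtain c where c: "c \<in> atlas M" "p \<in> cdom c" using ex_chart by blast
  note cf = chart_facts[OF c(1)]
  define V where "V = coord c ` (cdom c \<inter> U)"
  have V: "open V" "V \<noteq> {}" "V \<subseteq> codom c"
    using chart_image_open[OF chart[OF c(1)] assms(1)] p c cf(5) by (auto simp: V_def)
  have cU: "cdom c \<inter> U \<in> sets borel" using cf(1) assms(1) by auto
  have "emeasure vol (cdom c \<inter> U) \<noteq> 0"
  proof
    assume "emeasure vol (cdom c \<inter> U) = 0"
    then have "(\<integral>\<^sup>+x. ennreal (chart_density c x) * indicator V x \<partial>lborel) = 0"
      using emeasure_vol_chart[OF c(1) cU] by (simp add: V_def)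
    then have "AE x in lborel. ennreal (chart_density c x) * indicator V x = 0"
      by (subst (asm) nn_integral_0_iff_AE) (use chart_density_measurable[OF c(1)] V(1) in auto)
    then have "AE x in lborel. x \<notin> V"
    proof eventually_elim
      case (elim x)
      show ?case
      proof
        assume "x \<in> V"
        then have "chart_density c x > 0"
          using det_gram_pos[OF c(1)] V(3) by (auto simp: chart_density_def)
        then show False using elim \<open>x \<in> V\<close> by simp
      qed
    qed
    then have "negligible V"
      using V(1) by (metis AE_iff_null_sets borel_open completion.complete2 negligible_iff_null_sets
          null_sets_completionI sets_lborel)
    then show False using V open_not_negligible by blast
  qed
  then have "emeasure vol (cdom c \<inter> U) > 0" by (simp add: zero_less_iff_neq_zero)
  also have "emeasure vol (cdom c \<inter> U) \<le> emeasure vol U"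
    by (rule emeasure_mono) (use assms(1) in \<open>auto simp: sets_vol\<close>)
  finally show ?thesis by (simp add: emeasure_eq_measure)
qed

section \<open>Green's identity\<close>

lemma grad_prod_locally_zero:
  assumes "C1_fun M w" "C1_fun M f" "open V" "p \<in> V" "\<And>q. q \<in> V \<Longrightarrow> w q = 0"
  shows "grad_prod M w f p = 0"
proof -
  obtain c where c: "c \<in> atlas M" "p \<in> cdom c" using ex_chart by blast
  note cf = chart_facts[OF c(1)]
  have "chart_diff c w (coord c p) = 0"
  proof (rule chart_diff_unique)
    show "(w \<circ> param c has_derivative (\<lambda>v. 0 \<bullet> v)) (at (coord c p))"
      by (rule has_derivative_transform_within_open[of "\<lambda>_. 0", OF _
            chart_image_open[OF chart[OF c(1)] assms(3)]])
        (use assms(4,5) c(2) cf in auto)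
  qed
  then show ?thesis using grad_prod_eq[OF assms(1,2) c] by (simp add: grad_prod_in_def)
qed

text \<open>In coordinates, \<open>w \<Delta>f\<close> and the inner product of the gradients differ by the divergence of the
  compactly supported field \<open>w \<nabla>f\<close>, whose components are integrated by
  \<open>integral_derivative_compact_support\<close>.\<close>

lemma Green_chart:
  assumes w: "C1_fun M w" and f: "smooth_function M f" and k: "laplacian_is M f k" "continuous_on UNIV k"
    and c: "c \<in> atlas M" and B: "cball x0 r \<subseteq> codom c"
    and supp: "\<And>p. p \<notin> param c ` cball x0 r \<Longrightarrow> w p = 0"
  shows "(\<integral>p. w p * k p \<partial>vol) = (\<integral>p. grad_prod M w f p \<partial>vol)"
proof -
  note cf = chart_facts[OF c]
  have fC1: "C1_fun M f" using f by (rule smooth_function_imp_C1_fun)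
  let ?G = "\<lambda>x. sqrt (det (gram M c x))"
  define X where "X = grad_in M c f"
  define Z where "Z = (\<lambda>i x. if x \<in> codom c then ?G x * X x $ i * w (param c x) else 0)"
  have w0: "w (param c x) = 0" if "x \<in> codom c" "x \<notin> cball x0 r" for x
  proof (rule supp, rule notI)
    assume "param c x \<in> param c ` cball x0 r"
    then obtain y where y: "y \<in> cball x0 r" "param c x = param c y" by (rule imageE)
    then have "coord c (param c x) = coord c (param c y)" by simp
    then have "x = y" using cf(4)[OF that(1)] cf(4)[OF subsetD[OF B y(1)]] by simp
    then show False using y that by simp
  qed
  have Zin: "C1_on (codom c) (Z i)" for i
  proof (rule C1_on_cong[OF cf(2)])
    show "C1_on (codom c) (\<lambda>x. ?G x * X x $ i * (w \<circ> param c) x)"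
      unfolding X_def by (intro C1_on_mult sqrt_det_gram_C1 grad_in_C1 f c C1_fun_D[OF w])
  qed (simp add: Z_def)
  have Zout: "C1_on (- cball x0 r) (Z i)" for i
    by (rule C1_on_cong[of _ _ "\<lambda>_. 0"]) (auto simp: Z_def w0)
  have ZC1: "C1_on UNIV (Z i)" for i
  proof (rule C1_on_locally)
    fix x
    show "\<exists>V. open V \<and> x \<in> V \<and> C1_on V (Z i)"
      using Zin[of i] Zout[of i] cf(2) B by (cases "x \<in> codom c") (auto intro: exI[of _ "- cball x0 r"])
  qed
  have Z0: "Z i x = 0" if "norm x > norm x0 + r" for i x
  proof -
    have "x \<notin> cball x0 r"
      using that norm_triangle_ineq2[of x x0] by (auto simp: dist_norm norm_minus_commute)
    then show ?thesis by (simp add: Z_def w0)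
  qed
  note int0 = integral_derivative_compact_support[OF ZC1 Z0]
  have dsum: "(\<Sum>i\<in>UNIV. partial i (Z i) x) =
      chart_density c x * (grad_prod M w f (param c x) - w (param c x) * k (param c x))" for x
  proof (cases "x \<in> codom c")
    case True
    have Gpos: "?G x > 0" using det_gram_pos[OF c True] by simp
    have "partial i (Z i) x = partial i (\<lambda>y. ?G y * X y $ i) x * w (param c x)
        + ?G x * X x $ i * chart_diff c w x $ i" for i
    proof -
      have 1: "C1_on (codom c) (\<lambda>x. ?G x * X x $ i)"
        unfolding X_def by (intro C1_on_mult sqrt_det_gram_C1 grad_in_C1 f c)
      have "((\<lambda>y. (?G y * X y $ i) * (w \<circ> param c) y) has_derivative
        (\<lambda>v. (?G x * X x $ i) * (chart_diff c w x \<bullet> v)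
          + frechet_derivative (\<lambda>x. ?G x * X x $ i) (at x) v * (w \<circ> param c) x)) (at x)"
        by (rule has_derivative_mult[OF C1_on_has_derivative[OF 1 True] C1_fun_has_derivative[OF w c True]])
      then have "(Z i has_derivative
        (\<lambda>v. (?G x * X x $ i) * (chart_diff c w x \<bullet> v)
          + frechet_derivative (\<lambda>x. ?G x * X x $ i) (at x) v * (w \<circ> param c) x)) (at x)"
        by (rule has_derivative_transform_within_open[OF _ cf(2) True]) (simp add: Z_def)
      from fun_cong[OF frechet_derivative_at[OF this], of "axis i 1"] show ?thesis
        by (simp add: partial_def inner_axis)
    qed
    then have "(\<Sum>i\<in>UNIV. partial i (Z i) x) =
        (\<Sum>i\<in>UNIV. partial i (\<lambda>y. ?G y * X y $ i) x) * w (param c x) + ?G x * grad_prod_in M c w f x"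
      by (simp add: sum.distrib sum_distrib_right sum_distrib_left grad_prod_in_def inner_vec_def X_def algebra_simps)
    also have "(\<Sum>i\<in>UNIV. partial i (\<lambda>y. ?G y * X y $ i) x) = - ?G x * k (param c x)"
    proof -
      have "- div_in M c X x = k (param c x)"
        using k(1) c True unfolding laplacian_is_def X_def by blast
      then show ?thesis using Gpos unfolding div_in_def by (simp add: field_simps)
    qed
    finally show ?thesis
      using True grad_prod_param[OF w fC1 c True] by (simp add: chart_density_def algebra_simps)
  next
    case False
    then have "x \<in> - cball x0 r" using B by blast
    have "frechet_derivative (Z i) (at x) = (\<lambda>_. 0)" for i
    proof -
      have "(Z i has_derivative (\<lambda>_. 0)) (at x)"
        by (rule has_derivative_transform_within_open[of "\<lambda>_. 0" _ _ _ "- cball x0 r"])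
          (use \<open>x \<in> - cball x0 r\<close> w0 in \<open>auto simp: Z_def\<close>)
      then show ?thesis by (metis frechet_derivative_at)
    qed
    then show ?thesis using False by (simp add: partial_def chart_density_def)
  qed
  let ?g = "\<lambda>p. grad_prod M w f p - w p * k p"
  have contg: "continuous_on UNIV (grad_prod M w f)" "continuous_on UNIV (\<lambda>p. w p * k p)"
    by (intro continuous_intros grad_prod_continuous w fC1 k C1_fun_continuous)+
  have "closed (param c ` cball x0 r)"
    by (rule compact_imp_closed, rule compact_continuous_image)
      (use cf(8) B continuous_on_subset in auto)
  then have op: "open (- param c ` cball x0 r)" by auto
  have g0: "?g p = 0" if "p \<notin> cdom c" for p
  proof -
    have p: "p \<in> - param c ` cball x0 r" using that cf(6) B by auto
    have "grad_prod M w f p = 0"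
      by (rule grad_prod_locally_zero[OF w fC1 op p]) (use supp in auto)
    then show ?thesis using supp p by simp
  qed
  have "(\<integral>p. ?g p \<partial>vol) = (\<integral>p. indicator (cdom c) p * ?g p \<partial>vol)"
    by (rule Bochner_Integration.integral_cong) (use g0 in \<open>auto simp: indicator_def\<close>)
  also have "\<dots> = (\<integral>x. chart_density c x * ?g (param c x) \<partial>lborel)"
    by (rule integral_chart[OF c])
      (intro borel_measurable_continuous_onI continuous_intros contg)
  also have "\<dots> = (\<integral>x. (\<Sum>i\<in>UNIV. partial i (Z i) x) \<partial>lborel)"
    using dsum by simp
  also have "\<dots> = (\<Sum>i\<in>UNIV. (\<integral>x. partial i (Z i) x \<partial>lborel))"
    unfolding partial_def by (rule Bochner_Integration.integral_sum) (rule int0(1))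
  also have "\<dots> = 0"
    unfolding partial_def using int0(2) by (simp add: sum.neutral)
  finally have "(\<integral>p. ?g p \<partial>vol) = 0" .
  then show ?thesis
    using Bochner_Integration.integral_diff[OF continuous_integrable[OF contg(1)] continuous_integrable[OF contg(2)]]
    by simp
qed

lemma C1_fun_extend_zero:
  assumes c: "c \<in> atlas M" and K: "compact K" "K \<subseteq> codom c"
    and \<beta>: "C1_on (codom c) \<beta>" "\<And>x. x \<notin> K \<Longrightarrow> \<beta> x = 0"
  shows "C1_fun M (\<lambda>p. if p \<in> cdom c then \<beta> (coord c p) else 0)" (is "C1_fun M ?b")
  unfolding C1_fun_def
proof (intro ballI C1_on_locally)
  note cf = chart_facts[OF c]
  have "closed (param c ` K)"
    by (rule compact_imp_closed, rule compact_continuous_image)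
      (use cf(8) K continuous_on_subset in auto)
  then have op: "open (- param c ` K)" by auto
  fix d y assume d: "d \<in> atlas M" "y \<in> codom d"
  note df = chart_facts[OF d(1)]
  show "\<exists>V. open V \<and> y \<in> V \<and> C1_on V (?b \<circ> param d)"
  proof (cases "param d y \<in> cdom c")
    case True
    let ?V = "coord d ` (cdom d \<inter> cdom c)"
    have V: "open ?V" "y \<in> ?V"
      using chart_image_open[OF chart[OF d(1)] cf(1)] True df d(2)
      by (auto intro!: image_eqI[of _ _ "param d y"])
    have T: "C1_on ?V (coord c \<circ> param d)"
      using smooth_map_id d(1) c unfolding smooth_map_def
      by (intro smooth_on_imp_C1_on) auto
    have "C1_on ?V (\<lambda>x. \<beta> ((coord c \<circ> param d) x))"
      by (rule C1_on_compose[OF \<beta>(1) T]) (use df cf in auto)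
    then have "C1_on ?V (?b \<circ> param d)"
      by (rule C1_on_cong[OF V(1), rotated]) (use df in auto)
    then show ?thesis using V by blast
  next
    case False
    let ?V = "coord d ` (cdom d \<inter> - param c ` K)"
    have V: "open ?V" "y \<in> ?V"
      using chart_image_open[OF chart[OF d(1)] op] False df d(2) K(2) cf(6)
      by (auto intro!: image_eqI[of _ _ "param d y"])
    have b0: "?b p = 0" if "p \<notin> param c ` K" for p
      using \<beta>(2) that cf(3) by (metis image_eqI)
    have "C1_on ?V (?b \<circ> param d)"
    proof (rule C1_on_cong[OF V(1) _ C1_on_const[of _ 0]])
      fix x assume "x \<in> ?V"
      then have "param d x \<notin> param c ` K" using df(3) by force
      from b0[OF this] show "(?b \<circ> param d) x = 0" unfolding comp_apply .
    qed
    then show ?thesis using V by blast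
  qed
qed

text \<open>The test function is split by a partition of unity subordinate to coordinate balls. Its
  members only have to be continuously differentiable, so squares of truncated quadratic
  functions serve as bumps.\<close>

lemma Green:
  assumes w: "C1_fun M w" and f: "smooth_function M f" and k: "laplacian_is M f k" "continuous_on UNIV k"
  shows "(\<integral>p. w p * k p \<partial>vol) = (\<integral>p. grad_prod M w f p \<partial>vol)"
proof -
  obtain I c x r where "finite (I :: 'm set) \<and>
     (\<forall>p\<in>I. c p \<in> atlas M \<and> (0::real) < r p \<and> cball (x p) (r p) \<subseteq> codom (c p)) \<and>
     (\<Union>p\<in>I. param (c p) ` ball (x p) (r p)) = UNIV"
    using finite_chart_ball_cover by blast
  then have I: "finite I" "\<And>p. p \<in> I \<Longrightarrow> c p \<in> atlas M" "\<And>p. p \<in> I \<Longrightarrow> r p > 0"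
    "\<And>p. p \<in> I \<Longrightarrow> cball (x p) (r p) \<subseteq> codom (c p)" "(\<Union>p\<in>I. param (c p) ` ball (x p) (r p)) = UNIV"
    by blast+
  have fC1: "C1_fun M f" using f by (rule smooth_function_imp_C1_fun)
  define \<beta> where "\<beta> i y = (max 0 ((r i)\<^sup>2 - (y - x i) \<bullet> (y - x i)))\<^sup>2" for i y
  define b where "b i p = (if p \<in> cdom (c i) then \<beta> i (coord (c i) p) else 0)" for i p
  have \<beta>C1: "C1_on UNIV (\<beta> i)" for i
  proof -
    have 1: "C1_on UNIV (\<lambda>y. (r i)\<^sup>2 - (y - x i) \<bullet> (y - x i))"
      by (rule C1_onI[where f'="\<lambda>y v. - 2 * ((y - x i) \<bullet> v)"])
        (auto intro!: derivative_eq_intros continuous_intros simp: inner_commute)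
    have "((\<lambda>t. (max 0 t)\<^sup>2) has_real_derivative 2 * max 0 t) (at t)" for t :: real
    proof -
      consider "t > 0" | "t < 0" | "t = 0" by linarith
      then show ?thesis
      proof cases
        case 1
        then have "((\<lambda>t. t\<^sup>2) has_real_derivative 2 * max 0 t) (at t)"
          by (auto intro!: derivative_eq_intros)
        then show ?thesis
          by (rule has_field_derivative_transform_within_open[where S="{0<..}"]) (use 1 in auto)
      next
        case 2
        then have "((\<lambda>t::real. 0) has_real_derivative 2 * max 0 t) (at t)"
          by (auto intro!: derivative_eq_intros)
        then show ?thesis
          by (rule has_field_derivative_transform_within_open[where S="{..<0}"]) (use 2 in auto)
      next
        case 3
        have "((\<lambda>h::real. (max 0 h)\<^sup>2 / h) \<longlongrightarrow> 0) (at 0)"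
        proof (rule tendsto_rabs_zero_cancel, rule tendsto_sandwich[of "\<lambda>_. 0" _ _ "\<lambda>h. \<bar>h\<bar>"])
          show "\<forall>\<^sub>F h::real in at 0. \<bar>(max 0 h)\<^sup>2 / h\<bar> \<le> \<bar>h\<bar>"
            by (rule always_eventually) (auto simp: max_def power2_eq_square)
          show "((\<lambda>h::real. \<bar>h\<bar>) \<longlongrightarrow> 0) (at 0)" by (rule tendsto_rabs_zero) (rule tendsto_ident_at)
        qed auto
        then show ?thesis using 3 by (simp add: has_field_derivative_iff)
      qed
    qed
    then show ?thesis
      unfolding \<beta>_def
      by (intro C1_on_real_comp[OF 1, where q="\<lambda>t. (max 0 t)\<^sup>2" and q'="\<lambda>t. 2 * max 0 t"])
        (auto intro!: continuous_intros)
  qed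
  have \<beta>0: "\<beta> i y = 0" if "i \<in> I" "y \<notin> cball (x i) (r i)" for i y
  proof -
    have "(r i)\<^sup>2 \<le> (norm (y - x i))\<^sup>2"
      using that I(3)[OF that(1)] by (intro power_mono) (auto simp: dist_norm norm_minus_commute)
    then show ?thesis by (simp add: \<beta>_def power2_norm_eq_inner[symmetric])
  qed
  have \<beta>pos: "\<beta> i y > 0" if "i \<in> I" "y \<in> ball (x i) (r i)" for i y
  proof -
    have "(norm (y - x i))\<^sup>2 < (r i)\<^sup>2"
      using that by (intro power_strict_mono) (auto simp: dist_norm norm_minus_commute)
    then show ?thesis by (simp add: \<beta>_def power2_norm_eq_inner[symmetric])
  qed
  have bC1: "C1_fun M (b i)" if "i \<in> I" for i
    unfolding b_def
    by (rule C1_fun_extend_zero[OF I(2)[OF that] compact_cball I(4)[OF that]])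
      (use C1_on_subset[OF \<beta>C1] \<beta>0 that in auto)
  have bnn: "b i p \<ge> 0" for i p by (simp add: b_def \<beta>_def)
  have bpos: "(\<Sum>i\<in>I. b i p) > 0" for p
  proof -
    obtain i y where i: "i \<in> I" "y \<in> ball (x i) (r i)" "p = param (c i) y" using I(5) by blast
    then have "y \<in> codom (c i)" using I(4) ball_subset_cball by blast
    then have "b i p > 0"
      using \<beta>pos[OF i(1,2)] chart_facts[OF I(2)[OF i(1)]] by (simp add: b_def i(3))
    also have "b i p \<le> (\<Sum>i\<in>I. b i p)" by (rule member_le_sum) (use i I(1) bnn in auto)
    finally show ?thesis .
  qed
  define W where "W i p = w p * b i p / (\<Sum>j\<in>I. b j p)" for i p
  have WC1: "C1_fun M (W i)" if "i \<in> I" for i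
    unfolding W_def using bpos
    by (intro C1_fun_divide C1_fun_mult w bC1 that C1_fun_sum) (auto simp: less_imp_neq[symmetric])
  have Wsum: "w p = (\<Sum>i\<in>I. W i p)" for p
    using bpos[of p] by (simp add: W_def sum_divide_distrib[symmetric] sum_distrib_left[symmetric])
  have G: "(\<integral>p. W i p * k p \<partial>vol) = (\<integral>p. grad_prod M (W i) f p \<partial>vol)" if i: "i \<in> I" for i
  proof (rule Green_chart[OF WC1[OF i] f k I(2)[OF i] I(4)[OF i]])
    fix p assume "p \<notin> param (c i) ` cball (x i) (r i)"
    then have "b i p = 0"
      using \<beta>0[OF i] chart_facts(3)[OF I(2)[OF i]] unfolding b_def by (metis image_eqI)
    then show "W i p = 0" by (simp add: W_def)
  qed
  have gsum: "grad_prod M (\<lambda>p. \<Sum>i\<in>J. W i p) f p = (\<Sum>i\<in>J. grad_prod M (W i) f p)" if "J \<subseteq> I" for J p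
    using finite_subset[OF that I(1)] that
  proof (induction J rule: finite_induct)
    case (insert j J)
    then have "C1_fun M (W j)" "C1_fun M (\<lambda>p. \<Sum>i\<in>J. W i p)" using WC1 by (auto intro!: C1_fun_sum)
    from grad_prod_add[OF this fC1] show ?case using insert by simp
  qed (simp add: fC1)
  have "(\<integral>p. w p * k p \<partial>vol) = (\<integral>p. (\<Sum>i\<in>I. W i p * k p) \<partial>vol)"
    by (simp add: Wsum sum_distrib_right)
  also have "\<dots> = (\<Sum>i\<in>I. (\<integral>p. W i p * k p \<partial>vol))"
    by (rule Bochner_Integration.integral_sum)
      (intro continuous_integrable continuous_intros k C1_fun_continuous WC1)
  also have "\<dots> = (\<Sum>i\<in>I. (\<integral>p. grad_prod M (W i) f p \<partial>vol))" using G by simp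
  also have "\<dots> = (\<integral>p. (\<Sum>i\<in>I. grad_prod M (W i) f p) \<partial>vol)"
    by (rule Bochner_Integration.integral_sum[symmetric])
      (intro continuous_integrable grad_prod_continuous fC1 WC1)
  also have "\<dots> = (\<integral>p. grad_prod M w f p \<partial>vol)"
    using gsum[of I] Wsum by (simp add: ext[of w, OF Wsum])
  finally show ?thesis .
qed

section \<open>Isometries\<close>

text \<open>If \<open>J\<close> is the Jacobian matrix of the isometry in coordinates, the metric transforms as
  \<open>g = J\<^sup>T g' J\<close>, so the density \<open>\<surd>(det g)\<close> picks up exactly the factor \<open>|det J|\<close> of the
  change of variables.\<close>

lemma isometry_emeasure_chart:
  assumes T: "isometry M T" and c: "c \<in> atlas M" and d: "d \<in> atlas M"
    and S: "S \<in> sets borel" "S \<subseteq> cdom c" "T ` S \<subseteq> cdom d"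
  shows "emeasure vol (T ` S) = emeasure vol S"
proof -
  note cf = chart_facts[OF c] and df = chart_facts[OF d]
  have bij: "bij T" and sm: "smooth_map M T" "smooth_map M (inv T)" and pm: "preserves_metric M T"
    using T by (auto simp: isometry_def)
  have "T ` S = inv T -` S" using bij by (simp add: bij_vimage_eq_inv_image bij_imp_bij_inv inv_inv_eq)
  also have "\<dots> \<in> sets borel"
    using measurable_sets[OF borel_measurable_continuous_onI, of "inv T" S] sm(2) S(1)
    by (simp add: smooth_map_def)
  finally have TS: "T ` S \<in> sets borel" .
  define E where "E = coord c ` S"
  define J where "J = coord d \<circ> T \<circ> param c"
  define J' where "J' x = (\<lambda>v. jacobian J (at x) *v v)" for x
  have "cdom c \<inter> S = S" "cdom d \<inter> T ` S = T ` S" using S by auto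
  then have E: "E \<in> sets borel" and Eimg: "coord d ` T ` S \<in> sets borel"
    using borel_coord_image[OF c S(1)] borel_coord_image[OF d TS] by (simp_all add: E_def)
  have Ec: "x \<in> codom c" "param c x \<in> S" if "x \<in> E" for x
    using that S(2) cf by (auto simp: E_def)
  have JE: "J ` E = coord d ` T ` S"
    using S(2) cf(3) by (force simp: J_def E_def image_image subset_iff)
  have "inj_on J E"
  proof (rule inj_onI)
    fix x y assume xy: "x \<in> E" "y \<in> E" "J x = J y"
    then have "T (param c x) = T (param c y)"
      using Ec S(3) inj_onD[OF df(9), of "T (param c x)" "T (param c y)"] by (auto simp: J_def)
    then have "param c x = param c y" using bij by (metis bij_inv_eq_iff)
    then show "x = y" using Ec xy cf(4) by metis
  qed
  have Jder: "(J has_derivative J' x) (at x within E)" if "x \<in> E" for x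
  proof -
    have "C1_on (coord c ` (cdom c \<inter> T -` cdom d)) J"
      using sm(1) c d unfolding smooth_map_def J_def by (intro smooth_on_imp_C1_on) blast
    moreover have "x \<in> coord c ` (cdom c \<inter> T -` cdom d)"
      using that S(2,3) unfolding E_def by blast
    ultimately have "J differentiable at x" unfolding C1_on_def by blast
    then have "(J has_derivative J' x) (at x)" unfolding J'_def by (simp add: jacobian_works)
    then show ?thesis by (rule has_derivative_at_withinI)
  qed
  have dens: "chart_density c x = \<bar>det (matrix (J' x))\<bar> * chart_density d (J x)" if "x \<in> E" for x
  proof -
    have px: "param c x \<in> cdom c" "T (param c x) \<in> cdom d" "coord c (param c x) = x" "x \<in> codom c"
      using Ec[OF that] S cf(4) by auto
    have m: "matrix (J' x) = jacobian J (at x)" by (simp add: J'_def)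
    have "gram M c x = transpose (jacobian J (at x)) ** gram M d (J x) ** jacobian J (at x)"
      using pm c d px unfolding preserves_metric_def Let_def J_def by (metis comp_apply)
    then have "det (gram M c x) = (det (jacobian J (at x)))\<^sup>2 * det (gram M d (J x))"
      by (simp add: det_mul power2_eq_square)
    moreover have "J x \<in> codom d" using px df(5) by (simp add: J_def)
    ultimately show ?thesis using px by (simp add: chart_density_def m real_sqrt_mult)
  qed
  have e1: "emeasure vol S = (\<integral>\<^sup>+x. ennreal (chart_density c x) * indicator E x \<partial>lborel)"
    unfolding E_def by (rule emeasure_vol_chart[OF c S(1,2)])
  have e2: "emeasure vol (T ` S) = (\<integral>\<^sup>+x. ennreal (chart_density d x) * indicator (J ` E) x \<partial>lborel)"
    unfolding JE by (rule emeasure_vol_chart[OF d TS S(3)])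
  have "(\<integral>\<^sup>+x. ennreal (chart_density c x) * indicator E x \<partial>lborel) =
      (\<integral>\<^sup>+x. ennreal (chart_density d x) * indicator (J ` E) x \<partial>lborel)"
  proof (rule nn_integral_change_of_variables[OF E _ \<open>inj_on J E\<close> Jder])
    show "J ` E \<in> sets borel" using JE Eimg by simp
    show "(\<lambda>x. chart_density c x * indicator E x) \<in> borel_measurable borel"
      using chart_density_measurable[OF c] E by measurable
    show "(\<integral>\<^sup>+x. ennreal (chart_density d x) * indicator (J ` E) x \<partial>lborel) < \<infinity>"
      using e2 emeasure_finite[of "T ` S"] by (simp add: less_top)
  qed (use dens chart_density_measurable[OF d] chart_density_nonneg[OF d] in auto)
  then show ?thesis using e1 e2 by simp
qed

text \<open>A Borel set is cut into finitely many pieces, each of which is mapped from one chart into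
  another.\<close>

lemma isometry_distr:
  assumes T: "isometry M T"
  shows "distr vol borel T = vol"
proof (rule measure_eqI)
  show "sets (distr vol borel T) = sets vol" by (simp add: sets_vol)
  have bij: "bij T" and sm: "smooth_map M T"
    using T by (auto simp: isometry_def)
  have contT: "continuous_on UNIV T" using sm by (simp add: smooth_map_def)
  then have mT: "T \<in> borel_measurable borel" by (rule borel_measurable_continuous_onI)
  have mT': "T \<in> measurable vol borel" using mT by (simp add: measurable_cong_sets[OF sets_vol])
  have "\<forall>p. \<exists>c d. c \<in> atlas M \<and> d \<in> atlas M \<and> p \<in> cdom c \<and> T p \<in> cdom d" using ex_chart by meson
  then obtain c d where cd: "\<And>p. c p \<in> atlas M" "\<And>p. d p \<in> atlas M" "\<And>p. p \<in> cdom (c p)" "\<And>p. T p \<in> cdom (d p)"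
    by metis
  define U where "U p = cdom (c p) \<inter> T -` cdom (d p)" for p
  have Uopen: "open (U p)" for p
    unfolding U_def using chart_facts(1)[OF cd(1)] chart_facts(1)[OF cd(2)] contT
    by (intro open_Int) (auto intro: open_vimage)
  have "UNIV \<subseteq> (\<Union>p\<in>UNIV. U p)" using cd(3,4) by (auto simp: U_def)
  then obtain I where I: "finite I" "UNIV \<subseteq> (\<Union>p\<in>I. U p)"
    using compactE_image[OF compact, of UNIV U] Uopen by metis
  have inv: "emeasure vol (T ` (\<Union>p\<in>J. S \<inter> U p)) = emeasure vol (\<Union>p\<in>J. S \<inter> U p)"
    if S: "S \<in> sets borel" and J: "finite J" for S J
    using J S
  proof (induction J arbitrary: S rule: finite_induct)
    case (insert j J)
    let ?A = "S \<inter> U j" and ?B = "\<Union>p\<in>J. (S - U j) \<inter> U p"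
    have eq: "(\<Union>p\<in>insert j J. S \<inter> U p) = ?A \<union> ?B" by auto
    have A: "?A \<in> sets borel" and S': "S - U j \<in> sets borel" using insert.prems Uopen by auto
    have B: "?B \<in> sets borel"
      using S' Uopen insert.hyps(1) by (intro sets.finite_UN sets.Int) auto
    have im: "T ` X \<in> sets borel" if "X \<in> sets borel" for X
    proof -
      have "T ` X = inv T -` X" using bij by (simp add: bij_vimage_eq_inv_image bij_imp_bij_inv inv_inv_eq)
      moreover have "continuous_on UNIV (inv T)" using T by (simp add: isometry_def smooth_map_def)
      ultimately show ?thesis
        using measurable_sets[OF borel_measurable_continuous_onI, of "inv T" X] that by simp
    qed
    have "T ` ?A \<inter> T ` ?B = {}" using bij by (auto simp: bij_def dest: injD)
    then have "emeasure vol (T ` (?A \<union> ?B)) = emeasure vol (T ` ?A) + emeasure vol (T ` ?B)"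
      unfolding image_Un by (intro plus_emeasure[symmetric]) (use im[OF A] im[OF B] in \<open>auto simp: sets_vol\<close>)
    also have "emeasure vol (T ` ?A) = emeasure vol ?A"
      by (rule isometry_emeasure_chart[OF T cd(1)[of j] cd(2)[of j] A]) (auto simp: U_def)
    also have "emeasure vol (T ` ?B) = emeasure vol ?B" by (rule insert.IH[OF S'])
    also have "emeasure vol ?A + emeasure vol ?B = emeasure vol (?A \<union> ?B)"
      by (rule plus_emeasure) (use A B in \<open>auto simp: sets_vol\<close>)
    finally show ?case unfolding eq .
  qed simp
  fix X assume "X \<in> sets (distr vol borel T)"
  then have X: "X \<in> sets borel" by simp
  define S where "S = T -` X"
  have S: "S \<in> sets borel" using measurable_sets[OF mT X] by (simp add: S_def)
  have "(\<Union>p\<in>I. S \<inter> U p) = S" using I(2) by auto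
  then have "emeasure vol (T ` S) = emeasure vol S" using inv[OF S I(1)] by simp
  moreover have "T ` S = X" unfolding S_def using bij by (simp add: bij_is_surj surj_image_vimage_eq)
  ultimately show "emeasure (distr vol borel T) X = emeasure vol X"
    using emeasure_distr[OF mT' X] by (simp add: S_def)
qed

lemma isometry_integral:
  fixes g :: "'m \<Rightarrow> real"
  assumes "isometry M T" "g \<in> borel_measurable borel"
  shows "(\<integral>p. g (T p) \<partial>vol) = (\<integral>p. g p \<partial>vol)"
proof -
  have "T \<in> borel_measurable borel"
    using assms(1) by (intro borel_measurable_continuous_onI) (simp add: isometry_def smooth_map_def)
  then have "T \<in> measurable vol borel" by (simp add: measurable_cong_sets[OF sets_vol])
  then have "(\<integral>p. g p \<partial>distr vol borel T) = (\<integral>p. g (T p) \<partial>vol)"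
    by (rule integral_distr) (rule assms(2))
  then show ?thesis using isometry_distr[OF assms(1)] by simp
qed

lemma isometry_inv:
  assumes "isometry M T"
  shows "smooth_map M (inv T)" "inv T (T p) = p" "T (inv T p) = p"
  using assms by (auto simp: isometry_def bij_is_inj bij_is_surj surj_f_inv_f)

end

section \<open>Curves and the Riemannian distance\<close>

text \<open>The derivative of a curve may be unbounded near its breakpoints. The fundamental theorem of
  calculus then still holds for the Henstock integral, while the right-hand side may be
  infinite.\<close>

lemma has_integral_abs_le_nn_integral:
  fixes k' :: "real \<Rightarrow> real"
  assumes "(k' has_integral I) {u..v}"
  shows "ennreal \<bar>I\<bar> \<le> (\<integral>\<^sup>+s. ennreal \<bar>k' s\<bar> * indicator {u..v} s \<partial>lborel)"
proof (cases "(\<integral>\<^sup>+s. ennreal \<bar>k' s\<bar> * indicator {u..v} s \<partial>lborel) = \<infinity>")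
  case False
  have m: "(\<lambda>s. indicator {u..v} s *\<^sub>R k' s) \<in> borel_measurable lebesgue"
    using has_integral_implies_lebesgue_measurable[OF assms] .
  have eq: "(\<integral>\<^sup>+s. ennreal (norm (indicator {u..v} s *\<^sub>R k' s)) \<partial>lebesgue) =
      (\<integral>\<^sup>+s. ennreal \<bar>k' s\<bar> * indicator {u..v} s \<partial>lborel)"
    unfolding nn_integral_completion by (rule nn_integral_cong) (auto simp: indicator_def)
  have int: "integrable lebesgue (\<lambda>s. indicator {u..v} s *\<^sub>R k' s)"
  proof (rule integrableI_bounded[OF m])
    show "(\<integral>\<^sup>+s. ennreal (norm (indicator {u..v} s *\<^sub>R k' s)) \<partial>lebesgue) < \<infinity>"
      unfolding eq using False by (simp add: less_top)
  qed
  then have "I = (LINT s:{u..v}|lebesgue. k' s)"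
    using set_lebesgue_integral_eq_integral(2)[of "{u..v}" k'] assms
    by (simp add: set_integrable_def integral_unique)
  then have "\<bar>I\<bar> \<le> integral\<^sup>L lebesgue (\<lambda>s. norm (indicator {u..v} s *\<^sub>R k' s))"
    unfolding set_lebesgue_integral_def
    using integral_norm_bound[of lebesgue "\<lambda>s. indicator {u..v} s *\<^sub>R k' s"] by simp
  then have "ennreal \<bar>I\<bar> \<le> ennreal (integral\<^sup>L lebesgue (\<lambda>s. norm (indicator {u..v} s *\<^sub>R k' s)))"
    by (rule ennreal_leI)
  also have "\<dots> = (\<integral>\<^sup>+s. ennreal (norm (indicator {u..v} s *\<^sub>R k' s)) \<partial>lebesgue)"
    by (rule nn_integral_eq_integral[symmetric]) (use int in \<open>auto intro: integrable_norm\<close>)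
  finally show ?thesis unfolding eq .
qed simp

context riemannian_mfd
begin

text \<open>The chain rule for the change of coordinates, and the transformation rule of the metric.\<close>

lemma curve_speed_chart:
  assumes c: "c \<in> atlas M" "\<gamma> s \<in> cdom c" and cont: "isCont \<gamma> s"
    and v: "((coord c \<circ> \<gamma>) has_vector_derivative v) (at s)"
  shows "curve_speed M \<gamma> s = sqrt (v \<bullet> (gram M c (coord c (\<gamma> s)) *v v))"
proof -
  define d where "d = (SOME c. c \<in> atlas M \<and> \<gamma> s \<in> cdom c)"
  have d: "d \<in> atlas M \<and> \<gamma> s \<in> cdom d"
    unfolding d_def by (rule someI[of _ c]) (use c in simp)
  note cf = chart_facts[OF c(1)]
  define S where "S = coord d \<circ> id \<circ> param c"
  define x where "x = coord c (\<gamma> s)"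
  let ?J = "jacobian S (at x)"
  have "C1_on (coord c ` (cdom c \<inter> cdom d)) S"
    using smooth_map_id c(1) d unfolding smooth_map_def S_def
    by (intro smooth_on_imp_C1_on) (simp add: o_def id_def)
  moreover have "x \<in> coord c ` (cdom c \<inter> cdom d)" using c d by (simp add: x_def)
  ultimately have "S differentiable at x" unfolding C1_on_def by blast
  then have SD: "(S has_derivative (\<lambda>w. ?J *v w)) (at x)" by (simp add: jacobian_works)
  have "((\<lambda>t. S ((coord c \<circ> \<gamma>) t)) has_derivative (\<lambda>h. ?J *v (h *\<^sub>R v))) (at s)"
    by (rule has_derivative_compose[OF v[unfolded has_vector_derivative_def]])
      (unfold comp_apply[of "coord c"] x_def[symmetric], rule SD)
  then have Sv: "((\<lambda>t. S ((coord c \<circ> \<gamma>) t)) has_vector_derivative ?J *v v) (at s)"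
    by (simp add: has_vector_derivative_def matrix_vector_mult_scaleR)
  obtain N where N: "open N" "s \<in> N" "\<And>t. t \<in> N \<Longrightarrow> \<gamma> t \<in> cdom c"
    using continuous_at_open[THEN iffD1, OF cont, rule_format, of "cdom c"] cf(1) c(2) by blast
  have "((coord d \<circ> \<gamma>) has_vector_derivative ?J *v v) (at s)"
    by (rule has_vector_derivative_transform_within_open[OF Sv N(1,2)]) (simp add: S_def cf(3) N(3))
  then have vd: "vector_derivative (coord d \<circ> \<gamma>) (at s) = ?J *v v" by (rule vector_derivative_at)
  have "gram M c x = transpose ?J ** gram M d (coord d (\<gamma> s)) ** ?J"
  proof -
    have "\<forall>p\<in>cdom c. id p \<in> cdom d \<longrightarrow>
        (let J = jacobian (coord d \<circ> id \<circ> param c) (at (coord c p))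
         in gram M c (coord c p) = transpose J ** gram M d (coord d (id p)) ** J)"
      using preserves_metric_id c(1) d unfolding preserves_metric_def by blast
    from this[rule_format, of "\<gamma> s"] c(2) d show ?thesis
      unfolding Let_def S_def[symmetric] x_def[symmetric] by (simp only: id_apply)
  qed
  then have "v \<bullet> (gram M c x *v v) = (?J *v v) \<bullet> (gram M d (coord d (\<gamma> s)) *v (?J *v v))"
    using matrix_transpose_inner[of ?J v "gram M d (coord d (\<gamma> s)) *v (?J *v v)"]
    by (simp add: matrix_vector_mul_assoc matrix_mul_assoc)
  then show ?thesis
    unfolding curve_speed_def Let_def d_def[symmetric] vd by (simp add: x_def)
qed

text \<open>A curve piece that is continuously differentiable with speed at most \<^term>\<open>L\<close> on an
  open set of parameters. Bounding the speed rather than the length makes it trivial to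
  reverse and to concatenate curves.\<close>

definition C1_piece :: "(real \<Rightarrow> 'm) \<Rightarrow> real \<Rightarrow> real set \<Rightarrow> bool" where
  "C1_piece \<gamma> L T \<longleftrightarrow> open T \<and> continuous_on T \<gamma> \<and>
     (\<forall>c\<in>atlas M. (coord c \<circ> \<gamma>) C1_differentiable_on {s \<in> T. \<gamma> s \<in> cdom c}) \<and>
     (\<forall>s\<in>T. curve_speed M \<gamma> s \<le> L)"

definition reachable :: "real \<Rightarrow> 'm \<Rightarrow> 'm \<Rightarrow> bool" where
  "reachable L p q \<longleftrightarrow> L > 0 \<and> (\<exists>\<gamma> S. finite S \<and> continuous_on {0..1} \<gamma> \<and>
     C1_piece \<gamma> L ({0<..<1} - S) \<and> \<gamma> 0 = p \<and> \<gamma> 1 = q)"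

lemma reachable_pos: "reachable L p q \<Longrightarrow> L > 0" by (simp add: reachable_def)

lemma C1_piece_affine:
  assumes piece: "C1_piece \<gamma> L T" and m: "m \<noteq> 0"
    and eq: "open T'" "\<And>s. s \<in> T' \<Longrightarrow> m * s + k \<in> T \<and> \<delta> s = \<gamma> (m * s + k)"
  shows "C1_piece \<delta> (\<bar>m\<bar> * L) T'"
proof -
  have T: "open T" "continuous_on T \<gamma>" using piece by (auto simp: C1_piece_def)
  have "continuous_on T' (\<lambda>s. \<gamma> (m * s + k))"
    by (rule continuous_on_compose2[OF T(2)]) (use eq in \<open>auto intro!: continuous_intros\<close>)
  then have cont: "continuous_on T' \<delta>"
    by (rule continuous_on_eq) (use eq in auto)
  have der: "((coord c \<circ> \<delta>) has_vector_derivative m *\<^sub>R v) (at s)"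
    if s: "s \<in> T'" and v: "((coord c \<circ> \<gamma>) has_vector_derivative v) (at (m * s + k))" for c s v
  proof -
    have "((\<lambda>s. m * s + k) has_vector_derivative m) (at s)"
      by (auto intro!: derivative_eq_intros simp: has_vector_derivative_def mult.commute)
    from vector_diff_chain_at[OF this v]
    have "((coord c \<circ> \<gamma>) \<circ> (\<lambda>s. m * s + k) has_vector_derivative m *\<^sub>R v) (at s)" .
    then show ?thesis
      by (rule has_vector_derivative_transform_within_open[OF _ eq(1) s]) (use eq in auto)
  qed
  have vder: "((coord c \<circ> \<gamma>) has_vector_derivative vector_derivative (coord c \<circ> \<gamma>) (at s)) (at s)"
    and vcont: "continuous_on {s \<in> T. \<gamma> s \<in> cdom c} (\<lambda>s. vector_derivative (coord c \<circ> \<gamma>) (at s))"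
    if "c \<in> atlas M" "s \<in> T" "\<gamma> s \<in> cdom c" for c s
  proof -
    have "(coord c \<circ> \<gamma>) C1_differentiable_on {s \<in> T. \<gamma> s \<in> cdom c}"
      using piece that(1) unfolding C1_piece_def by blast
    then show "((coord c \<circ> \<gamma>) has_vector_derivative vector_derivative (coord c \<circ> \<gamma>) (at s)) (at s)"
      "continuous_on {s \<in> T. \<gamma> s \<in> cdom c} (\<lambda>s. vector_derivative (coord c \<circ> \<gamma>) (at s))"
      using that(2,3) unfolding C1_differentiable_on_eq by (auto simp: vector_derivative_works)
  qed
  show ?thesis
    unfolding C1_piece_def
  proof (intro conjI ballI)
    fix c assume c: "c \<in> atlas M"
    let ?V = "\<lambda>s. vector_derivative (coord c \<circ> \<gamma>) (at s)"
    show "(coord c \<circ> \<delta>) C1_differentiable_on {s \<in> T'. \<delta> s \<in> cdom c}"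
      unfolding C1_differentiable_on_def
    proof (intro exI[of _ "\<lambda>s. m *\<^sub>R ?V (m * s + k)"] conjI ballI)
      fix s assume "s \<in> {s \<in> T'. \<delta> s \<in> cdom c}"
      then have s: "s \<in> T'" "m * s + k \<in> T" "\<gamma> (m * s + k) \<in> cdom c" using eq(2)[of s] by auto
      show "((coord c \<circ> \<delta>) has_vector_derivative m *\<^sub>R ?V (m * s + k)) (at s)"
        by (rule der[OF s(1) vder[OF c s(2,3)]])
    next
      show "continuous_on {s \<in> T'. \<delta> s \<in> cdom c} (\<lambda>s. m *\<^sub>R ?V (m * s + k))"
      proof (cases "\<exists>s\<in>T. \<gamma> s \<in> cdom c")
        case True
        then have "continuous_on {s \<in> T. \<gamma> s \<in> cdom c} ?V" using vcont[OF c] by blast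
        then have "continuous_on {s \<in> T'. \<delta> s \<in> cdom c} (\<lambda>s. ?V (m * s + k))"
        proof (rule continuous_on_compose2)
          show "continuous_on {s \<in> T'. \<delta> s \<in> cdom c} (\<lambda>s. m * s + k)" by (intro continuous_intros)
          show "(\<lambda>s. m * s + k) ` {s \<in> T'. \<delta> s \<in> cdom c} \<subseteq> {s \<in> T. \<gamma> s \<in> cdom c}"
            using eq(2) by auto
        qed
        then show ?thesis by (intro continuous_on_scaleR continuous_on_const)
      next
        case False
        then have "{s \<in> T'. \<delta> s \<in> cdom c} = {}" using eq(2) by auto
        then show ?thesis by (simp only: continuous_on_empty)
      qed
    qed
  next
    fix s assume s: "s \<in> T'"
    obtain c where c: "c \<in> atlas M" "\<gamma> (m * s + k) \<in> cdom c" using ex_chart by blast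
    have sT: "m * s + k \<in> T" "\<delta> s = \<gamma> (m * s + k)" using eq(2)[OF s] by auto
    let ?v = "vector_derivative (coord c \<circ> \<gamma>) (at (m * s + k))"
    have "curve_speed M \<delta> s = sqrt ((m *\<^sub>R ?v) \<bullet> (gram M c (coord c (\<delta> s)) *v (m *\<^sub>R ?v)))"
    proof (rule curve_speed_chart[OF c(1)])
      show "\<delta> s \<in> cdom c" using sT(2) c(2) by simp
      show "isCont \<delta> s" using cont s continuous_on_eq_continuous_at[OF eq(1)] by blast
      show "((coord c \<circ> \<delta>) has_vector_derivative m *\<^sub>R ?v) (at s)"
        by (rule der[OF s vder[OF c(1) sT(1) c(2)]])
    qed
    also have "\<dots> = sqrt (m\<^sup>2 * (?v \<bullet> (gram M c (coord c (\<gamma> (m * s + k))) *v ?v)))"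
      by (simp add: sT(2) matrix_vector_mult_scaleR power2_eq_square)
    also have "\<dots> = \<bar>m\<bar> * curve_speed M \<gamma> (m * s + k)"
    proof -
      have "isCont \<gamma> (m * s + k)" using T(2) sT(1) continuous_on_eq_continuous_at[OF T(1)] by blast
      from curve_speed_chart[OF c this vder[OF c(1) sT(1) c(2)]] show ?thesis
        by (simp add: real_sqrt_mult)
    qed
    also have "\<dots> \<le> \<bar>m\<bar> * L"
      using piece sT(1) by (intro mult_left_mono) (auto simp: C1_piece_def)
    finally show "curve_speed M \<delta> s \<le> \<bar>m\<bar> * L" .
  qed (use cont eq in auto)
qed

lemma C1_piece_Un:
  assumes "C1_piece \<gamma> L T" "C1_piece \<gamma> L T'"
  shows "C1_piece \<gamma> L (T \<union> T')"
  unfolding C1_piece_def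
proof (intro conjI ballI)
  have op: "open T" "open T'" and cont: "continuous_on T \<gamma>" "continuous_on T' \<gamma>"
    using assms by (auto simp: C1_piece_def)
  then show "open (T \<union> T')" "continuous_on (T \<union> T') \<gamma>" by (auto intro: continuous_on_open_Un)
  fix c assume c: "c \<in> atlas M"
  have "open (T \<inter> \<gamma> -` cdom c)" "open (T' \<inter> \<gamma> -` cdom c)"
    using continuous_open_preimage[OF cont(1) op(1)] continuous_open_preimage[OF cont(2) op(2)]
      chart_facts(1)[OF c] by auto
  moreover have "{s \<in> T. \<gamma> s \<in> cdom c} = T \<inter> \<gamma> -` cdom c" "{s \<in> T'. \<gamma> s \<in> cdom c} = T' \<inter> \<gamma> -` cdom c"
    by auto
  ultimately have o: "open {s \<in> T. \<gamma> s \<in> cdom c}" "open {s \<in> T'. \<gamma> s \<in> cdom c}" by simp_all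
  have "(coord c \<circ> \<gamma>) C1_differentiable_on {s \<in> T. \<gamma> s \<in> cdom c}"
    "(coord c \<circ> \<gamma>) C1_differentiable_on {s \<in> T'. \<gamma> s \<in> cdom c}"
    using assms c by (auto simp: C1_piece_def)
  then have "(coord c \<circ> \<gamma>) C1_differentiable_on ({s \<in> T. \<gamma> s \<in> cdom c} \<union> {s \<in> T'. \<gamma> s \<in> cdom c})"
    unfolding C1_differentiable_on_eq using continuous_on_open_Un[OF o] by blast
  moreover have "{s \<in> T. \<gamma> s \<in> cdom c} \<union> {s \<in> T'. \<gamma> s \<in> cdom c} = {s \<in> T \<union> T'. \<gamma> s \<in> cdom c}" by auto
  ultimately show "(coord c \<circ> \<gamma>) C1_differentiable_on {s \<in> T \<union> T'. \<gamma> s \<in> cdom c}" by simp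
qed (use assms in \<open>auto simp: C1_piece_def\<close>)

lemma reachable_mono:
  assumes "reachable L p q" "L \<le> L'"
  shows "reachable L' p q"
proof -
  obtain \<gamma> S where g: "L > 0" "finite S" "continuous_on {0..1} \<gamma>" "C1_piece \<gamma> L ({0<..<1} - S)"
    "\<gamma> 0 = p" "\<gamma> 1 = q"
    using assms by (auto simp: reachable_def)
  have "C1_piece \<gamma> L' ({0<..<1} - S)"
    using g(4) assms(2) unfolding C1_piece_def by (meson order_trans)
  moreover have "L' > 0" using g(1) assms(2) by simp
  ultimately show ?thesis using g unfolding reachable_def by blast
qed

lemma reachable_sym:
  assumes "reachable L p q"
  shows "reachable L q p"
proof -
  obtain \<gamma> S where g: "L > 0" "finite S" "continuous_on {0..1} \<gamma>" "C1_piece \<gamma> L ({0<..<1} - S)"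
    "\<gamma> 0 = p" "\<gamma> 1 = q"
    using assms by (auto simp: reachable_def)
  let ?\<delta> = "\<lambda>s. \<gamma> (1 - s)" and ?S = "(\<lambda>s. 1 - s) ` S"
  have "C1_piece ?\<delta> (\<bar>-1\<bar> * L) ({0<..<1} - ?S)"
  proof (rule C1_piece_affine[OF g(4)])
    fix s assume s: "s \<in> {0<..<1} - ?S"
    have "1 - s \<notin> S"
    proof
      assume "1 - s \<in> S"
      then have "1 - (1 - s) \<in> ?S" by (rule imageI)
      then show False using s by simp
    qed
    then show "-1 * s + 1 \<in> {0<..<1} - S \<and> \<gamma> (1 - s) = \<gamma> (-1 * s + 1)" using s by simp
  qed (use g(2) in \<open>auto intro!: open_Diff finite_imp_closed\<close>)
  moreover have "continuous_on {0..1} ?\<delta>"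
    by (rule continuous_on_compose2[OF g(3)]) (auto intro!: continuous_intros)
  ultimately show ?thesis
    using g unfolding reachable_def
    by (intro conjI exI[of _ ?\<delta>] exI[of _ ?S]) auto
qed

lemma reachable_trans:
  assumes "reachable L p q" "reachable L' q r"
  shows "reachable (L + L') p r"
proof -
  obtain \<gamma> S where g: "L > 0" "finite S" "continuous_on {0..1} \<gamma>" "C1_piece \<gamma> L ({0<..<1} - S)"
    "\<gamma> 0 = p" "\<gamma> 1 = q"
    using assms by (auto simp: reachable_def)
  obtain \<gamma>' S' where g': "L' > 0" "finite S'" "continuous_on {0..1} \<gamma>'" "C1_piece \<gamma>' L' ({0<..<1} - S')"
    "\<gamma>' 0 = q" "\<gamma>' 1 = r"
    using assms by (auto simp: reachable_def)
  \<comment> \<open>the time spent on each part is proportional to its length bound\<close>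
  define l where "l = L / (L + L')"
  have l: "0 < l" "l < 1" using g(1) g'(1) by (auto simp: l_def)
  have l1: "1 / l * L = L + L'" "1 / (1 - l) * L' = L + L'"
    using g(1) g'(1) by (auto simp: l_def field_simps)
  define \<delta> where "\<delta> s = (if s \<le> l then \<gamma> (s / l) else \<gamma>' ((s - l) / (1 - l)))" for s
  define R where "R = (\<lambda>s. l * s) ` S \<union> {l} \<union> (\<lambda>s. l + (1 - l) * s) ` S'"
  have R: "finite R" using g(2) g'(2) by (simp add: R_def)
  have p1: "C1_piece \<delta> (\<bar>1 / l\<bar> * L) ({0<..<l} - R)"
  proof (rule C1_piece_affine[OF g(4)])
    fix s assume s: "s \<in> {0<..<l} - R"
    have "s / l \<notin> S"
    proof
      assume "s / l \<in> S"
      then have "l * (s / l) \<in> R" unfolding R_def by blast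
      then show False using s l by simp
    qed
    then show "1 / l * s + 0 \<in> {0<..<1} - S \<and> \<delta> s = \<gamma> (1 / l * s + 0)"
      using s l by (auto simp: \<delta>_def)
  qed (use l R in \<open>auto intro!: open_Diff finite_imp_closed\<close>)
  have p2: "C1_piece \<delta> (\<bar>1 / (1 - l)\<bar> * L') ({l<..<1} - R)"
  proof (rule C1_piece_affine[OF g'(4)])
    fix s assume s: "s \<in> {l<..<1} - R"
    have eq: "1 / (1 - l) * s + (- l / (1 - l)) = (s - l) / (1 - l)"
      by (simp add: diff_divide_distrib)
    have "(s - l) / (1 - l) \<notin> S'"
    proof
      assume "(s - l) / (1 - l) \<in> S'"
      then have "l + (1 - l) * ((s - l) / (1 - l)) \<in> R" unfolding R_def by blast
      moreover have "l + (1 - l) * ((s - l) / (1 - l)) = s"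
      proof -
        have nz: "1 - l \<noteq> 0" using l by simp
        show ?thesis unfolding times_divide_eq_right nonzero_mult_div_cancel_left[OF nz] by simp
      qed
      ultimately show False using s by simp
    qed
    then show "1 / (1 - l) * s + (- l / (1 - l)) \<in> {0<..<1} - S' \<and> \<delta> s = \<gamma>' (1 / (1 - l) * s + (- l / (1 - l)))"
      unfolding eq using s l by (auto simp: \<delta>_def)
  qed (use l R in \<open>auto intro!: open_Diff finite_imp_closed\<close>)
  have "({0<..<l} - R) \<union> ({l<..<1} - R) = {0<..<1} - R"
    using l by (auto simp: R_def)
  then have piece: "C1_piece \<delta> (L + L') ({0<..<1} - R)"
    using C1_piece_Un[of \<delta> "L + L'" "{0<..<l} - R" "{l<..<1} - R"] p1 p2 l l1 by simp
  have "continuous_on ({0..l} \<union> {l..1}) \<delta>"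
    unfolding \<delta>_def
  proof (rule continuous_on_cases)
    show "continuous_on {0..l} (\<lambda>s. \<gamma> (s / l))"
      by (rule continuous_on_compose2[OF g(3)]) (use l in \<open>auto intro!: continuous_intros\<close>)
    show "continuous_on {l..1} (\<lambda>s. \<gamma>' ((s - l) / (1 - l)))"
      by (rule continuous_on_compose2[OF g'(3)]) (use l in \<open>auto intro!: continuous_intros\<close>)
  qed (use l g(6) g'(5) in auto)
  moreover have "{0..l} \<union> {l..1} = {0..1}" using l by auto
  ultimately have "continuous_on {0..1} \<delta>" by simp
  moreover have "\<delta> 0 = p" "\<delta> 1 = r" using l g g' by (simp_all add: \<delta>_def)
  ultimately show ?thesis using piece R g(1) g'(1) unfolding reachable_def by auto
qed

lemma reachable_line:
  assumes c: "c \<in> atlas M" and L: "L > 0" and seg: "closed_segment x y \<subseteq> codom c"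
    and speed: "\<And>z. z \<in> closed_segment x y \<Longrightarrow> (y - x) \<bullet> (gram M c z *v (y - x)) \<le> L\<^sup>2"
  shows "reachable L (param c x) (param c y)"
proof -
  note cf = chart_facts[OF c]
  define l where "l s = x + s *\<^sub>R (y - x)" for s :: real
  define \<gamma> where "\<gamma> s = param c (l s)" for s
  have lseg: "l s \<in> closed_segment x y" if "s \<in> {0..1}" for s
    using that unfolding l_def closed_segment_def
    by (auto intro!: exI[of _ s] simp: algebra_simps)
  then have lc: "l s \<in> codom c" if "s \<in> {0..1}" for s using seg that by blast
  have contl: "continuous_on X l" for X unfolding l_def by (intro continuous_intros)
  have contg: "continuous_on {0..1} \<gamma>"
    unfolding \<gamma>_def by (rule continuous_on_compose2[OF cf(8) contl]) (use lc in auto)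
  have lder: "(l has_vector_derivative (y - x)) (at s)" for s
    unfolding l_def by (auto intro!: derivative_eq_intros simp: has_vector_derivative_def)
  have iso: "isCont \<gamma> s" if "s \<in> {0<..<1}" for s
    using continuous_on_interior[OF contg, of s] that by (simp add: interior_atLeastAtMost_real)
  have piece: "C1_piece \<gamma> L ({0<..<1} - {})"
    unfolding C1_piece_def
  proof (intro conjI ballI)
    show "continuous_on ({0<..<1} - {}) \<gamma>" using contg by (rule continuous_on_subset) auto
    fix d assume d: "d \<in> atlas M"
    let ?S = "coord d \<circ> param c" and ?D = "coord c ` (cdom c \<inter> cdom d)"
    have S: "C1_on ?D ?S"
      using smooth_map_id c d unfolding smooth_map_def
      by (intro smooth_on_imp_C1_on) (simp add: o_def id_def)
    have ld: "l s \<in> ?D" if "s \<in> {s \<in> {0<..<1} - {}. \<gamma> s \<in> cdom d}" for s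
    proof -
      have "l s \<in> codom c" "param c (l s) \<in> cdom d" using that lc[of s] by (auto simp: \<gamma>_def)
      then show ?thesis using cf(4,6) by (intro image_eqI[of _ _ "param c (l s)"]) auto
    qed
    show "(coord d \<circ> \<gamma>) C1_differentiable_on {s \<in> {0<..<1} - {}. \<gamma> s \<in> cdom d}"
      unfolding C1_differentiable_on_def
    proof (intro exI[of _ "\<lambda>s. frechet_derivative ?S (at (l s)) (y - x)"] conjI ballI)
      fix s assume s: "s \<in> {s \<in> {0<..<1} - {}. \<gamma> s \<in> cdom d}"
      have Sd: "(?S has_derivative frechet_derivative ?S (at (l s))) (at (l s))"
        by (rule C1_on_has_derivative[OF S ld[OF s]])
      have "((\<lambda>t. ?S (l t)) has_derivative (\<lambda>h. frechet_derivative ?S (at (l s)) (h *\<^sub>R (y - x)))) (at s)"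
        by (rule has_derivative_compose[OF lder[unfolded has_vector_derivative_def] Sd])
      moreover have "frechet_derivative ?S (at (l s)) (h *\<^sub>R (y - x)) = h *\<^sub>R frechet_derivative ?S (at (l s)) (y - x)" for h
        using linear_scale[OF has_derivative_linear[OF Sd]] .
      moreover have "(\<lambda>t. ?S (l t)) = coord d \<circ> \<gamma>" by (auto simp: \<gamma>_def)
      ultimately show "((coord d \<circ> \<gamma>) has_vector_derivative frechet_derivative ?S (at (l s)) (y - x)) (at s)"
        by (simp add: has_vector_derivative_def)
    next
      show "continuous_on {s \<in> {0<..<1} - {}. \<gamma> s \<in> cdom d} (\<lambda>s. frechet_derivative ?S (at (l s)) (y - x))"
        by (rule continuous_on_compose2[OF C1_on_continuous_deriv[OF S] contl]) (use ld in auto)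
    qed
  next
    fix s :: real assume "s \<in> {0<..<1} - {}"
    then have s: "s \<in> {0<..<1}" "s \<in> {0..1}" by auto
    have gs: "\<gamma> s \<in> cdom c" "coord c (\<gamma> s) = l s" using lc[OF s(2)] cf by (auto simp: \<gamma>_def)
    have "((coord c \<circ> \<gamma>) has_vector_derivative (y - x)) (at s)"
      by (rule has_vector_derivative_transform_within_open[OF lder, of "{0<..<1}"])
        (use s lc cf(4) in \<open>auto simp: \<gamma>_def\<close>)
    then have "curve_speed M \<gamma> s = sqrt ((y - x) \<bullet> (gram M c (l s) *v (y - x)))"
      using curve_speed_chart[OF c gs(1) iso[OF s(1)]] gs(2) by simp
    also have "\<dots> \<le> sqrt (L\<^sup>2)" using speed[OF lseg[OF s(2)]] by (rule real_sqrt_le_mono)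
    finally show "curve_speed M \<gamma> s \<le> L" using L by simp
  qed auto
  have "\<gamma> 0 = param c x" "\<gamma> 1 = param c y" by (simp_all add: \<gamma>_def l_def)
  then show ?thesis using L contg piece unfolding reachable_def by blast
qed

lemma gram_bound:
  assumes "c \<in> atlas M" "compact K" "K \<subseteq> codom c"
  shows "\<exists>C>0. \<forall>z\<in>K. \<forall>v. v \<bullet> (gram M c z *v v) \<le> C\<^sup>2 * (norm v)\<^sup>2"
proof -
  have bl: "bilinear (\<lambda>(A::real^'n^'n) v. A *v v)"
    unfolding bilinear_def
    by (auto intro!: linearI simp: matrix_vector_mult_add_rdistrib matrix_vector_right_distrib
        matrix_vector_mult_scaleR scaleR_matrix_vector_assoc)
  then obtain B where B: "B > 0" "\<And>(A::real^'n^'n) v. norm (A *v v) \<le> B * norm A * norm v"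
    using bilinear_bounded_pos by blast
  have "bounded (gram M c ` K)"
    using compact_continuous_image[OF continuous_on_subset[OF C1_on_continuous_on[OF gram_C1[OF assms(1)]] assms(3)] assms(2)]
      compact_imp_bounded by blast
  then obtain b where b: "b > 0" "\<And>z. z \<in> K \<Longrightarrow> norm (gram M c z) \<le> b"
    unfolding bounded_pos by auto
  show ?thesis
  proof (intro exI[of _ "sqrt (B * b)"] conjI ballI allI)
    fix z v assume z: "z \<in> K"
    have "v \<bullet> (gram M c z *v v) \<le> norm v * norm (gram M c z *v v)"
      by (rule norm_cauchy_schwarz)
    also have "\<dots> \<le> norm v * (B * norm (gram M c z) * norm v)" by (intro mult_left_mono B(2)) auto
    also have "\<dots> \<le> norm v * (B * b * norm v)"
      using B(1) b(2)[OF z] by (intro mult_left_mono mult_right_mono) auto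
    finally show "v \<bullet> (gram M c z *v v) \<le> (sqrt (B * b))\<^sup>2 * (norm v)\<^sup>2"
      using B(1) b(1) by (simp add: power2_eq_square algebra_simps)
  qed (use B(1) b(1) in simp)
qed

lemma reachable_locally:
  assumes "\<epsilon> > 0"
  obtains N where "open N" "p \<in> N" "\<And>q. q \<in> N \<Longrightarrow> reachable \<epsilon> p q"
proof -
  obtain c where c: "c \<in> atlas M" "p \<in> cdom c" using ex_chart by blast
  note cf = chart_facts[OF c(1)]
  define x where "x = coord c p"
  have x: "x \<in> codom c" "param c x = p" using cf c by (auto simp: x_def)
  obtain r where r: "r > 0" "cball x r \<subseteq> codom c"
    using open_contains_cball[of "codom c"] cf(2) x(1) by blast
  obtain C where C: "C > 0" "\<And>z v. z \<in> cball x r \<Longrightarrow> v \<bullet> (gram M c z *v v) \<le> C\<^sup>2 * (norm v)\<^sup>2"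
    using gram_bound[OF c(1) compact_cball r(2)] by blast
  define d where "d = min r (\<epsilon> / C)"
  have d: "d > 0" "d \<le> r" "C * d \<le> \<epsilon>" using r(1) C(1) assms by (auto simp: d_def min_def field_simps)
  have sub: "ball x d \<subseteq> codom c" using d(2) r(2) by (auto simp: subset_iff)
  show ?thesis
  proof (rule that)
    show "open {q \<in> cdom c. coord c q \<in> ball x d}"
      using continuous_open_preimage[OF cf(7) cf(1), of "ball x d"] by (simp add: Int_def vimage_def)
    show "p \<in> {q \<in> cdom c. coord c q \<in> ball x d}" using c d by (simp add: x_def)
    fix q assume "q \<in> {q \<in> cdom c. coord c q \<in> ball x d}"
    then have q: "q \<in> cdom c" "coord c q \<in> ball x d" by auto
    let ?y = "coord c q"
    have seg: "closed_segment x ?y \<subseteq> cball x r"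
      using q(2) d(2) r(1) by (intro closed_segment_subset convex_cball) auto
    have "reachable \<epsilon> (param c x) (param c ?y)"
    proof (rule reachable_line[OF c(1) assms])
      show "closed_segment x ?y \<subseteq> codom c" using seg r(2) by blast
      fix z assume "z \<in> closed_segment x ?y"
      then have "(?y - x) \<bullet> (gram M c z *v (?y - x)) \<le> C\<^sup>2 * (norm (?y - x))\<^sup>2"
        using C(2) seg by blast
      also have "\<dots> = (C * norm (?y - x))\<^sup>2" by (simp add: power_mult_distrib)
      also have "\<dots> \<le> \<epsilon>\<^sup>2"
      proof (rule power_mono)
        have "C * norm (?y - x) \<le> C * d"
          using q(2) C(1) by (intro mult_left_mono) (auto simp: dist_norm norm_minus_commute)
        then show "C * norm (?y - x) \<le> \<epsilon>" using d(3) by simp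
      qed (use C(1) in auto)
      finally show "(?y - x) \<bullet> (gram M c z *v (?y - x)) \<le> \<epsilon>\<^sup>2" .
    qed
    then show "reachable \<epsilon> p q" using x(2) cf(3)[OF q(1)] by simp
  qed
qed

lemma reachable_refl:
  assumes "\<epsilon> > 0"
  shows "reachable \<epsilon> p p"
proof -
  obtain N where "p \<in> N" "\<And>q. q \<in> N \<Longrightarrow> reachable \<epsilon> p q"
    using reachable_locally[OF assms, of p] by blast
  then show ?thesis by blast
qed

text \<open>The points that are reachable from \<open>p\<close> form an open set, and so do the others.\<close>

lemma reachable_connected:
  assumes "connected (UNIV :: 'm set)"
  obtains L where "reachable L p q"
proof -
  define R where "R = {q. \<exists>L. reachable L p q}"
  have "open R"
  proof (rule topological_space_class.openI)
    fix q assume "q \<in> R"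
    then obtain L where L: "reachable L p q" by (auto simp: R_def)
    obtain N where N: "open N" "q \<in> N" "\<And>r. r \<in> N \<Longrightarrow> reachable 1 q r"
      by (rule reachable_locally[of 1]) auto
    have "N \<subseteq> R" unfolding R_def using reachable_trans[OF L N(3)] by blast
    then show "\<exists>T. open T \<and> q \<in> T \<and> T \<subseteq> R" using N by blast
  qed
  moreover have "open (- R)"
  proof (rule topological_space_class.openI)
    fix q assume q: "q \<in> - R"
    obtain N where N: "open N" "q \<in> N" "\<And>r. r \<in> N \<Longrightarrow> reachable 1 q r"
      by (rule reachable_locally[of 1]) auto
    have "N \<subseteq> - R"
    proof (intro subsetI ComplI)
      fix r assume r: "r \<in> N" "r \<in> R"
      then obtain L where "reachable L p r" unfolding R_def by blast
      from reachable_trans[OF this reachable_sym[OF N(3)[OF r(1)]]]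
      show False using q unfolding R_def by blast
    qed
    then show "\<exists>T. open T \<and> q \<in> T \<and> T \<subseteq> - R" using N by blast
  qed
  moreover have "p \<in> R"
  proof -
    obtain N where "p \<in> N" "\<And>r. r \<in> N \<Longrightarrow> reachable 1 p r"
      by (rule reachable_locally[of 1]) auto
    then show ?thesis unfolding R_def by blast
  qed
  ultimately have "R = UNIV"
    using connectedD[OF assms, of R "- R"] by auto
  then show ?thesis using that unfolding R_def by blast
qed

lemma AE_not_in_finite: "finite S \<Longrightarrow> AE s in (lborel :: real measure). s \<notin> S"
  by (intro AE_not_in finite_imp_null_set_lborel)

lemma reachable_curve:
  assumes "reachable L p q"
  obtains \<gamma> where "piecewise_C1_curve M \<gamma>" "\<gamma> 0 = p" "\<gamma> 1 = q" "curve_length M \<gamma> \<le> ennreal L"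
proof -
  obtain \<gamma> S where g: "L > 0" "finite S" "continuous_on {0..1} \<gamma>" "C1_piece \<gamma> L ({0<..<1} - S)"
    "\<gamma> 0 = p" "\<gamma> 1 = q"
    using assms by (auto simp: reachable_def)
  have "curve_length M \<gamma> \<le> (\<integral>\<^sup>+s. ennreal L * indicator {0..1::real} s \<partial>lborel)"
    unfolding curve_length_def
  proof (rule nn_integral_mono_AE)
    have "AE s in lborel. s \<notin> insert 0 (insert 1 S)"
      by (rule AE_not_in_finite) (use g(2) in simp)
    then show "AE s in lborel. ennreal (curve_speed M \<gamma> s) * indicator {0..1} s \<le> ennreal L * indicator {0..1} s"
    proof eventually_elim
      case (elim s)
      show ?case
      proof (cases "s \<in> {0..1}")
        case True
        then have "curve_speed M \<gamma> s \<le> L" using elim g(4) by (auto simp: C1_piece_def)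
        then show ?thesis using True by (simp add: ennreal_leI)
      qed simp
    qed
  qed
  also have "\<dots> = ennreal L" by (subst nn_integral_cmult_indicator) auto
  finally have "curve_length M \<gamma> \<le> ennreal L" .
  moreover have "piecewise_C1_curve M \<gamma>"
    using g unfolding piecewise_C1_curve_def C1_piece_def by blast
  ultimately show ?thesis using that g by blast
qed

lemma rdist_le:
  assumes "reachable L p q"
  shows "rdist M p q \<le> L"
proof -
  obtain \<gamma> where g: "piecewise_C1_curve M \<gamma>" "\<gamma> 0 = p" "\<gamma> 1 = q" "curve_length M \<gamma> \<le> ennreal L"
    by (rule reachable_curve[OF assms])
  have "(INF \<gamma>\<in>{\<gamma>. piecewise_C1_curve M \<gamma> \<and> \<gamma> 0 = p \<and> \<gamma> 1 = q}. curve_length M \<gamma>) \<le> ennreal L"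
    by (rule INF_lower2[of \<gamma>]) (use g in auto)
  then have "rdist M p q \<le> enn2real (ennreal L)"
    unfolding rdist_def by (intro enn2real_mono) auto
  then show ?thesis using reachable_pos[OF assms] by simp
qed

text \<open>Connectedness enters because \<^const>\<open>rdist\<close> would be \<open>0\<close> if no curve of finite length joined
  the points.\<close>

lemma rdist_ge:
  assumes "connected (UNIV :: 'm set)"
    and "\<And>\<gamma>. piecewise_C1_curve M \<gamma> \<Longrightarrow> \<gamma> 0 = p \<Longrightarrow> \<gamma> 1 = q \<Longrightarrow> ennreal l \<le> curve_length M \<gamma>"
  shows "l \<le> rdist M p q"
proof (cases "l \<le> 0")
  case False
  let ?I = "INF \<gamma>\<in>{\<gamma>. piecewise_C1_curve M \<gamma> \<and> \<gamma> 0 = p \<and> \<gamma> 1 = q}. curve_length M \<gamma>"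
  obtain L where "reachable L p q" by (rule reachable_connected[OF assms(1)])
  then obtain \<gamma> where g: "piecewise_C1_curve M \<gamma>" "\<gamma> 0 = p" "\<gamma> 1 = q" "curve_length M \<gamma> \<le> ennreal L"
    by (rule reachable_curve)
  have "?I \<le> ennreal L" by (rule INF_lower2[of \<gamma>]) (use g in auto)
  then have fin: "?I < \<infinity>" by (rule le_less_trans) simp
  have "ennreal l \<le> ?I" by (rule INF_greatest) (use assms(2) in auto)
  then have "enn2real (ennreal l) \<le> enn2real ?I" using fin by (intro enn2real_mono) auto
  then show ?thesis using False by (simp add: rdist_def)
next
  case True
  have "0 \<le> rdist M p q" by (simp add: rdist_def)
  then show ?thesis using True by simp
qed

text \<open>The Cauchy-Schwarz inequality for the differential of \<open>f\<close> and the velocity of the curve.\<close>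

lemma curve_derivative:
  assumes f: "C1_fun M f" and c: "c \<in> atlas M" "\<gamma> s \<in> cdom c" and cont: "isCont \<gamma> s"
    and v: "((coord c \<circ> \<gamma>) has_vector_derivative v) (at s)"
  obtains D where "((\<lambda>s. f (\<gamma> s)) has_real_derivative D) (at s)"
    "\<bar>D\<bar> \<le> sqrt (grad_prod M f f (\<gamma> s)) * curve_speed M \<gamma> s"
proof -
  note cf = chart_facts[OF c(1)]
  let ?x = "coord c (\<gamma> s)"
  have x: "?x \<in> codom c" using cf c by blast
  have fd: "((f \<circ> param c) has_derivative (\<lambda>w. chart_diff c f ?x \<bullet> w)) (at ?x)"
    by (rule C1_fun_has_derivative[OF f c(1) x])
  have "((\<lambda>t. (f \<circ> param c) ((coord c \<circ> \<gamma>) t)) has_derivative (\<lambda>h. chart_diff c f ?x \<bullet> (h *\<^sub>R v))) (at s)"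
    by (rule has_derivative_compose[OF v[unfolded has_vector_derivative_def]])
      (unfold comp_apply[of "coord c"], rule fd)
  then have 1: "((\<lambda>t. (f \<circ> param c) ((coord c \<circ> \<gamma>) t)) has_real_derivative chart_diff c f ?x \<bullet> v) (at s)"
    by (simp add: has_field_derivative_def mult.commute[of _ "_ \<bullet> _"] mult_commute_abs)
  obtain N where N: "open N" "s \<in> N" "\<And>t. t \<in> N \<Longrightarrow> \<gamma> t \<in> cdom c"
    using continuous_at_open[THEN iffD1, OF cont, rule_format, of "cdom c"] cf(1) c(2) by blast
  have "((\<lambda>s. f (\<gamma> s)) has_real_derivative chart_diff c f ?x \<bullet> v) (at s)"
    by (rule has_field_derivative_transform_within_open[OF 1 N(1,2)]) (simp add: N(3) cf(3))
  moreover have "\<bar>chart_diff c f ?x \<bullet> v\<bar> \<le> sqrt (grad_prod M f f (\<gamma> s)) * curve_speed M \<gamma> s"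
  proof -
    have "(chart_diff c f ?x \<bullet> v)\<^sup>2 \<le> grad_prod M f f (\<gamma> s) * (v \<bullet> (gram M c ?x *v v))"
      using positive_definite.Cauchy_Schwarz[OF gram_pd[OF c(1) x], of "chart_diff c f ?x" v]
        grad_prod_eq[OF f f c] by (simp add: grad_prod_in_def grad_in_alt)
    then have "sqrt ((chart_diff c f ?x \<bullet> v)\<^sup>2) \<le> sqrt (grad_prod M f f (\<gamma> s) * (v \<bullet> (gram M c ?x *v v)))"
      by (rule real_sqrt_le_mono)
    then show ?thesis
      using curve_speed_chart[OF c cont v] by (simp add: real_sqrt_mult)
  qed
  ultimately show ?thesis using that by blast
qed

end

section \<open>Gronwall's inequality\<close>

text \<open>The function \<open>exp (- K t) E(t)\<close> is nonincreasing.\<close>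

lemma Gronwall_zero_forward:
  fixes E :: "real \<Rightarrow> real"
  assumes "u \<le> v" and der: "\<And>t. u \<le> t \<Longrightarrow> t \<le> v \<Longrightarrow> (E has_real_derivative E' t) (at t)"
    and nn: "\<And>t. u \<le> t \<Longrightarrow> t \<le> v \<Longrightarrow> 0 \<le> E t"
    and bound: "\<And>t. u \<le> t \<Longrightarrow> t \<le> v \<Longrightarrow> \<bar>E' t\<bar> \<le> K * E t"
    and "E u = 0"
  shows "E v = 0"
proof -
  have "exp (- K * v) * E v \<le> exp (- K * u) * E u"
  proof (rule DERIV_nonpos_imp_nonincreasing[OF assms(1)])
    fix t assume t: "u \<le> t" "t \<le> v"
    have "((\<lambda>t. exp (- K * t) * E t) has_real_derivative exp (- K * t) * (E' t - K * E t)) (at t)"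
      by (rule derivative_eq_intros der t refl)+ (simp add: algebra_simps)
    moreover have "E' t \<le> K * E t" using bound[OF t] by linarith
    then have "exp (- K * t) * (E' t - K * E t) \<le> 0" by (simp add: mult_nonneg_nonpos)
    ultimately show "\<exists>y. ((\<lambda>t. exp (- K * t) * E t) has_real_derivative y) (at t) \<and> y \<le> 0" by blast
  qed
  then have "exp (- K * v) * E v \<le> 0" using assms(5) by simp
  then have "E v \<le> 0" by (simp add: mult_le_0_iff)
  then show ?thesis using nn[of v] assms(1) by simp
qed

lemma Gronwall_zero:
  fixes E :: "real \<Rightarrow> real"
  assumes der: "\<And>t. t \<in> closed_segment u v \<Longrightarrow> (E has_real_derivative E' t) (at t)"
    and nn: "\<And>t. t \<in> closed_segment u v \<Longrightarrow> 0 \<le> E t"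
    and bound: "\<And>t. t \<in> closed_segment u v \<Longrightarrow> \<bar>E' t\<bar> \<le> K * E t"
    and "E u = 0"
  shows "E v = 0"
proof (cases "u \<le> v")
  case True
  then show ?thesis
    using Gronwall_zero_forward[of u v E E' K] assms by (simp add: closed_segment_eq_real_ivl)
next
  case False
  have "E (- (- v)) = 0"
  proof (rule Gronwall_zero_forward[of "- u" "- v" "\<lambda>t. E (- t)" "\<lambda>t. - E' (- t)" K])
    fix t assume t: "- u \<le> t" "t \<le> - v"
    then have s: "- t \<in> closed_segment u v" using False by (simp add: closed_segment_eq_real_ivl)
    have "((\<lambda>t. E (- t)) has_real_derivative E' (- t) * - 1) (at t)"
      by (rule DERIV_chain2[where f=E and g=uminus, OF der[OF s]]) (auto intro!: derivative_eq_intros)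
    then show "((\<lambda>t. E (- t)) has_real_derivative - E' (- t)) (at t)" by simp
    show "0 \<le> E (- t)" "\<bar>- E' (- t)\<bar> \<le> K * E (- t)" using nn[OF s] bound[OF s] by simp_all
  qed (use False assms(4) in auto)
  then show ?thesis by simp
qed

lemma smooth_on_real_derivative:
  fixes f :: "real \<Rightarrow> real"
  assumes "smooth_on U f" "t \<in> U"
  shows "(f has_real_derivative frechet_derivative f (at t) 1) (at t)"
proof -
  have D: "(f has_derivative frechet_derivative f (at t)) (at t)"
    by (rule C1_on_has_derivative[OF smooth_on_imp_C1_on[OF assms(1)] assms(2)])
  define d where "d = frechet_derivative f (at t) 1"
  have "frechet_derivative f (at t) = (*) d"
  proof
    fix h :: real
    have "frechet_derivative f (at t) (h *\<^sub>R 1) = h *\<^sub>R frechet_derivative f (at t) 1"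
      by (rule linear_scale[OF has_derivative_linear[OF D]])
    then show "frechet_derivative f (at t) h = d * h"
      unfolding d_def[symmetric] by (simp add: mult.commute)
  qed
  then show ?thesis
    unfolding has_field_derivative_def d_def[symmetric] using D by simp
qed

section \<open>The distance from the focal set\<close>

locale isoparametric_mfd = compact_riemannian M vol
  for M :: "('m::{t2_space,second_countable_topology}, 'n::finite) riemannian" and vol +
  fixes F :: "'m \<Rightarrow> real" and a b :: real and A B :: "real \<Rightarrow> real" and U :: "real set"
  assumes connected: "connected (UNIV :: 'm set)"
    and F_smooth: "smooth_function M F" and ab: "a < b" and range_F: "range F = {a..b}"
    and U: "open U" "{a..b} \<subseteq> U" and A_smooth: "smooth_on U A" and B_smooth: "smooth_on U B"
    and grad_F: "grad_norm_sq_is M F (A \<circ> F)" and lap_F: "laplacian_is M F (B \<circ> F)"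
begin

lemma F_C1: "C1_fun M F" using F_smooth by (rule smooth_function_imp_C1_fun)

lemma F_cont: "continuous_on UNIV F" using C1_fun_continuous[OF F_C1] .

lemma F_bounds: "a \<le> F p" "F p \<le> b"
  using range_F by (metis atLeastAtMost_iff rangeI)+

lemma ex_level: "a \<le> t \<Longrightarrow> t \<le> b \<Longrightarrow> \<exists>p. F p = t"
  using range_F by (metis atLeastAtMost_iff imageE)

lemma open_F_less: "open {p. F p < t}" and open_F_greater: "open {p. t < F p}"
  using F_cont by (auto intro: open_Collect_less continuous_intros)

lemma grad_prod_F: "grad_prod M F F p = A (F p)"
proof -
  obtain c x where c: "c \<in> atlas M" "x \<in> codom c" and p: "p = param c x"
    using ex_chart_coord by metis
  have "grad_in M c F x \<bullet> (gram M c x *v grad_in M c F x) = A (F p)"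
    using grad_F c p unfolding grad_norm_sq_is_def by simp
  moreover have "gram M c x *v grad_in M c F x = chart_diff c F x"
    by (simp add: grad_in_alt positive_definite.mult_inv[OF gram_pd[OF c]])
  ultimately show ?thesis
    by (simp add: p grad_prod_param[OF F_C1 F_C1 c] grad_prod_in_def inner_commute)
qed

lemma A_nonneg:
  assumes "a \<le> t" "t \<le> b"
  shows "0 \<le> A t"
proof -
  obtain p where p: "F p = t" using ex_level[OF assms] by blast
  obtain c where c: "c \<in> atlas M" "p \<in> cdom c" using ex_chart by blast
  have x: "coord c p \<in> codom c" using chart_facts c by blast
  have "grad_prod M F F p = grad_in M c F (coord c p) \<bullet> (gram M c (coord c p) *v grad_in M c F (coord c p))"
    unfolding grad_prod_eq[OF F_C1 F_C1 c] grad_prod_in_def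
    by (simp add: grad_in_alt positive_definite.mult_inv[OF gram_pd[OF c(1) x]] inner_commute)
  also have "\<dots> \<ge> 0" by (rule positive_definite.nonneg[OF gram_pd[OF c(1) x]])
  finally show ?thesis using grad_prod_F p by simp
qed

lemma A_deriv: "t \<in> U \<Longrightarrow> (A has_real_derivative frechet_derivative A (at t) 1) (at t)"
  by (rule smooth_on_real_derivative[OF A_smooth])

lemma A_cont: "continuous_on U A" and B_cont: "continuous_on U B"
  using C1_on_continuous_on smooth_on_imp_C1_on A_smooth B_smooth by blast+

text \<open>At an interior zero the nonnegative function \<^term>\<open>A\<close> would vanish to second order,
  and then \<^term>\<open>F\<close> could not leave that level.\<close>

lemma A_pos:
  assumes t0: "a < t0" "t0 < b"
  shows "0 < A t0"
proof (rule ccontr)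
  assume "\<not> 0 < A t0"
  then have A0: "A t0 = 0" using A_nonneg[of t0] t0 by simp
  define A' where "A' t = frechet_derivative A (at t) 1" for t
  define A'' where "A'' t = frechet_derivative A' (at t) 1" for t
  have dA: "(A has_real_derivative A' t) (at t)" if "t \<in> {a..b}" for t
    using A_deriv that U(2) unfolding A'_def by blast
  have sA': "smooth_on U A'" unfolding A'_def by (rule smooth_on_frechet_derivative[OF A_smooth])
  have dA': "(A' has_real_derivative A'' t) (at t)" if "t \<in> {a..b}" for t
    unfolding A''_def by (rule smooth_on_real_derivative[OF sA']) (use that U(2) in blast)
  have "continuous_on {a..b} A''"
    unfolding A''_def
    using C1_on_continuous_deriv[OF smooth_on_imp_C1_on[OF sA']] U(2) continuous_on_subset by blast
  then have "bounded (A'' ` {a..b})"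
    using compact_continuous_image compact_imp_bounded compact_Icc by blast
  then obtain K where K: "K > 0" "\<And>t. t \<in> {a..b} \<Longrightarrow> \<bar>A'' t\<bar> \<le> K"
    unfolding bounded_pos by auto
  have "A' t0 = 0"
  proof (rule DERIV_local_min[OF dA, of t0 "min (t0 - a) (b - t0)"])
    show "\<forall>y. \<bar>t0 - y\<bar> < min (t0 - a) (b - t0) \<longrightarrow> A t0 \<le> A y"
      using A0 A_nonneg by (auto simp: abs_real_def split: if_splits)
  qed (use t0 in auto)
  have mvt: "\<exists>s\<in>closed_segment t0 t. f t - f t0 = (t - t0) * f' s"
    if "\<And>s. s \<in> {a..b} \<Longrightarrow> (f has_real_derivative f' s) (at s)" "t \<in> {a..b}" for f f' :: "real \<Rightarrow> real" and t
  proof -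
    consider "t0 < t" | "t < t0" | "t = t0" by linarith
    then show ?thesis
    proof cases
      case 1
      have "\<exists>s>t0. s < t \<and> f t - f t0 = (t - t0) * f' s"
        by (rule MVT2[OF 1]) (use that t0 in auto)
      then obtain s where "t0 < s" "s < t" "f t - f t0 = (t - t0) * f' s" by blast
      then show ?thesis using 1 by (intro bexI[of _ s]) (auto simp: closed_segment_eq_real_ivl)
    next
      case 2
      have "\<exists>s>t. s < t0 \<and> f t0 - f t = (t0 - t) * f' s"
        by (rule MVT2[OF 2]) (use that t0 in auto)
      then obtain s where "t < s" "s < t0" "f t0 - f t = (t0 - t) * f' s" by blast
      then show ?thesis using 2
        by (intro bexI[of _ s]) (auto simp: closed_segment_eq_real_ivl algebra_simps)
    qed auto
  qed
  have seg: "s \<in> {a..b} \<and> \<bar>s - t0\<bar> \<le> \<bar>t - t0\<bar>" if "s \<in> closed_segment t0 t" "t \<in> {a..b}" for s t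
    using that t0 by (auto simp: closed_segment_eq_real_ivl split: if_splits)
  have A'b: "\<bar>A' t\<bar> \<le> K * \<bar>t - t0\<bar>" if t: "t \<in> {a..b}" for t
  proof -
    obtain s where s: "s \<in> closed_segment t0 t" "A' t - A' t0 = (t - t0) * A'' s"
      using mvt[OF dA' t] by blast
    then have "\<bar>A' t\<bar> = \<bar>t - t0\<bar> * \<bar>A'' s\<bar>" using \<open>A' t0 = 0\<close> by (simp add: abs_mult)
    also have "\<dots> \<le> \<bar>t - t0\<bar> * K"
      using K(2) seg[OF s(1) t] by (intro mult_left_mono) auto
    finally show ?thesis by (simp add: mult.commute)
  qed
  have Ab: "A t \<le> K * (t - t0)\<^sup>2" if t: "t \<in> {a..b}" for t
  proof -
    obtain s where s: "s \<in> closed_segment t0 t" "A t - A t0 = (t - t0) * A' s"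
      using mvt[OF dA t] by blast
    then have "A t \<le> \<bar>t - t0\<bar> * \<bar>A' s\<bar>" using A0 by (simp add: abs_mult[symmetric])
    also have "\<dots> \<le> \<bar>t - t0\<bar> * (K * \<bar>t - t0\<bar>)"
    proof (intro mult_left_mono)
      have "\<bar>A' s\<bar> \<le> K * \<bar>s - t0\<bar>" using A'b seg[OF s(1) t] by blast
      also have "\<dots> \<le> K * \<bar>t - t0\<bar>" using K(1) seg[OF s(1) t] by (intro mult_left_mono) auto
      finally show "\<bar>A' s\<bar> \<le> K * \<bar>t - t0\<bar>" .
    qed simp
    also have "\<dots> = K * (t - t0)\<^sup>2" by (simp add: power2_eq_square abs_mult[symmetric])
    finally show ?thesis .
  qed
  let ?Z = "{p. F p = t0}"
  have "open ?Z"
  proof (rule topological_space_class.openI)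
    fix p assume p: "p \<in> ?Z"
    obtain c where c: "c \<in> atlas M" "p \<in> cdom c" using ex_chart by blast
    note cf = chart_facts[OF c(1)]
    define x where "x = coord c p"
    have x: "x \<in> codom c" "param c x = p" using cf c by (auto simp: x_def)
    obtain r where r: "r > 0" "cball x r \<subseteq> codom c"
      using open_contains_cball[of "codom c"] cf(2) x(1) by blast
    obtain C where C: "C > 0" "\<And>z v. z \<in> cball x r \<Longrightarrow> v \<bullet> (gram M c z *v v) \<le> C\<^sup>2 * (norm v)\<^sup>2"
      using gram_bound[OF c(1) compact_cball r(2)] by blast
    have const: "F (param c y) = t0" if y: "y \<in> ball x r" for y
    proof -
      define v where "v = y - x"
      define l where "l t = x + t *\<^sub>R v" for t :: real
      define f where "f t = F (param c (l t)) - t0" for t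
      have lin: "l t \<in> cball x r" if "t \<in> closed_segment 0 1" for t
      proof -
        have t: "0 \<le> t" "t \<le> 1" using that by (auto simp: closed_segment_eq_real_ivl)
        have "norm (t *\<^sub>R v) \<le> 1 * norm v" unfolding norm_scaleR using t by (intro mult_right_mono) auto
        also have "norm v \<le> r" using y by (simp add: v_def dist_norm norm_minus_commute)
        finally show ?thesis by (simp add: l_def dist_norm)
      qed
      define f' where "f' t = chart_diff c F (l t) \<bullet> v" for t
      have df: "(f has_real_derivative f' t) (at t)" if t: "t \<in> closed_segment 0 1" for t
      proof -
        have lt: "l t \<in> codom c" using lin[OF t] r(2) by blast
        show ?thesis
          using C1_fun_along_line[OF F_C1 c(1) lt[unfolded l_def]]
          unfolding f_def f'_def l_def by (auto intro!: derivative_eq_intros)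
      qed
      have fb: "\<bar>f' t\<bar> \<le> sqrt K * C * norm v * \<bar>f t\<bar>" if t: "t \<in> closed_segment 0 1" for t
      proof -
        have lt: "l t \<in> codom c" using lin[OF t] r(2) by blast
        have "(f' t)\<^sup>2 \<le> grad_prod M F F (param c (l t)) * (v \<bullet> (gram M c (l t) *v v))"
          unfolding f'_def grad_prod_param[OF F_C1 F_C1 c(1) lt] grad_prod_in_def grad_in_alt
          by (rule positive_definite.Cauchy_Schwarz[OF gram_pd[OF c(1) lt]])
        also have "\<dots> \<le> (K * (f t)\<^sup>2) * (C\<^sup>2 * (norm v)\<^sup>2)"
        proof (rule mult_mono)
          show "grad_prod M F F (param c (l t)) \<le> K * (f t)\<^sup>2"
            unfolding grad_prod_F f_def using Ab F_bounds by simp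
        qed (use C(2)[OF lin[OF t]] K(1) positive_definite.nonneg[OF gram_pd[OF c(1) lt]] in auto)
        also have "\<dots> = (sqrt K * C * norm v * \<bar>f t\<bar>)\<^sup>2"
          using K(1) by (simp add: power_mult_distrib)
        finally have "sqrt ((f' t)\<^sup>2) \<le> sqrt ((sqrt K * C * norm v * \<bar>f t\<bar>)\<^sup>2)"
          by (rule real_sqrt_le_mono)
        moreover have "0 \<le> sqrt K * C * norm v * \<bar>f t\<bar>" using K(1) C(1) by simp
        ultimately show ?thesis by simp
      qed
      have "(f 1)\<^sup>2 = 0"
      proof (rule Gronwall_zero[of 0 1 "\<lambda>t. (f t)\<^sup>2" "\<lambda>t. 2 * f t * f' t" "2 * (sqrt K * C * norm v)"])
        fix t assume t: "t \<in> closed_segment (0::real) 1"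
        show "((\<lambda>t. (f t)\<^sup>2) has_real_derivative 2 * f t * f' t) (at t)"
          using df[OF t] by (auto intro!: derivative_eq_intros)
        have "\<bar>2 * f t * f' t\<bar> = 2 * \<bar>f t\<bar> * \<bar>f' t\<bar>" by (simp add: abs_mult)
        also have "\<dots> \<le> 2 * \<bar>f t\<bar> * (sqrt K * C * norm v * \<bar>f t\<bar>)"
          using fb[OF t] by (intro mult_left_mono) auto
        also have "\<dots> = 2 * (sqrt K * C * norm v) * (f t)\<^sup>2"
          by (simp add: power2_eq_square abs_mult[symmetric])
        finally show "\<bar>2 * f t * f' t\<bar> \<le> 2 * (sqrt K * C * norm v) * (f t)\<^sup>2" .
      next
        show "(f 0)\<^sup>2 = 0" using p x by (simp add: f_def l_def)
      qed simp
      then show ?thesis by (simp add: f_def l_def v_def)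
    qed
    have "open (param c ` ball x r)"
      by (rule param_ball_open[OF c(1)]) (use r(2) ball_subset_cball in auto)
    moreover have "p \<in> param c ` ball x r" using x(2) r(1) by (intro image_eqI[of _ _ x]) auto
    ultimately show "\<exists>T. open T \<and> p \<in> T \<and> T \<subseteq> ?Z" using const by blast
  qed
  moreover have "open (- ?Z)"
  proof -
    have "- ?Z = {p. F p < t0} \<union> {p. t0 < F p}" by auto
    then show ?thesis using open_F_less open_F_greater by auto
  qed
  moreover obtain p q where "F p = t0" "F q = a" using ex_level[of t0] ex_level[of a] t0 ab by auto
  then have "p \<in> ?Z" "q \<in> - ?Z" using t0 by auto
  then have "?Z \<noteq> {}" "- ?Z \<noteq> {}" by blast+
  ultimately show False
    using connectedD[OF connected, of ?Z "- ?Z"] by auto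
qed

text \<open>The differences of this function are the distances between the levels of \<open>F\<close>.\<close>

definition G :: "real \<Rightarrow> real" where
  "G = (SOME G. \<forall>t. a < t \<longrightarrow> t < b \<longrightarrow> (G has_real_derivative 1 / sqrt (A t)) (at t))"

lemma interior_antiderivative:
  fixes f :: "real \<Rightarrow> real"
  assumes "continuous_on {a<..<b} f"
  shows "\<exists>G. \<forall>t. a < t \<longrightarrow> t < b \<longrightarrow> (G has_real_derivative f t) (at t)"
proof -
  have "\<exists>G. \<forall>t. ereal a < ereal t \<longrightarrow> ereal t < ereal b \<longrightarrow> (G has_vector_derivative f t) (at t)"
  proof (rule einterval_antiderivative)
    show "isCont f x" if "ereal a < ereal x" "ereal x < ereal b" for x
      using assms that by (simp add: continuous_on_eq_continuous_at)
  qed (use ab in simp)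
  then show ?thesis by (simp add: has_real_derivative_iff_has_vector_derivative)
qed

lemma G_deriv:
  assumes "a < t" "t < b"
  shows "(G has_real_derivative 1 / sqrt (A t)) (at t)"
proof -
  have "continuous_on {a<..<b} (\<lambda>t. 1 / sqrt (A t))"
    using A_pos U(2) by (intro continuous_intros continuous_on_subset[OF A_cont]) force+
  from someI_ex[OF interior_antiderivative[OF this]] show ?thesis
    using assms unfolding G_def by blast
qed

lemma G_less:
  assumes "a < s" "s < t" "t < b"
  shows "G s < G t"
proof (rule DERIV_pos_imp_increasing[OF assms(2)])
  fix x assume "s \<le> x" "x \<le> t"
  then have x: "a < x" "x < b" using assms by auto
  then show "\<exists>y. (G has_real_derivative y) (at x) \<and> 0 < y"
    using G_deriv[OF x] A_pos[OF x] by (intro exI[of _ "1 / sqrt (A x)"]) simp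
qed

lemma G_less_iff: "a < s \<Longrightarrow> s < b \<Longrightarrow> a < t \<Longrightarrow> t < b \<Longrightarrow> G s < G t \<longleftrightarrow> s < t"
  using G_less by (metis less_asym linorder_neqE)

lemma G_isCont: "a < t \<Longrightarrow> t < b \<Longrightarrow> isCont G t"
  using G_deriv DERIV_isCont by blast

text \<open>Along the curve, the derivative of \<open>G(F)\<close> is bounded by the speed. As \<^const>\<open>G\<close> is only
  controlled on the open interval, the estimate is made on a part of the curve that runs
  between the two levels.\<close>

lemma curve_length_ge:
  assumes g: "piecewise_C1_curve M \<gamma>" and \<alpha>\<beta>: "a < \<alpha>" "\<alpha> < \<beta>" "\<beta> < b"
    and ends: "F (\<gamma> 0) \<ge> \<beta>" "F (\<gamma> 1) \<le> \<alpha>"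
  shows "ennreal (G \<beta> - G \<alpha>) \<le> curve_length M \<gamma>"
proof -
  obtain S where S: "finite S" "continuous_on {0..1} \<gamma>"
    "\<And>c. c \<in> atlas M \<Longrightarrow> (coord c \<circ> \<gamma>) C1_differentiable_on {s \<in> {0<..<1} - S. \<gamma> s \<in> cdom c}"
    using g unfolding piecewise_C1_curve_def by blast
  define f where "f s = F (\<gamma> s)" for s
  have contf: "continuous_on {0..1} f"
    unfolding f_def using continuous_on_compose2[OF F_cont S(2)] by auto
  \<comment> \<open>the first time at the lower level, and the last time at the upper level before that\<close>
  let ?C = "{s \<in> {0..1}. f s \<le> \<alpha>}"
  have "closed ({0..1} \<inter> f -` {..\<alpha>})" by (rule continuous_closed_preimage[OF contf]) auto
  then have "compact ({0..1} \<inter> ({0..1} \<inter> f -` {..\<alpha>}))" by (rule compact_Int_closed[OF compact_Icc])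
  also have "{0..1} \<inter> ({0..1} \<inter> f -` {..\<alpha>}) = ?C" by auto
  finally have "compact ?C" .
  moreover have "?C \<noteq> {}" using ends(2) by (force simp: f_def)
  ultimately obtain s0 where s0: "s0 \<in> ?C" "\<And>s. s \<in> ?C \<Longrightarrow> s0 \<le> s"
    using compact_attains_inf[of ?C] by blast
  let ?D = "{s \<in> {0..s0}. f s \<ge> \<beta>}"
  have contf0: "continuous_on {0..s0} f" using s0(1) continuous_on_subset[OF contf] by auto
  then have "closed ({0..s0} \<inter> f -` {\<beta>..})" by (rule continuous_closed_preimage) auto
  then have "compact ({0..s0} \<inter> ({0..s0} \<inter> f -` {\<beta>..}))" by (rule compact_Int_closed[OF compact_Icc])
  also have "{0..s0} \<inter> ({0..s0} \<inter> f -` {\<beta>..}) = ?D" by auto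
  finally have "compact ?D" .
  moreover have "?D \<noteq> {}" using ends(1) s0(1) by (force simp: f_def)
  ultimately obtain s1 where s1: "s1 \<in> ?D" "\<And>s. s \<in> ?D \<Longrightarrow> s \<le> s1"
    using compact_attains_sup[of ?D] by blast
  have le: "0 \<le> s1" "s1 \<le> s0" "s0 \<le> 1" using s0 s1 by auto
  have cont10: "continuous_on {s1..s0} f" using continuous_on_subset[OF contf] le by auto
  have fs0: "f s0 = \<alpha>"
  proof -
    have "\<exists>s\<ge>s1. s \<le> s0 \<and> f s = \<alpha>"
      by (rule IVT2') (use s0 s1 \<alpha>\<beta> le cont10 in auto)
    then obtain s where "s1 \<le> s" "s \<le> s0" "f s = \<alpha>" by blast
    then show ?thesis using s0(2)[of s] le by auto
  qed
  have fs1: "f s1 = \<beta>"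
  proof -
    have "\<exists>s\<ge>s1. s \<le> s0 \<and> f s = \<beta>"
      by (rule IVT2') (use s0 s1 \<alpha>\<beta> le cont10 in auto)
    then obtain s where "s1 \<le> s" "s \<le> s0" "f s = \<beta>" by blast
    then show ?thesis using s1(2)[of s] le by auto
  qed
  have between: "\<alpha> \<le> f s \<and> f s \<le> \<beta>" if "s \<in> {s1..s0}" for s
  proof
    show "\<alpha> \<le> f s" using s0(2)[of s] fs0 that le by (cases "f s \<le> \<alpha>") auto
    show "f s \<le> \<beta>" using s1(2)[of s] fs1 that le by (cases "f s \<ge> \<beta>") auto
  qed
  define k where "k s = G (f s)" for s
  have contG: "continuous_on {\<alpha>..\<beta>} G"
    using G_isCont \<alpha>\<beta> by (intro continuous_at_imp_continuous_on) auto
  have contk: "continuous_on {s1..s0} k"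
    unfolding k_def by (rule continuous_on_compose2[OF contG cont10]) (use between in auto)
  have dk: "\<exists>D. (k has_real_derivative D) (at s) \<and> \<bar>D\<bar> \<le> curve_speed M \<gamma> s"
    if s: "s \<in> {s1<..<s0} - S" for s
  proof -
    have s01: "s \<in> {0<..<1} - S" using s le by auto
    obtain c where c: "c \<in> atlas M" "\<gamma> s \<in> cdom c" using ex_chart by blast
    have iso: "isCont \<gamma> s"
      using continuous_on_interior[OF S(2), of s] s01 by (simp add: interior_atLeastAtMost_real)
    obtain v where v: "((coord c \<circ> \<gamma>) has_vector_derivative v) (at s)"
      using S(3)[OF c(1)] s01 c(2) unfolding C1_differentiable_on_def by blast
    obtain D where D: "(f has_real_derivative D) (at s)"
      "\<bar>D\<bar> \<le> sqrt (grad_prod M F F (\<gamma> s)) * curve_speed M \<gamma> s"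
      unfolding f_def by (rule curve_derivative[OF F_C1 c iso v])
    have fs: "a < f s" "f s < b" using between[of s] s \<alpha>\<beta> by auto
    have Apos: "A (f s) > 0" using A_pos[OF fs] .
    have "(k has_real_derivative (1 / sqrt (A (f s))) * D) (at s)"
      unfolding k_def by (rule DERIV_chain2[OF G_deriv[OF fs] D(1)])
    moreover have "\<bar>(1 / sqrt (A (f s))) * D\<bar> \<le> curve_speed M \<gamma> s"
      using D(2) Apos by (simp add: grad_prod_F f_def abs_mult field_simps)
    ultimately show ?thesis by blast
  qed
  define k' where "k' s = (SOME D. (k has_real_derivative D) (at s) \<and> \<bar>D\<bar> \<le> curve_speed M \<gamma> s)" for s
  have k': "(k has_real_derivative k' s) (at s) \<and> \<bar>k' s\<bar> \<le> curve_speed M \<gamma> s"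
    if "s \<in> {s1<..<s0} - S" for s
    unfolding k'_def by (rule someI_ex[OF dk[OF that]])
  have "(k' has_integral (k s0 - k s1)) {s1..s0}"
    by (rule fundamental_theorem_of_calculus_interior_strong[OF S(1) le(2) _ contk])
      (use k' in \<open>auto simp: has_real_derivative_iff_has_vector_derivative\<close>)
  then have "ennreal \<bar>k s0 - k s1\<bar> \<le> (\<integral>\<^sup>+s. ennreal \<bar>k' s\<bar> * indicator {s1..s0} s \<partial>lborel)"
    by (rule has_integral_abs_le_nn_integral)
  also have "\<dots> \<le> curve_length M \<gamma>"
    unfolding curve_length_def
  proof (rule nn_integral_mono_AE)
    have "AE s in lborel. s \<notin> insert s0 (insert s1 S)"
      by (rule AE_not_in_finite) (use S(1) in simp)
    then show "AE s in lborel. ennreal \<bar>k' s\<bar> * indicator {s1..s0} s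
        \<le> ennreal (curve_speed M \<gamma> s) * indicator {0..1} s"
    proof eventually_elim
      case (elim s)
      show ?case
      proof (cases "s \<in> {s1..s0}")
        case True
        then have "s \<in> {s1<..<s0} - S" using elim by auto
        from k'[OF this] True le show ?thesis by (simp add: ennreal_leI)
      qed simp
    qed
  qed
  also have "\<bar>k s0 - k s1\<bar> = G \<beta> - G \<alpha>"
    using G_less[OF \<alpha>\<beta>] by (simp add: k_def fs0 fs1)
  finally show ?thesis .
qed

text \<open>A short step against the gradient direction is almost as short as the distance of the
  levels allows.\<close>

lemma descent_step:
  assumes x: "a < F p" "F p < b" and \<alpha>: "\<alpha> < F p" and \<eta>: "\<eta> > 0"
  shows "\<exists>q. \<alpha> \<le> F q \<and> a < F q \<and> F q < F p \<and> reachable ((1 + \<eta>) * (G (F p) - G (F q))) p q"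
proof -
  \<comment> \<open>along the step, speed at most \<open>1 + e\<close> and descent of \<open>G(F)\<close> at rate at least \<open>1 - e\<close>;
      the quotient of the two bounds is \<open>1 + \<eta>\<close>\<close>
  define e where "e = \<eta> / (2 + \<eta>)"
  have e: "0 < e" "e < 1" "(1 + e) = (1 + \<eta>) * (1 - e)" using \<eta> by (auto simp: e_def field_simps)
  obtain c where c: "c \<in> atlas M" "p \<in> cdom c" using ex_chart by blast
  note cf = chart_facts[OF c(1)]
  define x0 where "x0 = coord c p"
  have x0: "x0 \<in> codom c" "param c x0 = p" using cf c by (auto simp: x0_def)
  have Ap: "A (F p) > 0" using A_pos[OF x] .
  define w where "w = - (1 / sqrt (A (F p))) *\<^sub>R grad_in M c F x0"
  have gp: "chart_diff c F x0 \<bullet> grad_in M c F x0 = A (F p)"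
    using grad_prod_param[OF F_C1 F_C1 c(1) x0(1)] grad_prod_F x0 by (simp add: grad_prod_in_def)
  have dw: "chart_diff c F x0 \<bullet> w = - sqrt (A (F p))"
    using Ap gp by (simp add: w_def real_div_sqrt)
  have gw: "gram M c x0 *v w = - (1 / sqrt (A (F p))) *\<^sub>R chart_diff c F x0"
    by (simp add: w_def grad_in_alt matrix_vector_mult_scaleR
        positive_definite.mult_inv[OF gram_pd[OF c(1) x0(1)]] del: scaleR_minus_left)
  have ww: "w \<bullet> (gram M c x0 *v w) = 1"
    unfolding gw using Ap dw by (simp add: inner_commute[of w])
  define l where "l t = x0 + t *\<^sub>R w" for t :: real
  define f where "f t = F (param c (l t))" for t
  have l0: "l 0 = x0" and f0: "f 0 = F p" using x0 by (simp_all add: l_def f_def)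
  have lcont: "continuous_on X l" for X unfolding l_def by (intro continuous_intros)
  have fder: "(f has_real_derivative - sqrt (A (F p))) (at 0)"
    using C1_fun_along_line[OF F_C1 c(1), of x0 0 w] x0(1) dw by (simp add: f_def[abs_def] l_def)
  have "((\<lambda>t. G (f t)) has_real_derivative 1 / sqrt (A (F p)) * - sqrt (A (F p))) (at 0)"
    by (rule DERIV_chain2[OF _ fder]) (use G_deriv[OF x] f0 in simp)
  then have kder: "((\<lambda>t. G (f t)) has_real_derivative - 1) (at 0)" using Ap by simp
  have ev1: "\<forall>\<^sub>F t in at 0. (G (f t) - G (f 0)) / t < - (1 - e)"
  proof -
    have "((\<lambda>t. (G (f t) - G (f 0)) / t) \<longlongrightarrow> - 1) (at 0)"
      using kder by (simp add: has_field_derivative_iff)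
    then show ?thesis by (rule order_tendstoD) (use e in simp)
  qed
  have isf: "isCont f 0" using fder DERIV_isCont by blast
  have ev2: "\<forall>\<^sub>F t in at 0. max \<alpha> a < f t \<and> f t < b"
    using isf unfolding isCont_def f0
    by (intro eventually_conj order_tendstoD[where y="F p"]) (use x \<alpha> in auto)
  have "open (codom c)" by (rule cf)
  then have opl: "open (l -` codom c)" using lcont[of UNIV] by (simp add: open_vimage)
  have contq: "continuous_on (l -` codom c) (\<lambda>t. w \<bullet> (gram M c (l t) *v w))"
  proof (intro continuous_intros)
    have "continuous_on (l -` codom c) (\<lambda>t. gram M c (l t))"
      by (rule continuous_on_compose2[OF C1_on_continuous_on[OF gram_C1[OF c(1)]] lcont]) auto
    then show "continuous_on (l -` codom c) (\<lambda>t. gram M c (l t) *v w)"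
      unfolding matrix_vector_mult_def by (intro continuous_intros)
  qed
  have "isCont (\<lambda>t. w \<bullet> (gram M c (l t) *v w)) 0"
    using contq opl x0 l0 by (simp add: continuous_on_eq_continuous_at)
  then have "((\<lambda>t. w \<bullet> (gram M c (l t) *v w)) \<longlongrightarrow> 1) (at 0)"
    unfolding isCont_def l0 ww .
  then have ev3: "\<forall>\<^sub>F t in at 0. w \<bullet> (gram M c (l t) *v w) < (1 + e)\<^sup>2"
    by (rule order_tendstoD) (use e in \<open>simp add: power2_eq_square algebra_simps add_pos_pos\<close>)
  have ev4: "\<forall>\<^sub>F t in at 0. l t \<in> codom c"
    using opl x0(1) l0 eventually_nhds_in_open[of "l -` codom c" 0]
    by (simp add: eventually_at_filter eventually_mono)
  obtain d where d: "d > 0" "\<And>t. t \<noteq> 0 \<Longrightarrow> \<bar>t\<bar> < d \<Longrightarrow> (G (f t) - G (f 0)) / t < - (1 - e) \<and>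
      (max \<alpha> a < f t \<and> f t < b) \<and> w \<bullet> (gram M c (l t) *v w) < (1 + e)\<^sup>2 \<and> l t \<in> codom c"
    using eventually_conj[OF ev1 eventually_conj[OF ev2 eventually_conj[OF ev3 ev4]]]
    unfolding eventually_at by (auto simp: dist_real_def)
  define t where "t = d / 2"
  have t: "t > 0" "t < d" "t \<noteq> 0" "\<bar>t\<bar> < d" using d(1) by (auto simp: t_def)
  note D = d(2)[OF t(3,4)]
  define q where "q = param c (l t)"
  have Fq: "F q = f t" by (simp add: q_def f_def)
  have k: "t * (1 - e) \<le> G (F p) - G (F q)"
  proof -
    have "G (f t) - G (f 0) < - (1 - e) * t" using D t(1) by (simp add: divide_less_eq)
    then show ?thesis using f0 Fq by (simp add: algebra_simps)
  qed
  have "G (F q) < G (F p)" using k t(1) e(2) by (smt (verit) mult_pos_pos)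
  then have lt: "F q < F p" using G_less_iff[of "F q" "F p"] D Fq x by auto
  have "reachable (t * (1 + e)) (param c x0) (param c (l t))"
  proof (rule reachable_line[OF c(1)])
    have seg: "\<exists>s. z = l s \<and> l s \<in> codom c \<and> w \<bullet> (gram M c (l s) *v w) \<le> (1 + e)\<^sup>2"
      if "z \<in> closed_segment x0 (l t)" for z
    proof -
      obtain u where u: "0 \<le> u" "u \<le> 1" "z = (1 - u) *\<^sub>R x0 + u *\<^sub>R l t"
        using \<open>z \<in> _\<close> unfolding closed_segment_def by auto
      have z: "z = l (u * t)" unfolding u(3) l_def by (simp add: algebra_simps)
      have "\<bar>u * t\<bar> \<le> 1 * t" unfolding abs_mult using u t(1) by (intro mult_mono) auto
      then have ut: "\<bar>u * t\<bar> < d" using t(2) by simp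
      show ?thesis
      proof (cases "u * t = 0")
        case True
        have "(1 :: real) \<le> (1 + e)\<^sup>2" using e(1) by (simp add: power2_eq_square algebra_simps)
        then show ?thesis using z[unfolded True] l0 x0(1) ww by (intro exI[of _ 0]) simp
      next
        case False
        then show ?thesis using d(2)[OF False ut] z by (intro exI[of _ "u * t"]) simp
      qed
    qed
    then show "closed_segment x0 (l t) \<subseteq> codom c" by blast
    show "0 < t * (1 + e)" using t(1) e(1) by simp
    fix z assume "z \<in> closed_segment x0 (l t)"
    then obtain s where s: "z = l s" "w \<bullet> (gram M c (l s) *v w) \<le> (1 + e)\<^sup>2" using seg by blast
    have "(l t - x0) \<bullet> (gram M c z *v (l t - x0)) = t\<^sup>2 * (w \<bullet> (gram M c (l s) *v w))"
      by (simp add: l_def s(1) matrix_vector_mult_scaleR power2_eq_square)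
    also have "\<dots> \<le> t\<^sup>2 * (1 + e)\<^sup>2" using s(2) by (intro mult_left_mono) auto
    finally show "(l t - x0) \<bullet> (gram M c z *v (l t - x0)) \<le> (t * (1 + e))\<^sup>2"
      by (simp add: power_mult_distrib)
  qed
  then have "reachable (t * (1 + e)) p q" using x0(2) by (simp add: q_def)
  moreover have "t * (1 + e) \<le> (1 + \<eta>) * (G (F p) - G (F q))"
  proof -
    have "t * (1 + e) = (1 + \<eta>) * (t * (1 - e))" unfolding e(3) by simp
    also have "\<dots> \<le> (1 + \<eta>) * (G (F p) - G (F q))" using k \<eta> by (intro mult_left_mono) auto
    finally show ?thesis .
  qed
  ultimately have "reachable ((1 + \<eta>) * (G (F p) - G (F q))) p q" by (rule reachable_mono)
  then show ?thesis using D Fq lt by (intro exI[of _ q]) auto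
qed

text \<open>The points that can be reached from \<open>p\<close> at nearly the optimal cost form a compact set, so
  \<open>F\<close> attains its minimum there. If the minimum were above the level \<open>\<alpha>\<close>, one more step of
  \<open>descent_step\<close> would lead to a lower point. The slack \<open>\<delta>\<close> makes the set closed.\<close>

lemma descent:
  assumes p: "F p < b" and \<alpha>: "a < \<alpha>" "\<alpha> \<le> F p" and L: "L > G (F p) - G \<alpha>"
  shows "\<exists>q. F q = \<alpha> \<and> reachable L p q"
proof -
  define D where "D = G (F p) - G \<alpha>"
  have D: "D \<ge> 0" using G_less[of \<alpha> "F p"] p \<alpha> by (cases "\<alpha> = F p") (auto simp: D_def)
  define \<delta> where "\<delta> = (L - D) / 2"
  define \<eta> where "\<eta> = \<delta> / (D + 1)"
  have \<delta>: "\<delta> > 0" using L by (simp add: \<delta>_def D_def)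
  have \<eta>: "\<eta> > 0" using \<delta> D by (simp add: \<eta>_def)
  have "\<eta> * D \<le> \<delta>" using \<delta> D by (simp add: \<eta>_def field_simps)
  moreover have "D + \<delta> + \<delta> = L" by (simp add: \<delta>_def field_simps)
  moreover have "(1 + \<eta>) * D = D + \<eta> * D" by (simp add: distrib_right)
  ultimately have total: "(1 + \<eta>) * D + \<delta> \<le> L" by linarith
  define Q where "Q = {q. \<alpha> \<le> F q \<and> F q \<le> F p \<and> (\<forall>\<delta>>0. reachable ((1 + \<eta>) * (G (F p) - G (F q)) + \<delta>) p q)}"
  have "open (- Q)"
  proof (rule topological_space_class.openI)
    fix q assume q: "q \<in> - Q"
    show "\<exists>T. open T \<and> q \<in> T \<and> T \<subseteq> - Q"
    proof (cases "\<alpha> \<le> F q \<and> F q \<le> F p")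
      case False
      then have "q \<in> {q. F q < \<alpha>} \<union> {q. F p < F q}" by auto
      moreover have "{q. F q < \<alpha>} \<union> {q. F p < F q} \<subseteq> - Q" by (auto simp: Q_def)
      ultimately show ?thesis using open_Un[OF open_F_less open_F_greater] by blast
    next
      case True
      then obtain \<epsilon> where \<epsilon>: "\<epsilon> > 0" "\<not> reachable ((1 + \<eta>) * (G (F p) - G (F q)) + \<epsilon>) p q"
        using q by (auto simp: Q_def)
      have Fq: "a < F q" "F q < b" using True \<alpha> p by auto
      have iG: "isCont (\<lambda>q. (1 + \<eta>) * G (F q)) q"
        using F_cont G_isCont[OF Fq]
        by (intro continuous_intros isCont_o2[of q F G]) (auto simp: continuous_on_eq_continuous_at)
      obtain N1 where N1: "open N1" "q \<in> N1"
        "\<And>y. y \<in> N1 \<Longrightarrow> \<bar>(1 + \<eta>) * G (F y) - (1 + \<eta>) * G (F q)\<bar> < \<epsilon> / 3"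
      proof -
        let ?V = "ball ((1 + \<eta>) * G (F q)) (\<epsilon> / 3)"
        have "open ?V" "(1 + \<eta>) * G (F q) \<in> ?V" using \<epsilon>(1) by auto
        then obtain N where "open N" "q \<in> N" "\<forall>y\<in>N. (1 + \<eta>) * G (F y) \<in> ?V"
          using continuous_at_open[THEN iffD1, OF iG, rule_format, of ?V] by blast
        then show ?thesis using that[of N] by (simp add: dist_real_def abs_minus_commute)
      qed
      obtain N2 where N2: "open N2" "q \<in> N2" "\<And>y. y \<in> N2 \<Longrightarrow> reachable (\<epsilon> / 3) q y"
        by (rule reachable_locally[of "\<epsilon> / 3" q]) (use \<epsilon>(1) in auto)
      have "N1 \<inter> N2 \<subseteq> - Q"
      proof (intro subsetI ComplI)
        fix y assume y: "y \<in> N1 \<inter> N2" "y \<in> Q"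
        have "reachable ((1 + \<eta>) * (G (F p) - G (F y)) + \<epsilon> / 3) p y"
          using y(2) \<epsilon>(1) by (simp add: Q_def)
        from reachable_trans[OF this reachable_sym[OF N2(3)]] y(1)
        have "reachable ((1 + \<eta>) * (G (F p) - G (F y)) + \<epsilon> / 3 + \<epsilon> / 3) p q" by blast
        moreover have "(1 + \<eta>) * (G (F p) - G (F y)) + \<epsilon> / 3 + \<epsilon> / 3 \<le> (1 + \<eta>) * (G (F p) - G (F q)) + \<epsilon>"
        proof -
          have "\<bar>(1 + \<eta>) * G (F y) - (1 + \<eta>) * G (F q)\<bar> < \<epsilon> / 3" using N1(3) y(1) by blast
          then show ?thesis unfolding right_diff_distrib by linarith
        qed
        ultimately show False using reachable_mono \<epsilon>(2) by blast
      qed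
      then show ?thesis using N1 N2 by (intro exI[of _ "N1 \<inter> N2"]) auto
    qed
  qed
  then have "compact Q"
    using compact_Int_closed[OF compact, of Q] by (simp add: closed_def)
  moreover have "p \<in> Q" using \<alpha> reachable_refl by (simp add: Q_def)
  then have "Q \<noteq> {}" by blast
  ultimately obtain q where q: "q \<in> Q" "\<And>y. y \<in> Q \<Longrightarrow> F q \<le> F y"
    using continuous_attains_inf[of Q F] continuous_on_subset[OF F_cont] by blast
  have "F q = \<alpha>"
  proof (rule ccontr)
    assume "F q \<noteq> \<alpha>"
    then have Fq: "\<alpha> < F q" "a < F q" "F q < b" using q(1) \<alpha> p by (auto simp: Q_def)
    obtain y where y: "\<alpha> \<le> F y" "F y < F q" "reachable ((1 + \<eta>) * (G (F q) - G (F y))) q y"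
      using descent_step[OF Fq(2,3,1) \<eta>] by blast
    have "reachable ((1 + \<eta>) * (G (F p) - G (F y)) + d) p y" if "d > 0" for d
    proof -
      have "reachable ((1 + \<eta>) * (G (F p) - G (F q)) + d) p q" using q(1) that by (simp add: Q_def)
      from reachable_trans[OF this y(3)] show ?thesis
        by (rule reachable_mono) (simp add: algebra_simps)
    qed
    then have "y \<in> Q" using y(1,2) q(1) by (simp add: Q_def)
    then show False using q(2) y(2) by fastforce
  qed
  moreover have "reachable ((1 + \<eta>) * (G (F p) - G (F q)) + \<delta>) p q" using q(1) \<delta> by (simp add: Q_def)
  ultimately show ?thesis using reachable_mono[OF _ total] by (auto simp: D_def)
qed

text \<open>By compactness, a neighbourhood of the focal set that consists of points close to it contains
  a whole sublevel set.\<close>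

lemma near_focal:
  assumes "\<epsilon> > 0"
  shows "\<exists>\<alpha>. a < \<alpha> \<and> \<alpha> < b \<and> (\<forall>p. F p \<le> \<alpha> \<longrightarrow> (\<exists>q. F q = a \<and> reachable \<epsilon> p q))"
proof -
  have "\<forall>q. \<exists>N. open N \<and> q \<in> N \<and> (\<forall>p\<in>N. reachable \<epsilon> q p)"
  proof
    fix q
    obtain N where "open N" "q \<in> N" "\<And>p. p \<in> N \<Longrightarrow> reachable \<epsilon> q p"
      using reachable_locally[OF assms, of q] by blast
    then show "\<exists>N. open N \<and> q \<in> N \<and> (\<forall>p\<in>N. reachable \<epsilon> q p)" by blast
  qed
  then obtain N where N: "\<And>q. open (N q)" "\<And>q. q \<in> N q" "\<And>q p. p \<in> N q \<Longrightarrow> reachable \<epsilon> q p"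
    by metis
  define W where "W = (\<Union>q\<in>F -` {a}. N q)"
  have "open W" using N(1) by (auto simp: W_def)
  then have "compact (- W)"
    using compact_Int_closed[OF compact, of "- W"] by (simp add: closed_def)
  have "\<exists>\<alpha>. a < \<alpha> \<and> \<alpha> < b \<and> (\<forall>p. F p \<le> \<alpha> \<longrightarrow> p \<in> W)"
  proof (cases "- W = {}")
    case True
    then show ?thesis using ab dense by blast
  next
    case False
    then obtain y where y: "y \<in> - W" "\<And>p. p \<in> - W \<Longrightarrow> F y \<le> F p"
      using continuous_attains_inf[OF \<open>compact (- W)\<close> False] continuous_on_subset[OF F_cont] by blast
    have "F y \<noteq> a" using y(1) N(2) by (auto simp: W_def)
    then have "a < F y" using F_bounds(1)[of y] by simp
    then obtain \<alpha> where \<alpha>: "a < \<alpha>" "\<alpha> < F y" using dense by blast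
    then have "p \<in> W" if "F p \<le> \<alpha>" for p using y(2)[of p] that by fastforce
    then show ?thesis using \<alpha> F_bounds(2)[of y] by (intro exI[of _ \<alpha>]) auto
  qed
  moreover have "\<exists>q. F q = a \<and> reachable \<epsilon> p q" if "p \<in> W" for p
    using that N(3) reachable_sym unfolding W_def by blast
  ultimately show ?thesis by blast
qed

abbreviation \<rho> :: "'m \<Rightarrow> real" where "\<rho> \<equiv> rho M F a"

lemma rdist_nonneg: "0 \<le> rdist M p q" by (simp add: rdist_def)

lemma rho_le:
  assumes "F q = a" "reachable L p q"
  shows "\<rho> p \<le> L"
proof -
  have "\<rho> p \<le> rdist M p q"
    unfolding rho_def rsetdist_def
    by (rule cINF_lower2[of _ _ "(p, q)"])
      (use assms rdist_nonneg in \<open>auto intro!: bdd_belowI[of _ 0] simp: focal_plus_def\<close>)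
  then show ?thesis using rdist_le[OF assms(2)] by simp
qed

lemma rho_ge:
  assumes "a < \<alpha>" "\<alpha> < \<beta>" "\<beta> < b" "\<beta> \<le> F p"
  shows "G \<beta> - G \<alpha> \<le> \<rho> p"
  unfolding rho_def rsetdist_def
proof (rule cINF_greatest)
  show "{p} \<times> focal_plus F a \<noteq> {}"
    using ex_level[of a] ab by (auto simp: focal_plus_def)
  fix z assume "z \<in> {p} \<times> focal_plus F a"
  then obtain q where z: "z = (p, q)" "F q = a" by (auto simp: focal_plus_def)
  have "G \<beta> - G \<alpha> \<le> rdist M p q"
  proof (rule rdist_ge[OF connected])
    fix \<gamma> assume "piecewise_C1_curve M \<gamma>" "\<gamma> 0 = p" "\<gamma> 1 = q"
    then show "ennreal (G \<beta> - G \<alpha>) \<le> curve_length M \<gamma>"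
      using curve_length_ge[of \<gamma> \<alpha> \<beta>] assms z(2) by simp
  qed
  then show "G \<beta> - G \<alpha> \<le> (case z of (p, q) \<Rightarrow> rdist M p q)" using z by simp
qed

lemma reach_focal_within:
  assumes p: "a < F p" "F p < b" and \<epsilon>: "\<epsilon> > 0"
  shows "\<exists>\<alpha>0. a < \<alpha>0 \<and> (\<forall>\<alpha>. a < \<alpha> \<and> \<alpha> < \<alpha>0 \<longrightarrow> (\<exists>q. F q = a \<and> reachable (G (F p) - G \<alpha> + \<epsilon>) p q))"
proof -
  obtain \<alpha>1 where \<alpha>1: "a < \<alpha>1" "\<And>p. F p \<le> \<alpha>1 \<Longrightarrow> \<exists>q. F q = a \<and> reachable (\<epsilon> / 2) p q"
    using near_focal[of "\<epsilon> / 2"] \<epsilon> by auto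
  have "\<exists>q. F q = a \<and> reachable (G (F p) - G \<alpha> + \<epsilon>) p q" if \<alpha>: "a < \<alpha>" "\<alpha> < min \<alpha>1 (F p)" for \<alpha>
  proof -
    have le: "\<alpha> \<le> F p" using \<alpha> by simp
    obtain y where y: "F y = \<alpha>" "reachable (G (F p) - G \<alpha> + \<epsilon> / 2) p y"
      using descent[OF p(2) \<alpha>(1) le, of "G (F p) - G \<alpha> + \<epsilon> / 2"] \<epsilon> by auto
    obtain q where q: "F q = a" "reachable (\<epsilon> / 2) y q" using \<alpha>1(2)[of y] y(1) \<alpha> by auto
    show ?thesis using q(1) reachable_trans[OF y(2) q(2)] by (intro exI[of _ q]) (simp add: algebra_simps)
  qed
  then show ?thesis using \<alpha>1(1) p(1) by (intro exI[of _ "min \<alpha>1 (F p)"]) auto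
qed

lemma rho_upper_le:
  assumes p: "a < F p" "F p < b" and q: "F p \<le> F q"
  shows "\<rho> p \<le> \<rho> q"
proof (rule field_le_epsilon)
  fix \<epsilon> :: real assume \<epsilon>: "\<epsilon> > 0"
  obtain \<alpha>0 where \<alpha>0: "a < \<alpha>0" "\<And>\<alpha>. a < \<alpha> \<Longrightarrow> \<alpha> < \<alpha>0 \<Longrightarrow> \<exists>q. F q = a \<and> reachable (G (F p) - G \<alpha> + \<epsilon>) p q"
    using reach_focal_within[OF p \<epsilon>] by blast
  obtain \<alpha> where \<alpha>: "a < \<alpha>" "\<alpha> < min \<alpha>0 (F p)" using dense[of a "min \<alpha>0 (F p)"] \<alpha>0(1) p(1) by auto
  then have "\<rho> p \<le> G (F p) - G \<alpha> + \<epsilon>" using \<alpha>0(2)[of \<alpha>] rho_le by auto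
  moreover have "G (F p) - G \<alpha> \<le> \<rho> q" using rho_ge[of \<alpha> "F p" q] \<alpha> p q by auto
  ultimately show "\<rho> p \<le> \<rho> q + \<epsilon>" by simp
qed

text \<open>Both distances are compared with the way to a level \<open>\<alpha>\<close> near the focal set. The value
  \<open>G \<alpha>\<close> cancels, so that \<open>\<alpha>\<close> can tend to \<open>a\<close>.\<close>

lemma rho_diff_le:
  assumes p: "a < F p" "F p < b" and q: "a < F q" "F q < b"
  shows "\<rho> p - G (F p) \<le> \<rho> q - G (F q)"
proof (rule field_le_epsilon)
  fix \<epsilon> :: real assume \<epsilon>: "\<epsilon> > 0"
  obtain \<alpha>0 where \<alpha>0: "a < \<alpha>0" "\<And>\<alpha>. a < \<alpha> \<Longrightarrow> \<alpha> < \<alpha>0 \<Longrightarrow> \<exists>q. F q = a \<and> reachable (G (F p) - G \<alpha> + \<epsilon>) p q"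
    using reach_focal_within[OF p \<epsilon>] by blast
  obtain \<alpha> where \<alpha>: "a < \<alpha>" "\<alpha> < min \<alpha>0 (F q)" using dense[of a "min \<alpha>0 (F q)"] \<alpha>0(1) q(1) by auto
  then have "\<rho> p \<le> G (F p) - G \<alpha> + \<epsilon>" using \<alpha>0(2)[of \<alpha>] rho_le by auto
  moreover have "G (F q) - G \<alpha> \<le> \<rho> q" using rho_ge[of \<alpha> "F q" q] \<alpha> q by auto
  ultimately show "\<rho> p - G (F p) \<le> \<rho> q - G (F q) + \<epsilon>" by simp
qed

lemma rho_formula:
  obtains K where "\<And>p. a < F p \<Longrightarrow> F p < b \<Longrightarrow> \<rho> p = G (F p) + K"
proof -
  obtain m where m: "a < m" "m < b" using dense[OF ab] by blast
  obtain x where x: "F x = m" using ex_level[of m] m by auto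
  show ?thesis
  proof (rule that[of "\<rho> x - G (F x)"])
    fix p assume "a < F p" "F p < b"
    then show "\<rho> p = G (F p) + (\<rho> x - G (F x))"
      using rho_diff_le[of p x] rho_diff_le[of x p] m x by simp
  qed
qed

lemma rho_focal: "F p = a \<Longrightarrow> \<rho> p \<le> 0"
  by (rule field_le_epsilon) (use rho_le reachable_refl in auto)

text \<open>As the manifold is connected, the boundary of the set where \<open>F < b\<close> contains a point of the other focal set,
  so if all radii inside were below \<^term>\<open>t\<close>, the focal sets would be at distance at
  most \<^term>\<open>t\<close>.\<close>

lemma tube_level:
  assumes t: "0 < t" "t < focal_distance M F a b"
  obtains s where "a < s" "s < b" "tube M F a t = {p. F p < s}"
proof -
  obtain K where K: "\<And>p. a < F p \<Longrightarrow> F p < b \<Longrightarrow> \<rho> p = G (F p) + K"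
    using rho_formula by blast
  have lev: "\<exists>p. F p = \<sigma> \<and> \<rho> p = G \<sigma> + K" if "a < \<sigma>" "\<sigma> < b" for \<sigma>
    using ex_level[of \<sigma>] K that by auto
  obtain \<sigma> where \<sigma>: "a < \<sigma>" "\<sigma> < b" "G \<sigma> + K < t"
  proof -
    obtain \<sigma> where \<sigma>: "a < \<sigma>" "\<sigma> < b" "\<And>p. F p \<le> \<sigma> \<Longrightarrow> \<exists>q. F q = a \<and> reachable (t / 2) p q"
      using near_focal[of "t / 2"] t(1) by auto
    obtain p where p: "F p = \<sigma>" "\<rho> p = G \<sigma> + K" using lev \<sigma> by blast
    obtain q where "F q = a" "reachable (t / 2) p q" using \<sigma>(3)[of p] p(1) by auto
    then have "\<rho> p \<le> t / 2" by (rule rho_le)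
    then show ?thesis using that[OF \<sigma>(1,2)] p(2) t(1) by simp
  qed
  obtain \<beta> where \<beta>: "a < \<beta>" "\<beta> < b" "G \<beta> + K \<ge> t"
  proof (rule ccontr)
    assume "\<not> thesis"
    note ex = that
    have small: "G \<beta> + K < t" if "a < \<beta>" "\<beta> < b" for \<beta>
      using ex[OF that] \<open>\<not> thesis\<close> by (cases "G \<beta> + K \<ge> t") auto
    have "\<not> open (F -` {b})"
    proof
      assume o: "open (F -` {b})"
      have "F -` {b} = - {p. F p < b}" using F_bounds(2) by (auto simp: less_le)
      moreover obtain p where "F p = b" using ex_level[of b] ab by auto
      moreover obtain q where "F q = a" using ex_level[of a] ab by auto
      ultimately show False
        using connectedD[OF connected o open_F_less[of b]] ab by auto
    qed
    then have "\<exists>y\<in>F -` {b}. \<not> (\<exists>T. open T \<and> y \<in> T \<and> T \<subseteq> F -` {b})"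
      using topological_space_class.openI[of "F -` {b}"] by blast
    then obtain y where "F y = b" "\<not> (\<exists>T. open T \<and> y \<in> T \<and> T \<subseteq> F -` {b})" by blast
    then have y: "F y = b" "\<exists>q\<in>N. F q \<noteq> b" if "open N" "y \<in> N" for N
      using that by blast+
    define \<epsilon> where "\<epsilon> = (focal_distance M F a b - t) / 3"
    have \<epsilon>: "\<epsilon> > 0" using t(2) by (simp add: \<epsilon>_def)
    obtain N where N: "open N" "y \<in> N" "\<And>q. q \<in> N \<Longrightarrow> reachable \<epsilon> y q"
      using reachable_locally[OF \<epsilon>, of y] by blast
    obtain q where q: "q \<in> N" "a < F q" "F q \<noteq> b"
      using y(2)[OF open_Int[OF N(1) open_F_greater[of a]]] N(2) y(1)[OF N(1,2)] ab by auto
    have Fq: "F q < b" using q(3) F_bounds(2)[of q] by simp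
    obtain \<alpha>0 where \<alpha>0: "a < \<alpha>0" "\<And>\<alpha>. a < \<alpha> \<Longrightarrow> \<alpha> < \<alpha>0 \<Longrightarrow> \<exists>p. F p = a \<and> reachable (G (F q) - G \<alpha> + \<epsilon>) q p"
      using reach_focal_within[OF q(2) Fq \<epsilon>] by blast
    obtain \<alpha> where \<alpha>: "a < \<alpha>" "\<alpha> < min \<alpha>0 (F q)" using dense[of a "min \<alpha>0 (F q)"] \<alpha>0(1) q(2) by auto
    obtain p where p: "F p = a" "reachable (G (F q) - G \<alpha> + \<epsilon>) q p" using \<alpha>0(2)[of \<alpha>] \<alpha> by auto
    have "G (F q) - G \<alpha> \<le> \<rho> q" using rho_ge[of \<alpha> "F q" q] \<alpha> Fq by auto
    also have "\<rho> q < t" using K[OF q(2) Fq] small[OF q(2) Fq] by simp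
    finally have lt: "G (F q) - G \<alpha> < t" .
    have "reachable (\<epsilon> + (G (F q) - G \<alpha> + \<epsilon>)) p y"
      by (rule reachable_sym[OF reachable_trans[OF N(3)[OF q(1)] p(2)]])
    then have "rdist M p y \<le> \<epsilon> + (G (F q) - G \<alpha> + \<epsilon>)" by (rule rdist_le)
    moreover have "focal_distance M F a b \<le> rdist M p y"
      unfolding focal_distance_def rsetdist_def
      by (rule cINF_lower2[of _ _ "(p, y)"])
        (use p y(1)[OF N(1,2)] rdist_nonneg in \<open>auto intro!: bdd_belowI[of _ 0] simp: focal_plus_def focal_minus_def\<close>)
    ultimately show False using lt \<epsilon> by (simp add: \<epsilon>_def field_simps)
  qed
  have "\<sigma> < \<beta>" using G_less_iff[of \<sigma> \<beta>] \<sigma> \<beta> by auto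
  then have "\<exists>s\<ge>\<sigma>. s \<le> \<beta> \<and> G s = t - K"
    using \<sigma> \<beta> by (intro IVT') (auto intro!: continuous_at_imp_continuous_on G_isCont)
  then obtain s where "\<sigma> \<le> s" "s \<le> \<beta>" "G s = t - K" by blast
  then have s: "a < s" "s < b" "G s = t - K" using \<sigma> \<beta> by auto
  have "tube M F a t = {p. F p < s}"
  proof (intro set_eqI)
    fix p
    consider "F p = a" | "a < F p" "F p < b" | "F p = b" using F_bounds[of p] by linarith
    then show "p \<in> tube M F a t \<longleftrightarrow> p \<in> {p. F p < s}"
    proof cases
      case 1
      then show ?thesis using rho_focal[OF 1] t(1) s(1) by (simp add: tube_def)
    next
      case 2
      then have "\<rho> p < t \<longleftrightarrow> G (F p) < G s" using K[OF 2] s(3) by auto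
      then show ?thesis using G_less_iff[OF 2 s(1,2)] by (simp add: tube_def)
    next
      case 3
      obtain q where q: "F q = s" "\<rho> q = G s + K" using lev s by blast
      have "\<rho> q \<le> \<rho> p" by (rule rho_upper_le) (use q s 3 in auto)
      then show ?thesis using q(2) s 3 by (simp add: tube_def)
    qed
  qed
  then show ?thesis using that s by blast
qed

lemma radial_level:
  assumes "radial M F a \<phi>" "a < F p" "F p < b" "F q = F p"
  shows "\<phi> q = \<phi> p"
proof -
  obtain \<psi> where "\<phi> = \<psi> \<circ> \<rho>" using assms(1) by (auto simp: radial_def)
  moreover have "\<rho> q = \<rho> p"
    using rho_diff_le[of p q] rho_diff_le[of q p] assms(2-4) by simp
  ultimately show ?thesis by simp
qed

end

section \<open>Functions of the level\<close>

lemma DERIV_locally_Lipschitz: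
  fixes f :: "real \<Rightarrow> real"
  assumes "(f has_real_derivative D) (at s)"
  obtains K d where "K > 0" "d > 0" "\<And>t. \<bar>t - s\<bar> < d \<Longrightarrow> \<bar>f t - f s\<bar> \<le> K * \<bar>t - s\<bar>"
proof -
  have "((\<lambda>h. (f (s + h) - f s) / h) \<longlongrightarrow> D) (at 0)"
    using assms by (simp add: DERIV_def)
  then have "((\<lambda>h. \<bar>(f (s + h) - f s) / h\<bar>) \<longlongrightarrow> \<bar>D\<bar>) (at 0)" by (rule tendsto_rabs)
  then have "\<forall>\<^sub>F h in at 0. \<bar>(f (s + h) - f s) / h\<bar> < \<bar>D\<bar> + 1" by (rule order_tendstoD) simp
  then obtain d where d: "d > 0" "\<And>h. h \<noteq> 0 \<Longrightarrow> \<bar>h\<bar> < d \<Longrightarrow> \<bar>(f (s + h) - f s) / h\<bar> < \<bar>D\<bar> + 1"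
    unfolding eventually_at by (auto simp: dist_real_def)
  show ?thesis
  proof (rule that[of "\<bar>D\<bar> + 1" d])
    fix t assume t: "\<bar>t - s\<bar> < d"
    show "\<bar>f t - f s\<bar> \<le> (\<bar>D\<bar> + 1) * \<bar>t - s\<bar>"
    proof (cases "t = s")
      case False
      then have "\<bar>(f t - f s) / (t - s)\<bar> < \<bar>D\<bar> + 1" using d(2)[of "t - s"] t by simp
      then show ?thesis using False by (simp add: divide_less_eq)
    qed simp
  qed (use d in auto)
qed

context isoparametric_mfd
begin

definition level_constant :: "('m \<Rightarrow> real) \<Rightarrow> bool" where
  "level_constant f \<longleftrightarrow> (\<forall>p q. a < F p \<and> F p < b \<and> F q = F p \<longrightarrow> f q = f p)"

text \<open>For a level-constant function the choice of the point does not matter, as long as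
  the level is not extreme.\<close>

definition level_value :: "('m \<Rightarrow> real) \<Rightarrow> real \<Rightarrow> real" where
  "level_value f t = f (SOME p. F p = t)"

lemma level_value_eq:
  assumes "level_constant f" "a < F p" "F p < b"
  shows "level_value f (F p) = f p"
proof -
  have "F (SOME q. F q = F p) = F p" by (rule someI[of _ p]) simp
  then show ?thesis using assms unfolding level_constant_def level_value_def by blast
qed

text \<open>Along a line in the direction of the gradient, the level is a local parameter with
  differentiable inverse, and \<open>f\<close> is differentiable.\<close>

lemma level_value_deriv:
  assumes f: "C1_fun M f" "level_constant f" and p: "a < F p" "F p < b"
  shows "(level_value f has_real_derivative grad_prod M f F p / A (F p)) (at (F p))"
proof -
  obtain c where c: "c \<in> atlas M" "p \<in> cdom c" using ex_chart by blast
  note cf = chart_facts[OF c(1)]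
  define x0 where "x0 = coord c p"
  have x0: "x0 \<in> codom c" "param c x0 = p" using cf c by (auto simp: x0_def)
  define w where "w = grad_in M c F x0"
  define l where "l t = x0 + t *\<^sub>R w" for t :: real
  have l0: "l 0 = x0" by (simp add: l_def)
  have lcont: "continuous_on X l" for X unfolding l_def by (intro continuous_intros)
  have along: "((\<lambda>t. u (param c (l t))) has_real_derivative chart_diff c u (l t) \<bullet> w) (at t)"
    if "C1_fun M u" "l t \<in> codom c" for u t
    using C1_fun_along_line[OF that(1) c(1) that(2)[unfolded l_def]] by (simp add: l_def[abs_def])
  define k where "k t = F (param c (l t))" for t
  define k' where "k' t = chart_diff c F (l t) \<bullet> w" for t
  have kF0: "k 0 = F p" by (simp add: k_def l0 x0)
  have k'0: "k' 0 = A (F p)"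
    using grad_prod_param[OF F_C1 F_C1 c(1) x0(1)] grad_prod_F x0
    by (simp add: k'_def l0 w_def grad_prod_in_def)
  have Ap: "A (F p) > 0" by (rule A_pos[OF p])
  have opl: "open (l -` codom c)" using lcont[of UNIV] cf(2) by (simp add: open_vimage)
  have "continuous_on (l -` codom c) k'"
    unfolding k'_def
    by (intro continuous_intros continuous_on_compose2[OF chart_diff_continuous[OF F_C1 c(1)] lcont]) auto
  then have "isCont k' 0" using opl l0 x0 by (simp add: continuous_on_eq_continuous_at)
  then have "\<forall>\<^sub>F t in at 0. 0 < k' t"
    unfolding isCont_def using Ap k'0 by (intro order_tendstoD) auto
  moreover have "\<forall>\<^sub>F t in at 0. l t \<in> codom c"
    using opl x0(1) l0 eventually_nhds_in_open[of "l -` codom c" 0]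
    by (simp add: eventually_at_filter eventually_mono)
  moreover have "isCont k 0"
    using along[OF F_C1, of 0] l0 x0 DERIV_isCont unfolding k_def by blast
  then have "\<forall>\<^sub>F t in at 0. a < k t \<and> k t < b"
    unfolding isCont_def kF0 using p by (intro eventually_conj order_tendstoD) auto
  ultimately have "\<forall>\<^sub>F t in at 0. 0 < k' t \<and> l t \<in> codom c \<and> (a < k t \<and> k t < b)"
    by (simp add: eventually_conj_iff)
  then obtain d0 where d0: "d0 > 0" "\<And>t. t \<noteq> 0 \<Longrightarrow> \<bar>t\<bar> < d0 \<Longrightarrow> 0 < k' t \<and> l t \<in> codom c \<and> a < k t \<and> k t < b"
    unfolding eventually_at by (auto simp: dist_real_def)
  define d where "d = d0 / 2"
  have d: "d > 0" using d0(1) by (simp add: d_def)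
  have near: "0 < k' t \<and> l t \<in> codom c \<and> a < k t \<and> k t < b" if "\<bar>t\<bar> \<le> d" for t
    using d0(2)[of t] that d0(1) Ap k'0 l0 x0(1) kF0 p by (cases "t = 0") (auto simp: d_def)
  have kder: "(k has_real_derivative k' t) (at t)" if "\<bar>t\<bar> \<le> d" for t
    unfolding k_def k'_def using along[OF F_C1] near[OF that] by blast
  have kmono: "k u < k v" if "- d \<le> u" "u < v" "v \<le> d" for u v
  proof (rule DERIV_pos_imp_increasing[OF that(2)])
    fix t assume "u \<le> t" "t \<le> v"
    then have "\<bar>t\<bar> \<le> d" using that by auto
    then show "\<exists>y. (k has_real_derivative y) (at t) \<and> 0 < y" using kder near by blast
  qed
  define j where "j = inv_into {-d..d} k"
  have inj: "inj_on k {-d..d}"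
  proof (rule inj_onI)
    fix u v assume "u \<in> {-d..d}" "v \<in> {-d..d}" "k u = k v"
    then show "u = v" using kmono[of u v] kmono[of v u] by (cases u v rule: linorder_cases) auto
  qed
  have jk: "j (k t) = t" if "\<bar>t\<bar> \<le> d" for t
    unfolding j_def by (rule inv_into_f_f[OF inj]) (use that in auto)
  have jprop: "\<bar>j y\<bar> \<le> d \<and> k (j y) = y" if "k (- d) < y" "y < k d" for y
  proof -
    have "\<exists>t\<ge>- d. t \<le> d \<and> k t = y"
    proof (rule IVT')
      show "continuous_on {- d..d} k"
      proof (intro continuous_at_imp_continuous_on ballI)
        fix x assume "x \<in> {- d..d}"
        then have "\<bar>x\<bar> \<le> d" by auto
        from DERIV_isCont[OF kder[OF this]] show "isCont k x" .
      qed
    qed (use that d in auto)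
    then obtain t where "- d \<le> t" "t \<le> d" "k t = y" by blast
    then have "\<bar>t\<bar> \<le> d" "k t = y" by auto
    then show ?thesis using jk by auto
  qed
  have isj: "isCont j (k 0)"
  proof (rule isCont_inverse_function[where f=k and x=0, OF d])
    fix z assume "\<bar>z - 0\<bar> \<le> d"
    then have z: "\<bar>z\<bar> \<le> d" by simp
    show "j (k z) = z" by (rule jk[OF z])
    show "isCont k z" by (rule DERIV_isCont[OF kder[OF z]])
  qed
  have j0: "j (F p) = 0" using jk[of 0] kF0 d by simp
  have jd: "(j has_real_derivative inverse (A (F p))) (at (F p))"
  proof (rule DERIV_inverse_function)
    show "(k has_real_derivative A (F p)) (at (j (F p)))" using kder[of 0] d k'0 j0 by simp
    show "A (F p) \<noteq> 0" using Ap by simp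
    show "k (- d) < F p" "F p < k d" using kmono[of "- d" 0] kmono[of 0 d] d kF0 by auto
    show "k (j y) = y" if "k (- d) < y" "y < k d" for y using jprop[OF that] by blast
    show "isCont j (F p)" using isj kF0 by simp
  qed
  have fl: "((\<lambda>t. f (param c (l t))) has_real_derivative grad_prod M f F p) (at (j (F p)))"
    using along[OF f(1), of 0] l0 x0 grad_prod_param[OF f(1) F_C1 c(1) x0(1)] j0
    by (simp add: grad_prod_in_def w_def)
  have "((\<lambda>y. f (param c (l (j y)))) has_real_derivative grad_prod M f F p * inverse (A (F p))) (at (F p))"
    by (rule DERIV_chain2[OF fl jd])
  then have "(level_value f has_real_derivative grad_prod M f F p * inverse (A (F p))) (at (F p))"
  proof (rule has_field_derivative_transform_within_open[where S="{k (- d)<..<k d}"])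
    show "F p \<in> {k (- d)<..<k d}" using kmono[of "- d" 0] kmono[of 0 d] d kF0 by auto
    fix y assume "y \<in> {k (- d)<..<k d}"
    then have j: "\<bar>j y\<bar> \<le> d" "k (j y) = y" using jprop by auto
    then have Fy: "F (param c (l (j y))) = y" by (simp add: k_def)
    then show "f (param c (l (j y))) = level_value f y"
      using level_value_eq[OF f(2), of "param c (l (j y))"] near[OF j(1)] j(2) by simp
  qed auto
  then show ?thesis by (simp add: divide_inverse)
qed

lemma level_constant_grad_prod:
  assumes "C1_fun M f" "level_constant f"
  shows "level_constant (grad_prod M f F)"
  unfolding level_constant_def
proof (intro allI impI)
  fix p q assume pq: "a < F p \<and> F p < b \<and> F q = F p"
  have "grad_prod M f F p / A (F p) = grad_prod M f F q / A (F q)"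
    using DERIV_unique[OF level_value_deriv[OF assms, of p]] level_value_deriv[OF assms, of q] pq by simp
  then show "grad_prod M f F q = grad_prod M f F p" using A_pos[of "F p"] pq by simp
qed

text \<open>The gradient of \<open>g(F)\<close> is \<open>g'(F) \<nabla>F\<close>, and the divergence of a product follows.\<close>

lemma laplacian_level_function:
  assumes f: "smooth_function M f" "laplacian_is M f k"
    and g: "\<And>t. a < t \<Longrightarrow> t < b \<Longrightarrow> (g has_real_derivative g' t) (at t)"
      "\<And>p. a < F p \<Longrightarrow> F p < b \<Longrightarrow> f p = g (F p)"
    and g': "(g' has_real_derivative D) (at (F p))"
    and p: "a < F p" "F p < b"
  shows "k p = g' (F p) * B (F p) - D * A (F p)"
proof -
  have fC1: "C1_fun M f" using f(1) by (rule smooth_function_imp_C1_fun)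
  obtain c where c: "c \<in> atlas M" "p \<in> cdom c" using ex_chart by blast
  note cf = chart_facts[OF c(1)]
  define x where "x = coord c p"
  have x: "x \<in> codom c" "param c x = p" using cf c by (auto simp: x_def)
  define V where "V = coord c ` (cdom c \<inter> {p. a < F p \<and> F p < b})"
  have "{p. a < F p \<and> F p < b} = {p. a < F p} \<inter> {p. F p < b}" by auto
  then have V: "open V" "x \<in> V"
    using chart_image_open[OF chart[OF c(1)] open_Int[OF open_F_greater[of a] open_F_less[of b]]] c p
    unfolding V_def x_def by auto
  have Vy: "y \<in> codom c \<and> a < F (param c y) \<and> F (param c y) < b" if "y \<in> V" for y
    using that cf unfolding V_def by auto
  have cd: "chart_diff c f y = g' (F (param c y)) *\<^sub>R chart_diff c F y" if y: "y \<in> V" for y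
  proof (rule chart_diff_unique)
    have yc: "y \<in> codom c" using Vy[OF y] by blast
    have "((\<lambda>z. g ((F \<circ> param c) z)) has_derivative (\<lambda>v. g' (F (param c y)) * (chart_diff c F y \<bullet> v))) (at y)"
      by (rule has_derivative_compose[OF C1_fun_has_derivative[OF F_C1 c(1) yc]])
        (use g(1)[of "F (param c y)"] Vy[OF y] in \<open>simp add: has_field_derivative_def\<close>)
    then have "((f \<circ> param c) has_derivative (\<lambda>v. g' (F (param c y)) * (chart_diff c F y \<bullet> v))) (at y)"
      by (rule has_derivative_transform_within_open[OF _ V(1) y]) (use g(2) Vy in auto)
    then show "((f \<circ> param c) has_derivative (\<lambda>v. (g' (F (param c y)) *\<^sub>R chart_diff c F y) \<bullet> v)) (at y)"
      by simp
  qed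
  let ?G = "\<lambda>y. sqrt (det (gram M c y))"
  have Gpos: "?G x > 0" using det_gram_pos[OF c(1) x(1)] by simp
  have partials: "partial i (\<lambda>y. ?G y * grad_in M c f y $ i) x =
      g' (F p) * partial i (\<lambda>y. ?G y * grad_in M c F y $ i) x
      + D * chart_diff c F x $ i * (?G x * grad_in M c F x $ i)" for i
  proof -
    let ?h = "\<lambda>y. ?G y * grad_in M c F y $ i"
    have "C1_on (codom c) ?h"
      by (intro C1_on_mult sqrt_det_gram_C1 grad_in_C1 F_smooth c(1))
    then have hd: "(?h has_derivative frechet_derivative ?h (at x)) (at x)"
      by (rule C1_on_has_derivative[OF _ x(1)])
    have gd: "((\<lambda>y. g' ((F \<circ> param c) y)) has_derivative (\<lambda>v. D * (chart_diff c F x \<bullet> v))) (at x)"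
      by (rule has_derivative_compose[OF C1_fun_has_derivative[OF F_C1 c(1) x(1)]])
        (use g' x in \<open>simp add: has_field_derivative_def\<close>)
    have "((\<lambda>y. g' ((F \<circ> param c) y) * ?h y) has_derivative
      (\<lambda>v. g' ((F \<circ> param c) x) * frechet_derivative ?h (at x) v + D * (chart_diff c F x \<bullet> v) * ?h x)) (at x)"
      by (rule has_derivative_mult[OF gd hd])
    then have "((\<lambda>y. ?G y * grad_in M c f y $ i) has_derivative
      (\<lambda>v. g' ((F \<circ> param c) x) * frechet_derivative ?h (at x) v + D * (chart_diff c F x \<bullet> v) * ?h x)) (at x)"
      by (rule has_derivative_transform_within_open[OF _ V])
        (simp add: grad_in_alt cd matrix_vector_mult_scaleR)
    from fun_cong[OF frechet_derivative_at[OF this], of "axis i 1"]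
    show ?thesis by (simp add: partial_def inner_axis x)
  qed
  have "k p = - div_in M c (grad_in M c f) x" using f(2) c(1) x unfolding laplacian_is_def by auto
  also have "\<dots> = - (g' (F p) * (\<Sum>i\<in>UNIV. partial i (\<lambda>y. ?G y * grad_in M c F y $ i) x)
      + D * (?G x * (chart_diff c F x \<bullet> grad_in M c F x))) / ?G x"
  proof -
    have "(\<Sum>i\<in>UNIV. partial i (\<lambda>y. ?G y * grad_in M c f y $ i) x) =
        g' (F p) * (\<Sum>i\<in>UNIV. partial i (\<lambda>y. ?G y * grad_in M c F y $ i) x)
      + D * (?G x * (chart_diff c F x \<bullet> grad_in M c F x))"
      by (simp add: partials sum.distrib sum_distrib_left inner_vec_def mult_ac)
    then show ?thesis unfolding div_in_def by (simp only: minus_divide_left)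
  qed
  also have "\<dots> = g' (F p) * - div_in M c (grad_in M c F) x - D * grad_prod_in M c F F x"
    using Gpos unfolding div_in_def grad_prod_in_def by (simp add: field_simps)
  also have "- div_in M c (grad_in M c F) x = B (F p)"
    using lap_F c(1) x unfolding laplacian_is_def by auto
  also have "grad_prod_in M c F F x = A (F p)"
    using grad_prod_param[OF F_C1 F_C1 c(1) x(1)] grad_prod_F x by simp
  finally show ?thesis .
qed

text \<open>A radial eigenfunction solves a second order linear equation in the level, so it
  vanishes on all levels if it vanishes together with its derivative on one of them.\<close>

lemma radial_eigenfunction_Cauchy_zero:
  assumes f: "smooth_function M f" "laplacian_is M f (\<lambda>p. \<kappa> * f p)" "level_constant f"
    and s: "a < s" "s < b"
    and zero: "level_value f s = 0" "level_value (grad_prod M f F) s = 0"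
    and p: "a < F p" "F p < b"
  shows "f p = 0"
proof -
  have fC1: "C1_fun M f" using f(1) by (rule smooth_function_imp_C1_fun)
  define g where "g = level_value f"
  define \<nu> where "\<nu> = level_value (grad_prod M f F)"
  have NC1: "C1_fun M (grad_prod M f F)" by (rule grad_prod_C1_fun[OF f(1) F_smooth])
  have Nlev: "level_constant (grad_prod M f F)" by (rule level_constant_grad_prod[OF fC1 f(3)])
  define \<nu>' where "\<nu>' = (\<lambda>t. level_value (grad_prod M (grad_prod M f F) F) t / A t)"
  have dg: "(g has_real_derivative \<nu> t / A t) (at t)" if t: "a < t" "t < b" for t
  proof -
    obtain q where q: "F q = t" using ex_level[of t] t by auto
    then show ?thesis
      using level_value_deriv[OF fC1 f(3), of q] level_value_eq[OF Nlev, of q] t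
      by (simp add: g_def \<nu>_def)
  qed
  have d\<nu>: "(\<nu> has_real_derivative \<nu>' t) (at t)" if t: "a < t" "t < b" for t
  proof -
    obtain q where q: "F q = t" using ex_level[of t] t by auto
    then show ?thesis
      using level_value_deriv[OF NC1 Nlev, of q] t
        level_value_eq[OF level_constant_grad_prod[OF NC1 Nlev], of q]
      by (simp add: \<nu>_def \<nu>'_def)
  qed
  have dA: "(A has_real_derivative frechet_derivative A (at t) 1) (at t)" if "a < t" "t < b" for t
    using A_deriv[of t] subsetD[OF U(2), of t] that by simp
  define h where "h t = \<nu> t / A t" for t
  define h' where "h' t = (\<nu>' t * A t - \<nu> t * frechet_derivative A (at t) 1) / (A t * A t)" for t
  have dh: "(h has_real_derivative h' t) (at t)" if "a < t" "t < b" for t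
    unfolding h_def h'_def using DERIV_divide[OF d\<nu>[OF that] dA[OF that]] A_pos[OF that] by simp
  have ode: "h' t = (h t * B t - \<kappa> * g t) / A t" if t: "a < t" "t < b" for t
  proof -
    obtain q where q: "F q = t" using ex_level[of t] t by auto
    have "\<kappa> * f q = h (F q) * B (F q) - h' (F q) * A (F q)"
    proof (rule laplacian_level_function[OF f(1,2)])
      show "(g has_real_derivative h u) (at u)" if "a < u" "u < b" for u
        unfolding h_def by (rule dg[OF that])
      show "f r = g (F r)" if "a < F r" "F r < b" for r
        unfolding g_def by (rule level_value_eq[OF f(3) that, symmetric])
    qed (use dh q t in auto)
    moreover have "f q = g t" unfolding g_def using level_value_eq[OF f(3), of q] q t by simp
    ultimately show ?thesis using A_pos[OF t] q by (simp add: field_simps)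
  qed
  define \<sigma> where "\<sigma> = F p"
  let ?S = "closed_segment s \<sigma>"
  have S: "a < t \<and> t < b" if "t \<in> ?S" for t
    using that s p by (auto simp: \<sigma>_def closed_segment_eq_real_ivl split: if_splits)
  have SU: "?S \<subseteq> U" using S U(2) by force
  have bdd: "\<exists>K. \<forall>t\<in>?S. \<bar>u t\<bar> \<le> K" if "continuous_on ?S u" for u :: "real \<Rightarrow> real"
  proof -
    have "bounded (u ` ?S)"
      by (intro compact_imp_bounded compact_continuous_image that compact_segment)
    then show ?thesis unfolding bounded_iff by auto
  qed
  have contA: "continuous_on ?S A" and contB: "continuous_on ?S B"
    using continuous_on_subset[OF A_cont SU] continuous_on_subset[OF B_cont SU] .
  have Anz: "\<forall>t\<in>?S. A t \<noteq> 0" using A_pos S by force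
  obtain K1 where K1: "\<And>t. t \<in> ?S \<Longrightarrow> \<bar>B t / A t\<bar> \<le> K1"
    using bdd[OF continuous_on_divide[OF contB contA Anz]] by blast
  obtain K2 where K2: "\<And>t. t \<in> ?S \<Longrightarrow> \<bar>\<kappa> / A t\<bar> \<le> K2"
    using bdd[OF continuous_on_divide[OF continuous_on_const contA Anz]] by blast
  have "(g \<sigma>)\<^sup>2 + (h \<sigma>)\<^sup>2 = 0"
  proof (rule Gronwall_zero[of s \<sigma> "\<lambda>t. (g t)\<^sup>2 + (h t)\<^sup>2" "\<lambda>t. 2 * g t * h t + 2 * h t * h' t" "1 + 2 * K1 + K2"])
    fix t assume t: "t \<in> ?S"
    note S' = S[OF t]
    show "((\<lambda>t. (g t)\<^sup>2 + (h t)\<^sup>2) has_real_derivative 2 * g t * h t + 2 * h t * h' t) (at t)"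
    proof -
      have "(g has_real_derivative h t) (at t)" unfolding h_def using dg S' by blast
      then show ?thesis using dh[of t] S' by (auto intro!: derivative_eq_intros)
    qed
    have e1: "\<bar>2 * (g t * h t)\<bar> \<le> (g t)\<^sup>2 + (h t)\<^sup>2"
      using sum_squares_bound[of "\<bar>g t\<bar>" "\<bar>h t\<bar>"] by (simp add: abs_mult)
    have "2 * h t * h' t = 2 * (B t / A t) * (h t)\<^sup>2 - (\<kappa> / A t) * (2 * (g t * h t))"
      unfolding ode[OF conjunct1[OF S'] conjunct2[OF S']]
      by (simp add: power2_eq_square diff_divide_distrib right_diff_distrib mult_ac)
    then have "\<bar>2 * h t * h' t\<bar> \<le> 2 * \<bar>B t / A t\<bar> * (h t)\<^sup>2 + \<bar>\<kappa> / A t\<bar> * \<bar>2 * (g t * h t)\<bar>"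
      using abs_triangle_ineq4[of "2 * (B t / A t) * (h t)\<^sup>2" "(\<kappa> / A t) * (2 * (g t * h t))"]
      by (simp add: abs_mult)
    also have "\<dots> \<le> 2 * K1 * ((g t)\<^sup>2 + (h t)\<^sup>2) + K2 * ((g t)\<^sup>2 + (h t)\<^sup>2)"
      using K1[OF t] K2[OF t] e1 order_trans[OF abs_ge_zero K1[OF t]] order_trans[OF abs_ge_zero K2[OF t]]
      by (intro add_mono mult_mono) auto
    finally have e2: "\<bar>2 * h t * h' t\<bar> \<le> (2 * K1 + K2) * ((g t)\<^sup>2 + (h t)\<^sup>2)"
      by (simp add: algebra_simps)
    have "\<bar>2 * g t * h t + 2 * h t * h' t\<bar> \<le> \<bar>2 * (g t * h t)\<bar> + \<bar>2 * h t * h' t\<bar>"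
      using abs_triangle_ineq[of "2 * (g t * h t)" "2 * h t * h' t"] by (simp add: mult.assoc)
    also have "\<dots> \<le> ((g t)\<^sup>2 + (h t)\<^sup>2) + (2 * K1 + K2) * ((g t)\<^sup>2 + (h t)\<^sup>2)"
      using e1 e2 by (rule add_mono)
    also have "\<dots> = (1 + 2 * K1 + K2) * ((g t)\<^sup>2 + (h t)\<^sup>2)" by (simp add: algebra_simps)
    finally show "\<bar>2 * g t * h t + 2 * h t * h' t\<bar> \<le> (1 + 2 * K1 + K2) * ((g t)\<^sup>2 + (h t)\<^sup>2)" .
  qed (use zero in \<open>auto simp: g_def h_def \<nu>_def\<close>)
  then have "g \<sigma> = 0" by (simp add: sum_power2_eq_zero_iff)
  then show ?thesis using level_value_eq[OF f(3) p] by (simp add: g_def \<sigma>_def)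
qed

end

section \<open>Cutoff functions of the level\<close>

lemma ex_cutoff:
  obtains H \<theta> :: "real \<Rightarrow> real" and K where
    "\<And>t. (H has_real_derivative \<theta> t) (at t)" "continuous_on UNIV \<theta>"
    "\<And>t. t \<le> 0 \<Longrightarrow> H t = 0" "\<And>t. 1 \<le> t \<Longrightarrow> H t = 1" "\<And>t. 0 \<le> H t \<and> H t \<le> 1"
    "\<And>t. 0 < t \<Longrightarrow> t < 1 \<Longrightarrow> 0 < \<theta> t" "\<And>t. t \<le> 0 \<or> 1 \<le> t \<Longrightarrow> \<theta> t = 0" "\<And>t. 0 \<le> \<theta> t \<and> \<theta> t \<le> K"
proof -
  define \<theta>0 where "\<theta>0 t = max 0 (t * (1 - t))" for t :: real
  have c0: "continuous_on UNIV \<theta>0" unfolding \<theta>0_def by (intro continuous_intros)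
  have "\<exists>H. \<forall>t. -\<infinity> < ereal t \<longrightarrow> ereal t < \<infinity> \<longrightarrow> (H has_vector_derivative \<theta>0 t) (at t)"
    by (rule einterval_antiderivative) (use c0 in \<open>auto simp: continuous_on_eq_continuous_at\<close>)
  then obtain H0 where H0: "\<And>t. (H0 has_real_derivative \<theta>0 t) (at t)"
    by (auto simp: has_real_derivative_iff_has_vector_derivative)
  have pos: "0 < \<theta>0 t" if "0 < t" "t < 1" for t
    unfolding \<theta>0_def using that by (simp add: less_max_iff_disj)
  have nonneg: "0 \<le> \<theta>0 t" for t by (simp add: \<theta>0_def)
  have out: "\<theta>0 t = 0" if "t \<le> 0 \<or> 1 \<le> t" for t
  proof -
    have "t * (1 - t) \<le> 0" using that by (auto simp: mult_le_0_iff)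
    then show ?thesis by (simp add: \<theta>0_def)
  qed
  have le1: "\<theta>0 t \<le> 1" for t
  proof -
    have "t * (1 - t) \<le> 1"
      using zero_le_power2[of "t - 1/2"] by (simp add: power2_eq_square field_simps)
    then show ?thesis by (simp add: \<theta>0_def)
  qed
  have mono: "H0 u \<le> H0 v" if "u \<le> v" for u v
    by (rule DERIV_nonneg_imp_nondecreasing[OF that]) (use H0 nonneg in blast)
  have lt: "H0 0 < H0 1"
  proof -
    have "\<exists>z>0. z < 1 \<and> H0 1 - H0 0 = (1 - 0) * \<theta>0 z"
      by (rule MVT2) (use H0 in auto)
    then obtain z where "0 < z" "z < 1" "H0 1 - H0 0 = (1 - 0) * \<theta>0 z" by blast
    then show ?thesis using pos[of z] by simp
  qed
  have const: "H0 u = H0 v" if "u \<le> v" "\<And>t. u \<le> t \<Longrightarrow> t \<le> v \<Longrightarrow> \<theta>0 t = 0" for u v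
  proof (cases "u = v")
    case False
    then have "u < v" using that(1) by simp
    then have "\<exists>z>u. z < v \<and> H0 v - H0 u = (v - u) * \<theta>0 z"
      by (rule MVT2) (use H0 in auto)
    then obtain z where "u < z" "z < v" "H0 v - H0 u = (v - u) * \<theta>0 z" by blast
    then show ?thesis using that(2)[of z] by simp
  qed simp
  have low: "H0 0 \<le> H0 t" for t
  proof (cases "t \<le> 0")
    case True
    then show ?thesis using const[OF True] out by simp
  qed (use mono[of 0 t] in simp)
  have high: "H0 t \<le> H0 1" for t
  proof (cases "t \<le> 1")
    case False
    then have "H0 1 = H0 t" using out by (intro const) auto
    then show ?thesis by simp
  qed (use mono[of t 1] in simp)
  define C where "C = H0 1 - H0 0"
  have C: "C > 0" using lt by (simp add: C_def)
  show ?thesis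
  proof (rule that[of "\<lambda>t. (H0 t - H0 0) / C" "\<lambda>t. \<theta>0 t / C" "1 / C"])
    fix t
    show "((\<lambda>t. (H0 t - H0 0) / C) has_real_derivative \<theta>0 t / C) (at t)"
      using H0[of t] C by (auto intro!: derivative_eq_intros)
    show H0t: "(H0 t - H0 0) / C = 0" if "t \<le> 0" using const[of t 0] out that by simp
    show H1t: "(H0 t - H0 0) / C = 1" if "1 \<le> t" using const[of 1 t] out that C by (simp add: C_def)
    have "0 \<le> H0 t - H0 0" "H0 t - H0 0 \<le> C" using low[of t] high[of t] by (simp_all add: C_def)
    then show "0 \<le> (H0 t - H0 0) / C \<and> (H0 t - H0 0) / C \<le> 1" using C by simp
    show "0 < \<theta>0 t / C" if "0 < t" "t < 1" using pos that C by simp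
    show "\<theta>0 t / C = 0" if "t \<le> 0 \<or> 1 \<le> t" using out[OF that] by simp
    show "0 \<le> \<theta>0 t / C \<and> \<theta>0 t / C \<le> 1 / C"
      using nonneg[of t] le1[of t] C by (auto intro: divide_right_mono)
  next
    show "continuous_on UNIV (\<lambda>t. \<theta>0 t / C)"
      using C by (intro continuous_intros c0) auto
  qed
qed

lemma scaled_cutoff_deriv:
  assumes "\<And>t. (H has_real_derivative \<theta> t) (at t)"
  shows "((\<lambda>t. H (n * (s - t))) has_real_derivative - (n * \<theta> (n * (s - t)))) (at t)"
proof -
  have "((\<lambda>t. H (n * (s - t))) has_real_derivative \<theta> (n * (s - t)) * - n) (at t)"
    by (rule DERIV_chain2[OF assms]) (auto intro!: derivative_eq_intros)
  then show ?thesis by (simp add: mult.commute)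
qed

context isoparametric_mfd
begin

lemma integral_pos:
  fixes f :: "'m \<Rightarrow> real"
  assumes f: "continuous_on UNIV f" "\<And>p. 0 \<le> f p" and p: "0 < f p"
  shows "0 < (\<integral>x. f x \<partial>vol)"
proof -
  define V where "V = {x. f p / 2 < f x}"
  have V: "open V" "p \<in> V"
    using f(1) p unfolding V_def by (auto intro!: open_Collect_less continuous_intros)
  then have mV: "V \<in> sets vol" by (simp add: sets_vol)
  have "0 < f p / 2 * measure vol V"
  proof -
    have "V \<noteq> {}" using V(2) by blast
    from vol_open_pos[OF V(1) this] show ?thesis using p by simp
  qed
  also have "\<dots> = (\<integral>x. f p / 2 * indicator V x \<partial>vol)" using mV by simp
  also have "\<dots> \<le> (\<integral>x. f x \<partial>vol)"
  proof (rule integral_mono)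
    show "integrable vol (\<lambda>x. f p / 2 * indicator V x)"
      by (intro integrable_mult_right) (use mV in \<open>simp add: integrable_real_indicator emeasure_finite less_top[symmetric]\<close>)
    show "integrable vol f" by (rule continuous_integrable[OF f(1)])
    show "f p / 2 * indicator V x \<le> f x" for x
      using f(2)[of x] by (auto simp: V_def indicator_def)
  qed
  finally show ?thesis .
qed

lemma continuous_bounded:
  fixes f :: "'m \<Rightarrow> real"
  assumes "continuous_on UNIV f"
  obtains K where "K > 0" "\<And>p. \<bar>f p\<bar> \<le> K"
proof -
  have "bounded (f ` UNIV)"
    using compact_continuous_image[OF assms compact] compact_imp_bounded by blast
  then show ?thesis using that unfolding bounded_pos by auto
qed

lemma C1_fun_level:
  assumes "\<And>t. (q has_real_derivative q' t) (at t)" "continuous_on UNIV q'"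
  shows "C1_fun M (\<lambda>p. q (F p))"
  by (rule C1_fun_real_comp[OF F_C1, OF assms(1)]) (rule continuous_on_subset[OF assms(2)], simp)

lemma level_continuous:
  assumes "continuous_on UNIV (q :: real \<Rightarrow> real)"
  shows "continuous_on UNIV (\<lambda>p. q (F p))"
  by (rule continuous_on_compose2[OF assms F_cont]) auto

lemma grad_prod_level_mult:
  assumes q: "\<And>t. (q has_real_derivative q' t) (at t)" "continuous_on UNIV q'"
    and w: "C1_fun M w" and f: "C1_fun M f"
  shows "grad_prod M (\<lambda>p. q (F p) * w p) f p = q (F p) * grad_prod M w f p + q' (F p) * (w p * grad_prod M F f p)"
proof -
  have qF: "C1_fun M (\<lambda>p. q (F p))" by (rule C1_fun_level[OF q])
  show ?thesis
    using grad_prod_mult[OF qF w f] grad_prod_real_comp[OF F_C1 f qF q(1)] by (simp add: mult.assoc mult.left_commute)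
qed

lemma integral_level_weight:
  assumes "\<And>t. (z has_real_derivative z' t) (at t)" "continuous_on UNIV z'"
  shows "(\<integral>p. z (F p) * B (F p) \<partial>vol) = (\<integral>p. z' (F p) * A (F p) \<partial>vol)"
proof -
  have zF: "C1_fun M (\<lambda>p. z (F p))" by (rule C1_fun_level[OF assms])
  have "range F \<subseteq> U" using range_F U(2) by simp
  then have "continuous_on UNIV (\<lambda>p. B (F p))"
    using continuous_on_compose2[OF B_cont F_cont] by blast
  then have "(\<integral>p. z (F p) * (B \<circ> F) p \<partial>vol) = (\<integral>p. grad_prod M (\<lambda>p. z (F p)) F p \<partial>vol)"
    by (intro Green[OF zF F_smooth lap_F]) (simp add: o_def)
  then show ?thesis
    using grad_prod_real_comp[OF F_C1 F_C1 zF assms(1)] by (simp add: grad_prod_F)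
qed

text \<open>If \<open>Y' = (B / A) Y\<close>, then \<open>(q Y)' A - q Y B = q' Y A\<close>, so by \<open>integral_level_weight\<close> the
  integral of \<open>q'(F) Y(F) A(F)\<close> vanishes for every bump \<open>q\<close>. With a bump that rises above a
  fixed level and falls just below \<open>s\<close>, this says that the weighted flux through the shells
  just below \<open>s\<close> does not depend on their thickness; the rising part shows that it is
  positive.\<close>

lemma flux_weight:
  assumes s: "a < s" "s < b"
    and H: "\<And>t. (H has_real_derivative \<theta> t) (at t)" "continuous_on UNIV \<theta>"
    "\<And>t. t \<le> 0 \<Longrightarrow> H t = (0::real)" "\<And>t. 1 \<le> t \<Longrightarrow> H t = 1"
    "\<And>t. 0 < t \<Longrightarrow> t < 1 \<Longrightarrow> 0 < \<theta> t" "\<And>t. 0 \<le> \<theta> t"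
  obtains Y C n0 where "continuous_on UNIV Y" "\<And>t. 0 < Y t" "0 < C" "0 < n0"
    "\<And>n. n0 \<le> n \<Longrightarrow> (\<integral>p. n * \<theta> (n * (s - F p)) * (Y (F p) * A (F p)) \<partial>vol) = C"
proof -
  obtain \<alpha> where \<alpha>: "a < \<alpha>" "\<alpha> < s" using dense[OF s(1)] by blast
  \<comment> \<open>\<open>A\<close> vanishes at the extreme levels, so the level is clamped to the support of the bumps\<close>
  let ?cl = "\<lambda>t. max \<alpha> (min s t)"
  define \<beta> where "\<beta> t = B (?cl t) / A (?cl t)" for t
  have cl: "a < ?cl t \<and> ?cl t < b" for t using \<alpha> s by auto
  have c1: "continuous_on UNIV ?cl" by (intro continuous_intros)
  have "?cl t \<in> U" for t using cl[of t] U(2) by auto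
  then have clU: "range ?cl \<subseteq> U" by blast
  have Acl: "A (?cl t) \<noteq> 0" for t
    using A_pos[of "?cl t"] cl[of t] by simp
  have "continuous_on UNIV \<beta>"
    unfolding \<beta>_def
    by (intro continuous_on_divide continuous_on_compose2[OF A_cont c1 clU]
        continuous_on_compose2[OF B_cont c1 clU]) (use Acl in blast)
  then have "\<exists>I. \<forall>t. -\<infinity> < ereal t \<longrightarrow> ereal t < \<infinity> \<longrightarrow> (I has_vector_derivative \<beta> t) (at t)"
    by (intro einterval_antiderivative) (auto simp: continuous_on_eq_continuous_at)
  then obtain I where I: "\<And>t. (I has_real_derivative \<beta> t) (at t)"
    by (auto simp: has_real_derivative_iff_has_vector_derivative)
  define Y where "Y t = exp (I t)" for t
  have Yd: "(Y has_real_derivative \<beta> t * Y t) (at t)" for t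
    unfolding Y_def using I[of t] by (auto intro!: derivative_eq_intros)
  have Yc: "continuous_on UNIV Y"
    using Yd DERIV_isCont by (intro continuous_at_imp_continuous_on) blast
  have Ypos: "Y t > 0" for t by (simp add: Y_def)
  have Hc: "continuous_on UNIV H"
    using H(1) DERIV_isCont by (intro continuous_at_imp_continuous_on) blast
  have AFc: "continuous_on UNIV (\<lambda>p. A (F p))"
    using continuous_on_compose2[OF A_cont F_cont] range_F U(2) by auto
  define m where "m = 1 / (s - \<alpha>)"
  have m: "m > 0" using \<alpha> by (simp add: m_def)
  define C where "C = (\<integral>p. m * \<theta> (m * (F p - \<alpha>)) * (Y (F p) * A (F p)) \<partial>vol)"
  have \<theta>F: "continuous_on UNIV (\<lambda>p. c * \<theta> (c * (F p - d)))" "continuous_on UNIV (\<lambda>p. c * \<theta> (c * (d - F p)))" for c d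
    by (intro continuous_intros continuous_on_compose2[OF H(2)] F_cont; simp)+
  have YA: "continuous_on UNIV (\<lambda>p. Y (F p) * A (F p))"
    by (intro continuous_intros level_continuous Yc AFc)
  have Cpos: "C > 0"
  proof -
    obtain \<tau> where \<tau>: "\<alpha> < \<tau>" "\<tau> < s" using dense[OF \<alpha>(2)] by blast
    obtain p where p: "F p = \<tau>" using ex_level[of \<tau>] \<tau> \<alpha> s by auto
    have "0 < m * (\<tau> - \<alpha>)" "m * (\<tau> - \<alpha>) < 1" using \<tau> \<alpha> by (auto simp: m_def field_simps)
    then have "\<theta> (m * (\<tau> - \<alpha>)) > 0" by (rule H(5))
    moreover have "A \<tau> > 0" using A_pos \<tau> \<alpha> s by simp
    ultimately have "0 < m * \<theta> (m * (F p - \<alpha>)) * (Y (F p) * A (F p))" using m Ypos p by simp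
    then show ?thesis
      unfolding C_def
    proof (rule integral_pos[rotated 2])
      show "continuous_on UNIV (\<lambda>p. m * \<theta> (m * (F p - \<alpha>)) * (Y (F p) * A (F p)))"
        by (intro continuous_on_mult[OF \<theta>F(1) YA])
      show "0 \<le> m * \<theta> (m * (F p - \<alpha>)) * (Y (F p) * A (F p))" for p
        using m H(6) Ypos[of "F p"] A_nonneg[OF F_bounds] by (intro mult_nonneg_nonneg) (auto intro: less_imp_le)
    qed
  qed
  show ?thesis
  proof (rule that[OF Yc Ypos Cpos m])
    fix n assume n: "m \<le> n"
    then have npos: "n > 0" using m by simp
    define q where "q t = H (m * (t - \<alpha>)) + H (n * (s - t)) - 1" for t
    define q' where "q' t = m * \<theta> (m * (t - \<alpha>)) - n * \<theta> (n * (s - t))" for t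
    have q0: "q t = 0" if "t \<le> \<alpha> \<or> s \<le> t" for t
      using that
    proof
      assume t: "t \<le> \<alpha>"
      then have "1 = m * (s - \<alpha>)" using \<alpha> by (simp add: m_def)
      also have "\<dots> \<le> n * (s - t)" using n m t \<alpha> by (intro mult_mono) auto
      finally have "H (n * (s - t)) = 1" by (rule H(4))
      moreover have "H (m * (t - \<alpha>)) = 0" using t m by (intro H(3)) (simp add: mult_nonneg_nonpos)
      ultimately show ?thesis by (simp add: q_def)
    next
      assume t: "s \<le> t"
      then have "1 \<le> m * (t - \<alpha>)" using \<alpha> by (simp add: m_def field_simps)
      then have "H (m * (t - \<alpha>)) = 1" by (rule H(4))
      moreover have "H (n * (s - t)) = 0" using t npos by (intro H(3)) (simp add: mult_nonneg_nonpos)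
      ultimately show ?thesis by (simp add: q_def)
    qed
    have qd: "(q has_real_derivative q' t) (at t)" for t
    proof -
      have 1: "((\<lambda>t. H (m * (t - \<alpha>))) has_real_derivative \<theta> (m * (t - \<alpha>)) * m) (at t)"
        by (rule DERIV_chain2[OF H(1)]) (auto intro!: derivative_eq_intros)
      note 2 = scaled_cutoff_deriv[of H \<theta> n s t, OF H(1)]
      show ?thesis
        unfolding q_def q'_def using 1 2 by (auto intro!: derivative_eq_intros)
    qed
    have q'c: "continuous_on UNIV q'"
      unfolding q'_def by (intro continuous_intros continuous_on_compose2[OF H(2)]) auto
    have qc: "continuous_on UNIV q"
      using qd DERIV_isCont by (intro continuous_at_imp_continuous_on) blast
    define z' where "z' t = q' t * Y t + q t * (\<beta> t * Y t)" for t
    have zd: "((\<lambda>t. q t * Y t) has_real_derivative z' t) (at t)" for t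
      unfolding z'_def using qd[of t] Yd[of t] by (auto intro!: derivative_eq_intros)
    have z'c: "continuous_on UNIV z'"
      unfolding z'_def by (intro continuous_intros q'c qc Yc \<open>continuous_on UNIV \<beta>\<close>)
    have key: "z' (F p) * A (F p) - (q (F p) * Y (F p)) * B (F p) = q' (F p) * (Y (F p) * A (F p))" for p
    proof (cases "F p \<le> \<alpha> \<or> s \<le> F p")
      case True
      then show ?thesis using q0 by (simp add: z'_def)
    next
      case False
      then have "\<beta> (F p) = B (F p) / A (F p)" "A (F p) > 0"
        using A_pos[of "F p"] \<alpha> s by (auto simp: \<beta>_def max_def min_def)
      then show ?thesis by (simp add: z'_def field_simps)
    qed
    have zFc: "continuous_on UNIV (\<lambda>p. z' (F p) * A (F p))"
      by (intro continuous_intros level_continuous z'c AFc)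
    have qFc: "continuous_on UNIV (\<lambda>p. q (F p) * Y (F p) * B (F p))"
    proof -
      have "continuous_on UNIV (\<lambda>p. B (F p))"
        using continuous_on_compose2[OF B_cont F_cont] range_F U(2) by auto
      then show ?thesis
        by (rule continuous_on_mult[OF continuous_on_mult[OF level_continuous[OF qc] level_continuous[OF Yc]]])
    qed
    have "0 = (\<integral>p. z' (F p) * A (F p) \<partial>vol) - (\<integral>p. q (F p) * Y (F p) * B (F p) \<partial>vol)"
      using integral_level_weight[OF zd z'c] by simp
    also have "\<dots> = (\<integral>p. q' (F p) * (Y (F p) * A (F p)) \<partial>vol)"
      using Bochner_Integration.integral_diff[OF continuous_integrable[OF zFc] continuous_integrable[OF qFc]]
      by (simp add: key)
    also have "\<dots> = (\<integral>p. m * \<theta> (m * (F p - \<alpha>)) * (Y (F p) * A (F p)) - n * \<theta> (n * (s - F p)) * (Y (F p) * A (F p)) \<partial>vol)"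
      by (simp add: q'_def left_diff_distrib)
    also have "\<dots> = C - (\<integral>p. n * \<theta> (n * (s - F p)) * (Y (F p) * A (F p)) \<partial>vol)"
      unfolding C_def
      by (rule Bochner_Integration.integral_diff)
        (intro continuous_integrable continuous_on_mult[OF \<theta>F(1) YA] continuous_on_mult[OF \<theta>F(2) YA])+
    finally show "(\<integral>p. n * \<theta> (n * (s - F p)) * (Y (F p) * A (F p)) \<partial>vol) = C" by simp
  qed
qed

end

section \<open>The Pompeiu problem for tubes\<close>

lemma submanifold_empty_interior:
  fixes M :: "('m::t2_space, 'n::finite) riemannian"
  assumes S: "submanifold_codim_ge M 2 S" and N: "open N" "N \<subseteq> S"
  shows "N = {}"
proof (rule ccontr)
  assume "N \<noteq> {}"
  then obtain p where p: "p \<in> N" by blast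
  then have pS: "p \<in> S" using N(2) by blast
  obtain d :: "('m, 'n) chart" and K where d: "is_chart d" "p \<in> cdom d" "2 \<le> card K"
    "coord d ` (cdom d \<inter> S) = codom d \<inter> {x. \<forall>i\<in>K. x $ i = 0}"
    using bspec[OF S[unfolded submanifold_codim_ge_def] pS] by (elim exE conjE) (rule that)
  obtain i where i: "i \<in> K" using d(3) by fastforce
  define V where "V = coord d ` (cdom d \<inter> N)"
  have V: "open V" "coord d p \<in> V" using chart_image_open[OF d(1) N(1)] p d(2) by (auto simp: V_def)
  have "V \<subseteq> coord d ` (cdom d \<inter> S)" unfolding V_def using N(2) by blast
  then have zero: "x $ i = 0" if "x \<in> V" for x using that d(4) i by blast
  obtain e where e: "e > 0" "ball (coord d p) e \<subseteq> V" using V openE by blast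
  have "coord d p + (e / 2) *\<^sub>R axis i 1 \<in> ball (coord d p) e"
    using e(1) by (simp add: dist_norm)
  then have "coord d p + (e / 2) *\<^sub>R axis i 1 \<in> V" using e(2) by blast
  from zero[OF this] zero[OF V(2)] e(1) show False by simp
qed

locale proper_isoparametric_mfd = isoparametric_mfd +
  assumes empty_interior_a: "\<And>N. open N \<Longrightarrow> N \<subseteq> F -` {a} \<Longrightarrow> N = {}"
    and empty_interior_b: "\<And>N. open N \<Longrightarrow> N \<subseteq> F -` {b} \<Longrightarrow> N = {}"
begin

lemma zero_if_zero_between:
  fixes f :: "'a \<Rightarrow> real"
  assumes f: "continuous_on UNIV f" and zero: "\<And>p. a < F p \<Longrightarrow> F p < b \<Longrightarrow> f p = 0"
  shows "f p = 0"
proof (rule ccontr)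
  assume "f p \<noteq> 0"
  define N where "N = {q. f q \<noteq> 0}"
  have N: "open N" using f unfolding N_def by (auto intro!: open_Collect_neq continuous_intros)
  have "N \<inter> {p. F p < b} = {}"
  proof (rule empty_interior_a)
    show "N \<inter> {p. F p < b} \<subseteq> F -` {a}"
    proof
      fix q assume q: "q \<in> N \<inter> {p. F p < b}"
      then have "\<not> a < F q" using zero[of q] by (auto simp: N_def)
      then show "q \<in> F -` {a}" using F_bounds(1)[of q] by simp
    qed
  qed (use N open_F_less in auto)
  then have "F q = b" if "q \<in> N" for q using that F_bounds(2)[of q] by (auto simp: less_le)
  then have "N \<subseteq> F -` {b}" by blast
  then have "N = {}" by (rule empty_interior_b[OF N])
  then show False using \<open>f p \<noteq> 0\<close> by (auto simp: N_def)
qed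

lemma Green_level:
  assumes q: "\<And>t. (q has_real_derivative q' t) (at t)" "continuous_on UNIV q'"
    and w: "C1_fun M w" and f: "smooth_function M f" and k: "laplacian_is M f k" "continuous_on UNIV k"
  shows "(\<integral>p. q (F p) * w p * k p \<partial>vol) =
    (\<integral>p. q (F p) * grad_prod M w f p + q' (F p) * (w p * grad_prod M F f p) \<partial>vol)"
proof -
  have "C1_fun M (\<lambda>p. q (F p) * w p)" by (intro C1_fun_mult C1_fun_level[OF q] w)
  from Green[OF this f k] show ?thesis
    using grad_prod_level_mult[OF q w smooth_function_imp_C1_fun[OF f]] by simp
qed

lemma integral_cutoff_limit:
  assumes H: "continuous_on UNIV H" "\<And>t. t \<le> 0 \<Longrightarrow> H t = (0::real)" "\<And>t. 1 \<le> t \<Longrightarrow> H t = 1"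
    "\<And>t. 0 \<le> H t \<and> H t \<le> 1"
    and f: "continuous_on UNIV f"
  shows "(\<lambda>n. \<integral>p. H (real n * (s - F p)) * f p \<partial>vol) \<longlonglongrightarrow> (\<integral>p. indicator {p. F p < s} p * f p \<partial>vol)"
proof (rule integral_dominated_convergence)
  have fm: "f \<in> borel_measurable vol"
    using borel_measurable_continuous_onI[OF f] by (simp add: measurable_cong_sets[OF sets_vol])
  have sm: "{p. F p < s} \<in> sets vol" using open_F_less by (simp add: sets_vol)
  show "(\<lambda>p. indicator {p. F p < s} p * f p) \<in> borel_measurable vol"
    by (intro borel_measurable_times fm borel_measurable_indicator sm)
  have "continuous_on UNIV (\<lambda>p. H (real n * (s - F p)))" for n
    by (rule continuous_on_compose2[OF H(1)]) (auto intro!: continuous_intros F_cont)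
  then have Hc: "continuous_on UNIV (\<lambda>p. H (real n * (s - F p)) * f p)" for n
    by (intro continuous_on_mult f)
  show "(\<lambda>p. H (real n * (s - F p)) * f p) \<in> borel_measurable vol" for n
    using borel_measurable_continuous_onI[OF Hc] by (simp add: measurable_cong_sets[OF sets_vol])
  show "integrable vol (\<lambda>p. \<bar>f p\<bar>)"
    by (intro continuous_integrable continuous_intros f)
  show "AE p in vol. norm (H (real n * (s - F p)) * f p) \<le> \<bar>f p\<bar>" for n
  proof (rule AE_I2)
    fix p
    have "\<bar>H (real n * (s - F p))\<bar> \<le> 1" using H(4) by simp
    then have "\<bar>H (real n * (s - F p))\<bar> * \<bar>f p\<bar> \<le> 1 * \<bar>f p\<bar>" by (intro mult_right_mono) auto
    then show "norm (H (real n * (s - F p)) * f p) \<le> \<bar>f p\<bar>" by (simp add: abs_mult)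
  qed
  show "AE p in vol. (\<lambda>n. H (real n * (s - F p)) * f p) \<longlonglongrightarrow> indicator {p. F p < s} p * f p"
  proof (rule AE_I2)
    fix p
    show "(\<lambda>n. H (real n * (s - F p)) * f p) \<longlonglongrightarrow> indicator {p. F p < s} p * f p"
    proof (cases "F p < s")
      case True
      obtain n0 :: nat where n0: "1 / (s - F p) < real n0" using reals_Archimedean2 by blast
      have "H (real n * (s - F p)) = 1" if "n \<ge> n0" for n
      proof (rule H(3))
        have "1 / (s - F p) \<le> real n" using n0 that by simp
        then show "1 \<le> real n * (s - F p)" using True by (simp add: divide_le_eq)
      qed
      then have "\<forall>\<^sub>F n in sequentially. H (real n * (s - F p)) * f p = indicator {p. F p < s} p * f p"
        using True by (intro eventually_sequentiallyI[of n0]) simp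
      then show ?thesis by (rule tendsto_eventually)
    next
      case False
      then have "H (real n * (s - F p)) = 0" for n by (intro H(2)) (simp add: mult_nonneg_nonpos)
      then show ?thesis using False by simp
    qed
  qed
qed

text \<open>Up to sign, the integral of \<open>k = \<Delta>f\<close> over the sublevel set is the limit of the fluxes of \<open>\<nabla>f\<close>
  through thin shells below the level \<open>s\<close>. Relative to the weighted flux of
  \<open>flux_weight\<close>, which is constant, these tend to \<open>u(s)\<close>, where \<open>u = \<nu> / (Y A)\<close> and \<open>\<nu>\<close> is
  the inner product of \<open>\<nabla>f\<close> and \<open>\<nabla>F\<close> as a function of the level.\<close>

lemma vanishing_flux:
  assumes s: "a < s" "s < b"
    and f: "smooth_function M f" "laplacian_is M f k" "continuous_on UNIV k" "level_constant f"
    and int0: "(\<integral>p. indicator {p. F p < s} p * k p \<partial>vol) = 0"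
  shows "level_value (grad_prod M f F) s = 0"
proof -
  have fC1: "C1_fun M f" using f(1) by (rule smooth_function_imp_C1_fun)
  let ?N = "grad_prod M f F"
  define \<nu> where "\<nu> = level_value ?N"
  have NC1: "C1_fun M ?N" by (rule grad_prod_C1_fun[OF f(1) F_smooth])
  have Nlev: "level_constant ?N" by (rule level_constant_grad_prod[OF fC1 f(4)])
  obtain H \<theta> K where H: "\<And>t. (H has_real_derivative \<theta> t) (at t)" "continuous_on UNIV \<theta>"
    "\<And>t. t \<le> 0 \<Longrightarrow> H t = 0" "\<And>t. 1 \<le> t \<Longrightarrow> H t = 1" "\<And>t. 0 \<le> H t \<and> H t \<le> 1"
    "\<And>t. 0 < t \<Longrightarrow> t < 1 \<Longrightarrow> 0 < \<theta> t" "\<And>t. t \<le> 0 \<or> 1 \<le> t \<Longrightarrow> \<theta> t = 0" "\<And>t. 0 \<le> \<theta> t \<and> \<theta> t \<le> K"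
    by (rule ex_cutoff) blast
  have \<theta>nn: "\<And>t. 0 \<le> \<theta> t" using H(8) by blast
  obtain Y C n0 where Y: "continuous_on UNIV Y" "\<And>t. 0 < Y t" "0 < C" "0 < n0"
    "\<And>n. n0 \<le> n \<Longrightarrow> (\<integral>p. n * \<theta> (n * (s - F p)) * (Y (F p) * A (F p)) \<partial>vol) = C"
    using flux_weight[OF s H(1-4,6) \<theta>nn] by blast
  have Hc: "continuous_on UNIV H"
    using H(1) DERIV_isCont by (intro continuous_at_imp_continuous_on) blast
  have flux: "(\<integral>p. H (real n * (s - F p)) * k p \<partial>vol) = - (\<integral>p. real n * \<theta> (real n * (s - F p)) * ?N p \<partial>vol)" for n
  proof -
    have q: "((\<lambda>t. H (real n * (s - t))) has_real_derivative - (real n * \<theta> (real n * (s - t)))) (at t)" for t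
      by (rule scaled_cutoff_deriv[OF H(1)])
    have qc: "continuous_on UNIV (\<lambda>t. - (real n * \<theta> (real n * (s - t))))"
      by (intro continuous_intros continuous_on_compose2[OF H(2)]) auto
    have "(\<integral>p. H (real n * (s - F p)) * 1 * k p \<partial>vol) =
      (\<integral>p. H (real n * (s - F p)) * grad_prod M (\<lambda>_. 1) f p
         + - (real n * \<theta> (real n * (s - F p))) * (1 * grad_prod M F f p) \<partial>vol)"
      by (rule Green_level[OF q qc C1_fun_const f(1-3)])
    then show ?thesis using fC1 grad_prod_comm[OF F_C1 fC1] by simp
  qed
  have tends: "(\<lambda>n. \<integral>p. real n * \<theta> (real n * (s - F p)) * ?N p \<partial>vol) \<longlonglongrightarrow> 0"
    using tendsto_minus[OF integral_cutoff_limit[OF Hc H(3,4,5) f(3), of s]] int0 by (simp add: flux)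
  obtain q0 where q0: "F q0 = s" using ex_level[of s] s by auto
  have \<nu>c: "isCont \<nu> s"
    using DERIV_isCont[OF level_value_deriv[OF NC1 Nlev, of q0]] s q0 by (simp add: \<nu>_def)
  define u where "u t = \<nu> t / (Y t * A t)" for t
  have As: "A s > 0" using A_pos s by blast
  have "isCont A s" using A_deriv[of s] subsetD[OF U(2), of s] s by (intro DERIV_isCont) auto
  moreover have "isCont Y s" using Y(1) by (simp add: continuous_on_eq_continuous_at)
  ultimately have uc: "isCont u s"
    unfolding u_def using \<nu>c As Y(2)[of s] by (intro continuous_intros) auto
  have "u s = 0"
  proof (rule ccontr)
    assume us: "u s \<noteq> 0"
    define e where "e = \<bar>u s\<bar> / 2"
    have e: "e > 0" using us by (simp add: e_def)
    obtain d where d: "d > 0" "\<And>t. \<bar>t - s\<bar> < d \<Longrightarrow> \<bar>u t - u s\<bar> < e"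
      using uc e unfolding continuous_at_eps_delta by (auto simp: dist_real_def)
    define m where "m = max n0 (max (1 / d) (1 / (s - a)))"
    have lower: "e * C \<le> \<bar>\<integral>p. real n * \<theta> (real n * (s - F p)) * ?N p \<partial>vol\<bar>" if n: "m < real n" for n
    proof -
      let ?\<theta> = "\<lambda>p. real n * \<theta> (real n * (s - F p))"
      have npos: "real n > 0" and nn0: "n0 \<le> real n" using n Y(4) by (auto simp: m_def)
      have "1 / d < real n" "1 / (s - a) < real n" using n by (auto simp: m_def)
      then have inv: "1 / real n < d" "1 / real n < s - a"
        using d(1) s(1) npos by (auto simp: field_simps)
      have bound: "\<bar>?\<theta> p * ?N p - u s * (?\<theta> p * (Y (F p) * A (F p)))\<bar> \<le> e * (?\<theta> p * (Y (F p) * A (F p)))" for p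
      proof (cases "0 < real n * (s - F p) \<and> real n * (s - F p) < 1")
        case True
        then have Fp: "F p < s" "s - F p < 1 / real n"
          using npos by (auto simp: zero_less_mult_iff field_simps)
        then have aF: "a < F p" "F p < b" "\<bar>F p - s\<bar> < d" using inv s by auto
        have YA: "Y (F p) * A (F p) > 0" using Y(2) A_pos[OF aF(1,2)] by simp
        have "?N p = u (F p) * (Y (F p) * A (F p))"
        proof -
          have "Y (F p) \<noteq> 0" "A (F p) \<noteq> 0" using YA by auto
          then show ?thesis using level_value_eq[OF Nlev aF(1,2)] by (simp add: u_def \<nu>_def)
        qed
        then have eq: "?\<theta> p * ?N p - u s * (?\<theta> p * (Y (F p) * A (F p))) =
            (u (F p) - u s) * (?\<theta> p * (Y (F p) * A (F p)))"
          by (simp add: algebra_simps)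
        have W: "?\<theta> p * (Y (F p) * A (F p)) \<ge> 0" using YA \<theta>nn npos by simp
        show ?thesis
          unfolding eq abs_mult[of "u (F p) - u s"] abs_of_nonneg[OF W]
          by (rule mult_right_mono[OF less_imp_le[OF d(2)[OF aF(3)]] W])
      next
        case False
        then have "real n * (s - F p) \<le> 0 \<or> 1 \<le> real n * (s - F p)" by auto
        then have "\<theta> (real n * (s - F p)) = 0" by (rule H(7))
        then show ?thesis by simp
      qed
      have tc: "continuous_on UNIV ?\<theta>"
        by (intro continuous_intros continuous_on_compose2[OF H(2)] F_cont) auto
      have YAc: "continuous_on UNIV (\<lambda>p. Y (F p) * A (F p))"
        by (intro continuous_on_mult level_continuous[OF Y(1)])
          (use continuous_on_compose2[OF A_cont F_cont] range_F U(2) in auto)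
      have i1: "integrable vol (\<lambda>p. ?\<theta> p * ?N p)"
        by (intro continuous_integrable continuous_on_mult tc C1_fun_continuous NC1)
      have i2: "integrable vol (\<lambda>p. ?\<theta> p * (Y (F p) * A (F p)))"
        by (intro continuous_integrable continuous_on_mult[OF tc YAc])
      have "\<bar>(\<integral>p. ?\<theta> p * ?N p \<partial>vol) - u s * C\<bar> =
          \<bar>\<integral>p. ?\<theta> p * ?N p - u s * (?\<theta> p * (Y (F p) * A (F p))) \<partial>vol\<bar>"
        using Bochner_Integration.integral_diff[OF i1 integrable_mult_right[OF i2, of "u s"]] Y(5)[OF nn0] by simp
      also have "\<dots> \<le> (\<integral>p. \<bar>?\<theta> p * ?N p - u s * (?\<theta> p * (Y (F p) * A (F p)))\<bar> \<partial>vol)"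
        by (rule integral_abs_bound)
      also have "\<dots> \<le> (\<integral>p. e * (?\<theta> p * (Y (F p) * A (F p))) \<partial>vol)"
      proof (rule integral_mono)
        show "integrable vol (\<lambda>p. \<bar>?\<theta> p * ?N p - u s * (?\<theta> p * (Y (F p) * A (F p)))\<bar>)"
          by (rule integrable_abs[OF Bochner_Integration.integrable_diff[OF i1 integrable_mult_right[OF i2]]])
        show "integrable vol (\<lambda>p. e * (?\<theta> p * (Y (F p) * A (F p))))"
          by (rule integrable_mult_right[OF i2])
      qed (rule bound)
      also have "\<dots> = e * C" using Y(5)[OF nn0] by simp
      finally have "\<bar>(\<integral>p. ?\<theta> p * ?N p \<partial>vol) - u s * C\<bar> \<le> e * C" .
      moreover have "\<bar>u s * C\<bar> = 2 * (e * C)" using Y(3) by (simp add: e_def abs_mult)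
      ultimately show ?thesis by linarith
    qed
    obtain n1 :: nat where n1: "m < real n1" using reals_Archimedean2 by blast
    have "e * C \<le> \<bar>0\<bar>"
    proof (rule tendsto_lowerbound[OF tendsto_rabs[OF tends]])
      show "\<forall>\<^sub>F n in sequentially. e * C \<le> \<bar>\<integral>p. real n * \<theta> (real n * (s - F p)) * ?N p \<partial>vol\<bar>"
      proof (rule eventually_sequentiallyI[of n1])
        fix n assume "n1 \<le> n"
        then have "m < real n" using n1 by simp
        then show "e * C \<le> \<bar>\<integral>p. real n * \<theta> (real n * (s - F p)) * ?N p \<partial>vol\<bar>" by (rule lower)
      qed
    qed simp
    moreover have "e * C > 0" using e Y(3) by simp
    ultimately show False by simp
  qed
  then show ?thesis using As Y(2)[of s] by (simp add: u_def \<nu>_def)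
qed

text \<open>On the level \<open>s\<close>, the function \<open>v = f - c\<close> with \<open>c = g(s)\<close> vanishes together with its
  gradient. In Green's identity for \<open>u\<close> and \<open>v\<close>, cut off at this level, the derivative of the
  cutoff is of order \<open>n\<close> on a shell of thickness \<open>1 / n\<close>, while \<open>v\<close> and the inner product of
  \<open>\<nabla>f\<close> and \<open>\<nabla>F\<close> are of order \<open>1 / n\<close> there. So the boundary term, in which they are
  multiplied, is bounded and supported in a shell that shrinks to the empty set.\<close>

lemma integral_tube_eigenfunction:
  assumes s: "a < s" "s < b"
    and f: "smooth_function M f" "laplacian_is M f (\<lambda>p. \<kappa> * f p)" "level_constant f"
    and zero: "level_value (grad_prod M f F) s = 0"
    and u: "C1_fun M u" "\<And>w. C1_fun M w \<Longrightarrow> (\<integral>p. grad_prod M u w p \<partial>vol) = \<kappa> * (\<integral>p. u p * w p \<partial>vol)"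
  shows "\<kappa> * level_value f s * (\<integral>p. indicator {p. F p < s} p * u p \<partial>vol) = 0"
proof -
  have fC1: "C1_fun M f" using f(1) by (rule smooth_function_imp_C1_fun)
  let ?N = "grad_prod M f F"
  define \<nu> where "\<nu> = level_value ?N"
  define g where "g = level_value f"
  define c where "c = g s"
  define v where "v p = f p + - c" for p
  have vC1: "C1_fun M v" unfolding v_def by (intro C1_fun_add fC1 C1_fun_const)
  have NC1: "C1_fun M ?N" by (rule grad_prod_C1_fun[OF f(1) F_smooth])
  have Nlev: "level_constant ?N" by (rule level_constant_grad_prod[OF fC1 f(3)])
  have cf: "continuous_on UNIV f" and cu: "continuous_on UNIV u" and cv: "continuous_on UNIV v"
    using C1_fun_continuous fC1 u(1) vC1 by blast+
  obtain q0 where q0: "F q0 = s" using ex_level[of s] s by auto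
  obtain K1 d1 where K1: "K1 > 0" "d1 > 0" "\<And>t. \<bar>t - s\<bar> < d1 \<Longrightarrow> \<bar>\<nu> t - \<nu> s\<bar> \<le> K1 * \<bar>t - s\<bar>"
    using DERIV_locally_Lipschitz[OF level_value_deriv[OF NC1 Nlev, of q0, unfolded q0, OF s]]
    unfolding \<nu>_def by blast
  obtain K2 d2 where K2: "K2 > 0" "d2 > 0" "\<And>t. \<bar>t - s\<bar> < d2 \<Longrightarrow> \<bar>g t - g s\<bar> \<le> K2 * \<bar>t - s\<bar>"
    using DERIV_locally_Lipschitz[OF level_value_deriv[OF fC1 f(3), of q0, unfolded q0, OF s]]
    unfolding g_def by blast
  obtain H \<theta> K where H: "\<And>t. (H has_real_derivative \<theta> t) (at t)" "continuous_on UNIV \<theta>"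
    "\<And>t. t \<le> 0 \<Longrightarrow> H t = 0" "\<And>t. 1 \<le> t \<Longrightarrow> H t = 1" "\<And>t. 0 \<le> H t \<and> H t \<le> 1"
    "\<And>t. 0 < t \<Longrightarrow> t < 1 \<Longrightarrow> 0 < \<theta> t" "\<And>t. t \<le> 0 \<or> 1 \<le> t \<Longrightarrow> \<theta> t = 0" "\<And>t. 0 \<le> \<theta> t \<and> \<theta> t \<le> K"
    by (rule ex_cutoff) blast
  have Hc: "continuous_on UNIV H"
    using H(1) DERIV_isCont by (intro continuous_at_imp_continuous_on) blast
  define R where "R p = u p * grad_prod M F f p - v p * grad_prod M F u p" for p
  have cR: "continuous_on UNIV R"
    unfolding R_def by (intro continuous_intros cu cv grad_prod_continuous F_C1 fC1 u(1))
  have id: "\<kappa> * c * (\<integral>p. H (real n * (s - F p)) * u p \<partial>vol) =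
      (\<integral>p. - (real n * \<theta> (real n * (s - F p))) * R p \<partial>vol)" for n
  proof -
    let ?q = "\<lambda>p. H (real n * (s - F p))" and ?q' = "\<lambda>p. - (real n * \<theta> (real n * (s - F p)))"
    have q: "((\<lambda>t. H (real n * (s - t))) has_real_derivative - (real n * \<theta> (real n * (s - t)))) (at t)" for t
      by (rule scaled_cutoff_deriv[OF H(1)])
    have qc: "continuous_on UNIV (\<lambda>t. - (real n * \<theta> (real n * (s - t))))"
      by (intro continuous_intros continuous_on_compose2[OF H(2)]) auto
    have cq: "continuous_on UNIV ?q"
      by (rule continuous_on_compose2[OF Hc]) (auto intro!: continuous_intros F_cont)
    have cq': "continuous_on UNIV ?q'"
      by (rule continuous_on_compose2[OF qc F_cont]) auto
    have qv: "C1_fun M (\<lambda>p. ?q p * v p)" by (intro C1_fun_mult C1_fun_level[OF q qc] vC1)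
    have gvu: "grad_prod M v u p = grad_prod M u f p" for p
      using grad_prod_add[OF fC1 C1_fun_const u(1), of "- c" p] grad_prod_comm[OF fC1 u(1)] u(1)
      by (simp add: v_def[abs_def])
    have 1: "(\<integral>p. ?q p * u p * (\<kappa> * f p) \<partial>vol) =
        (\<integral>p. ?q p * grad_prod M u f p + ?q' p * (u p * grad_prod M F f p) \<partial>vol)"
      by (rule Green_level[OF q qc u(1) f(1,2)]) (intro continuous_intros cf)
    have "\<kappa> * (\<integral>p. u p * (?q p * v p) \<partial>vol) = (\<integral>p. grad_prod M u (\<lambda>p. ?q p * v p) p \<partial>vol)"
      by (rule u(2)[OF qv, symmetric])
    also have "\<dots> = (\<integral>p. ?q p * grad_prod M u f p + ?q' p * (v p * grad_prod M F u p) \<partial>vol)"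
      using grad_prod_level_mult[OF q qc vC1 u(1)] grad_prod_comm[OF u(1) qv] by (simp add: gvu)
    finally have 2: "\<kappa> * (\<integral>p. u p * (?q p * v p) \<partial>vol) =
        (\<integral>p. ?q p * grad_prod M u f p + ?q' p * (v p * grad_prod M F u p) \<partial>vol)" .
    have c1: "continuous_on UNIV (\<lambda>p. ?q p * u p * (\<kappa> * f p))"
      and c2: "continuous_on UNIV (\<lambda>p. u p * (?q p * v p))"
      and c3: "continuous_on UNIV (\<lambda>p. ?q p * grad_prod M u f p + ?q' p * (u p * grad_prod M F f p))"
      and c4: "continuous_on UNIV (\<lambda>p. ?q p * grad_prod M u f p + ?q' p * (v p * grad_prod M F u p))"
      by (rule continuous_on_add continuous_on_mult cq cq' cu cv cf continuous_on_const
          grad_prod_continuous F_C1 fC1 u(1))+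
    note I = continuous_integrable[OF c1] continuous_integrable[OF c2]
      continuous_integrable[OF c3] continuous_integrable[OF c4]
    have "\<kappa> * c * (\<integral>p. ?q p * u p \<partial>vol) = (\<integral>p. ?q p * u p * (\<kappa> * f p) - \<kappa> * (u p * (?q p * v p)) \<partial>vol)"
      unfolding integral_mult_right_zero[symmetric]
      by (rule Bochner_Integration.integral_cong) (simp_all add: v_def algebra_simps)
    also have "\<dots> = (\<integral>p. ?q p * u p * (\<kappa> * f p) \<partial>vol) - \<kappa> * (\<integral>p. u p * (?q p * v p) \<partial>vol)"
      using Bochner_Integration.integral_diff[OF I(1) integrable_mult_right[OF I(2), of \<kappa>]] by simp
    also have "\<dots> = (\<integral>p. (?q p * grad_prod M u f p + ?q' p * (u p * grad_prod M F f p))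
        - (?q p * grad_prod M u f p + ?q' p * (v p * grad_prod M F u p)) \<partial>vol)"
      unfolding 1 2 by (rule Bochner_Integration.integral_diff[OF I(3,4), symmetric])
    also have "\<dots> = (\<integral>p. ?q' p * R p \<partial>vol)"
      by (rule Bochner_Integration.integral_cong) (simp_all add: R_def algebra_simps)
    finally show ?thesis .
  qed
  obtain Ku where Ku: "Ku > 0" "\<And>p. \<bar>u p\<bar> \<le> Ku" by (rule continuous_bounded[OF cu]) blast
  obtain Kg where Kg: "Kg > 0" "\<And>p. \<bar>grad_prod M F u p\<bar> \<le> Kg"
    by (rule continuous_bounded[OF grad_prod_continuous[OF F_C1 u(1)]]) blast
  define L where "L = Ku * K1 + K2 * Kg"
  have L: "L > 0" using Ku(1) K1(1) K2(1) Kg(1) by (simp add: L_def add_pos_pos)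
  define d where "d = min d1 (min d2 (s - a))"
  have d: "d > 0" using K1(2) K2(2) s by (simp add: d_def)
  have Rb: "\<bar>R p\<bar> \<le> L * \<bar>F p - s\<bar>" if "\<bar>F p - s\<bar> < d" "F p < s" for p
  proof -
    have aF: "a < F p" "F p < b" using that s by (auto simp: d_def)
    have "\<bar>grad_prod M F f p\<bar> \<le> K1 * \<bar>F p - s\<bar>"
      using K1(3)[of "F p"] that level_value_eq[OF Nlev aF] zero grad_prod_comm[OF F_C1 fC1]
      by (simp add: \<nu>_def d_def)
    moreover have "\<bar>v p\<bar> \<le> K2 * \<bar>F p - s\<bar>"
      using K2(3)[of "F p"] that level_value_eq[OF f(3) aF] by (simp add: v_def c_def g_def d_def)
    ultimately have "\<bar>u p\<bar> * \<bar>grad_prod M F f p\<bar> + \<bar>v p\<bar> * \<bar>grad_prod M F u p\<bar>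
        \<le> Ku * (K1 * \<bar>F p - s\<bar>) + (K2 * \<bar>F p - s\<bar>) * Kg"
      using Ku Kg K1(1) K2(1) by (intro add_mono mult_mono) auto
    moreover have "\<bar>R p\<bar> \<le> \<bar>u p\<bar> * \<bar>grad_prod M F f p\<bar> + \<bar>v p\<bar> * \<bar>grad_prod M F u p\<bar>"
      unfolding R_def abs_mult[symmetric] by (rule abs_triangle_ineq4)
    ultimately show ?thesis by (simp add: L_def algebra_simps)
  qed
  have Kpos: "K \<ge> 0" using H(8)[of 0] by linarith
  obtain n1 :: nat where n1: "1 / d < real n1" using reals_Archimedean2 by blast
  let ?h = "\<lambda>n p. - (real (n + n1) * \<theta> (real (n + n1) * (s - F p))) * R p"
  have "(\<lambda>n. \<integral>p. ?h n p \<partial>vol) \<longlonglongrightarrow> (\<integral>p. 0 \<partial>vol)"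
  proof (rule integral_dominated_convergence[where w="\<lambda>_. K * L"])
    show "?h n \<in> borel_measurable vol" for n
    proof -
      have "continuous_on UNIV (?h n)"
        by (intro continuous_intros cR continuous_on_compose2[OF H(2)] F_cont) auto
      from borel_measurable_continuous_onI[OF this] show ?thesis
        by (simp add: measurable_cong_sets[OF sets_vol])
    qed
    show "AE p in vol. norm (?h n p) \<le> K * L" for n
    proof (rule AE_I2)
      fix p
      define m where "m = real (n + n1)"
      have "0 < 1 / d" using d by simp
      then have m: "m > 0" "1 / d < m" using n1 unfolding m_def of_nat_add by linarith+
      then have inv: "1 / m < d" using d by (simp add: field_simps)
      have "norm (- (m * \<theta> (m * (s - F p))) * R p) \<le> K * L"
      proof (cases "0 < m * (s - F p) \<and> m * (s - F p) < 1")
        case True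
        then have Fp: "F p < s" "s - F p < 1 / m" using m(1) by (auto simp: zero_less_mult_iff field_simps)
        have "\<bar>R p\<bar> \<le> L * (1 / m)"
        proof (rule order_trans[OF Rb])
          show "L * \<bar>F p - s\<bar> \<le> L * (1 / m)" using L Fp by (intro mult_left_mono) auto
        qed (use Fp inv in auto)
        then have "(m * \<theta> (m * (s - F p))) * \<bar>R p\<bar> \<le> (m * K) * (L * (1 / m))"
          using H(8) m(1) Kpos by (intro mult_mono mult_left_mono) auto
        also have "\<dots> = K * L" using m(1) by simp
        finally show ?thesis using H(8)[of "m * (s - F p)"] m(1) by (simp add: abs_mult)
      next
        case False
        then have "m * (s - F p) \<le> 0 \<or> 1 \<le> m * (s - F p)" by linarith
        then have "\<theta> (m * (s - F p)) = 0" by (rule H(7))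
        then show ?thesis using Kpos L by simp
      qed
      then show "norm (?h n p) \<le> K * L" unfolding m_def .
    qed
    show "AE p in vol. (\<lambda>n. ?h n p) \<longlonglongrightarrow> 0"
    proof (rule AE_I2)
      fix p
      obtain n0 :: nat where n0: "1 / (s - F p) < real n0" using reals_Archimedean2 by blast
      have "\<forall>\<^sub>F n in sequentially. ?h n p = 0"
      proof (rule eventually_sequentiallyI[of n0])
        fix n assume "n0 \<le> n"
        then have n: "1 / (s - F p) < real (n + n1)" using n0 by simp
        have "real (n + n1) * (s - F p) \<le> 0 \<or> 1 \<le> real (n + n1) * (s - F p)"
        proof (cases "F p < s")
          case True
          then show ?thesis using n by (simp add: divide_less_eq)
        next
          case False
          then show ?thesis by (simp add: mult_nonneg_nonpos)
        qed
        then have "\<theta> (real (n + n1) * (s - F p)) = 0" by (rule H(7))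
        then show "?h n p = 0" by simp
      qed
      then show "(\<lambda>n. ?h n p) \<longlonglongrightarrow> 0" by (rule tendsto_eventually)
    qed
  qed simp_all
  then have "(\<lambda>n. \<kappa> * c * (\<integral>p. H (real (n + n1) * (s - F p)) * u p \<partial>vol)) \<longlonglongrightarrow> 0"
    unfolding id by simp
  from LIMSEQ_unique[OF _ this] have unique: "l = 0"
    if "(\<lambda>n. \<kappa> * c * (\<integral>p. H (real (n + n1) * (s - F p)) * u p \<partial>vol)) \<longlonglongrightarrow> l" for l
    using that by blast
  have "(\<lambda>n. \<kappa> * c * (\<integral>p. H (real (n + n1) * (s - F p)) * u p \<partial>vol)) \<longlonglongrightarrow>
      \<kappa> * c * (\<integral>p. indicator {p. F p < s} p * u p \<partial>vol)"
    by (intro tendsto_mult tendsto_const LIMSEQ_ignore_initial_segment[OF integral_cutoff_limit[OF Hc H(3,4,5) cu]])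
  from unique[OF this] show ?thesis unfolding c_def g_def .
qed

text \<open>The test function is moved to the other side of the isometry, where the eigenvalue equation
  holds.\<close>

lemma eigenfunction_isometry_weak:
  assumes h: "isometry M h" and f: "smooth_function M f" "laplacian_is M f (\<lambda>p. \<kappa> * f p)"
    and w: "C1_fun M w"
  shows "(\<integral>p. grad_prod M (f \<circ> h) w p \<partial>vol) = \<kappa> * (\<integral>p. (f \<circ> h) p * w p \<partial>vol)"
proof -
  have fC1: "C1_fun M f" using f(1) by (rule smooth_function_imp_C1_fun)
  have cf: "continuous_on UNIV f" by (rule C1_fun_continuous[OF fC1])
  have sm: "smooth_map M h" and pm: "preserves_metric M h" using h by (auto simp: isometry_def)
  define w' where "w' = w \<circ> inv h"
  have w'C1: "C1_fun M w'" unfolding w'_def by (rule C1_fun_compose[OF isometry_inv(1)[OF h] w])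
  have w: "w = w' \<circ> h" by (auto simp: w'_def isometry_inv(2)[OF h])
  have "(\<integral>p. grad_prod M (f \<circ> h) w p \<partial>vol) = (\<integral>p. grad_prod M f w' (h p) \<partial>vol)"
    unfolding w by (simp only: grad_prod_compose[OF sm pm fC1 w'C1])
  also have "\<dots> = (\<integral>p. grad_prod M f w' p \<partial>vol)"
    by (rule isometry_integral[OF h])
      (rule borel_measurable_continuous_onI[OF grad_prod_continuous[OF fC1 w'C1]])
  also have "\<dots> = (\<integral>p. grad_prod M w' f p \<partial>vol)" by (simp only: grad_prod_comm[OF fC1 w'C1])
  also have "\<dots> = (\<integral>p. w' p * (\<kappa> * f p) \<partial>vol)"
    by (rule Green[OF w'C1 f, symmetric]) (intro continuous_intros cf)
  also have "\<dots> = (\<integral>p. w' (h p) * (\<kappa> * f (h p)) \<partial>vol)"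
    by (rule isometry_integral[OF h, symmetric])
      (intro borel_measurable_continuous_onI continuous_intros cf C1_fun_continuous w'C1)
  also have "\<dots> = \<kappa> * (\<integral>p. (f \<circ> h) p * w p \<partial>vol)"
    unfolding integral_mult_right_zero[symmetric]
    by (rule Bochner_Integration.integral_cong) (simp_all add: w)
  finally show ?thesis .
qed

lemma tube_not_pompeiu:
  assumes t: "0 < t" "t < focal_distance M F a b"
    and \<phi>: "eigenfunction M \<kappa> \<phi>" "radial M F a \<phi>"
    and int0: "set_lebesgue_integral vol (tube M F a t) \<phi> = 0"
  shows "\<not> pompeiu_property M vol (tube M F a t)"
proof -
  obtain s where s: "a < s" "s < b" and tube: "tube M F a t = {p. F p < s}"
    by (rule tube_level[OF t])
  have sm: "smooth_function M \<phi>" and nz: "\<phi> \<noteq> (\<lambda>_. 0)" and lap: "laplacian_is M \<phi> (\<lambda>p. \<kappa> * \<phi> p)"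
    using \<phi>(1) by (auto simp: eigenfunction_def)
  have C1: "C1_fun M \<phi>" using sm by (rule smooth_function_imp_C1_fun)
  have cont: "continuous_on UNIV \<phi>" by (rule C1_fun_continuous[OF C1])
  have lev: "level_constant \<phi>" unfolding level_constant_def using radial_level[OF \<phi>(2)] by blast
  have int0': "(\<integral>p. indicator {p. F p < s} p * \<phi> p \<partial>vol) = 0"
    using int0 by (simp add: tube set_lebesgue_integral_def)
  have kc: "continuous_on UNIV (\<lambda>p. \<kappa> * \<phi> p)" by (intro continuous_intros cont)
  have \<nu>0: "level_value (grad_prod M \<phi> F) s = 0"
  proof (rule vanishing_flux[OF s sm lap kc lev])
    have "(\<integral>p. indicator {p. F p < s} p * (\<kappa> * \<phi> p) \<partial>vol) = \<kappa> * (\<integral>p. indicator {p. F p < s} p * \<phi> p \<partial>vol)"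
      unfolding integral_mult_right_zero[symmetric]
      by (rule Bochner_Integration.integral_cong) (simp_all add: mult.left_commute)
    then show "(\<integral>p. indicator {p. F p < s} p * (\<kappa> * \<phi> p) \<partial>vol) = 0" using int0' by simp
  qed
  \<comment> \<open>a harmonic \<open>\<phi>\<close> would be constant, as its flux through every level vanishes\<close>
  have "\<kappa> \<noteq> 0"
  proof
    assume \<kappa>: "\<kappa> = 0"
    have \<nu>: "level_value (grad_prod M \<phi> F) \<sigma> = 0" if "a < \<sigma>" "\<sigma> < b" for \<sigma>
      by (rule vanishing_flux[OF that sm lap kc lev]) (simp add: \<kappa>)
    have dg: "(level_value \<phi> has_real_derivative 0) (at \<sigma>)" if \<sigma>: "a < \<sigma>" "\<sigma> < b" for \<sigma>
    proof -
      obtain q where q: "F q = \<sigma>" using ex_level[of \<sigma>] \<sigma> by auto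
      then show ?thesis
        using level_value_deriv[OF C1 lev, of q] \<nu>[OF \<sigma>] \<sigma>
          level_value_eq[OF level_constant_grad_prod[OF C1 lev], of q] by simp
    qed
    define c where "c = level_value \<phi> s"
    have const: "\<phi> p - c = 0" for p
    proof (rule zero_if_zero_between)
      show "continuous_on UNIV (\<lambda>p. \<phi> p - c)" by (intro continuous_intros cont)
      fix p assume p: "a < F p" "F p < b"
      have "level_value \<phi> (F p) = level_value \<phi> s"
        by (rule DERIV_isconst3[OF ab]) (use p s dg in auto)
      then show "\<phi> p - c = 0" using level_value_eq[OF lev p] by (simp add: c_def)
    qed
    have "c \<noteq> 0" using nz const by auto
    have ms: "{p. F p < s} \<in> sets vol" using open_F_less by (simp add: sets_vol)
    have "(\<integral>p. indicator {p. F p < s} p * \<phi> p \<partial>vol) = (\<integral>p. c * indicator {p. F p < s} p \<partial>vol)"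
      by (rule Bochner_Integration.integral_cong) (use const in \<open>simp_all add: mult.commute\<close>)
    then have "c * measure vol {p. F p < s} = 0" using int0' ms by simp
    moreover obtain q where "F q = a" using ex_level[of a] ab by auto
    then have "{p. F p < s} \<noteq> {}" using s by auto
    then have "measure vol {p. F p < s} > 0" by (rule vol_open_pos[OF open_F_less])
    ultimately show False using \<open>c \<noteq> 0\<close> by simp
  qed
  have "level_value \<phi> s \<noteq> 0"
  proof
    assume "level_value \<phi> s = 0"
    then have "\<phi> p = 0" if "a < F p" "F p < b" for p
      using radial_eigenfunction_Cauchy_zero[OF sm lap lev s _ \<nu>0 that] by blast
    then have "\<phi> p = 0" for p by (rule zero_if_zero_between[OF cont])
    then show False using nz by auto
  qed
  have "set_lebesgue_integral vol (h ` tube M F a t) \<phi> = 0" if h: "isometry M h" for h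
  proof -
    have bij: "bij h" and smh: "smooth_map M h" using h by (auto simp: isometry_def)
    have "continuous_on UNIV (inv h)" using h by (simp add: isometry_def smooth_map_def)
    then have "open (inv h -` {p. F p < s})" by (intro open_vimage open_F_less)
    moreover have "h ` {p. F p < s} = inv h -` {p. F p < s}"
      unfolding bij_vimage_eq_inv_image[OF bij_imp_bij_inv[OF bij]] inv_inv_eq[OF bij] ..
    ultimately have op: "open (h ` {p. F p < s})" by simp
    have "(\<integral>p. indicator (h ` {p. F p < s}) p * \<phi> p \<partial>vol) =
        (\<integral>p. indicator (h ` {p. F p < s}) (h p) * \<phi> (h p) \<partial>vol)"
      by (rule isometry_integral[OF h, symmetric])
        (intro borel_measurable_times borel_measurable_indicator borel_open op
          borel_measurable_continuous_onI cont)
    also have "\<dots> = (\<integral>p. indicator {p. F p < s} p * (\<phi> \<circ> h) p \<partial>vol)"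
      by (rule Bochner_Integration.integral_cong)
        (use bij in \<open>auto simp: indicator_def bij_def inj_image_mem_iff\<close>)
    also have "\<dots> = 0"
    proof -
      have "\<kappa> * level_value \<phi> s * (\<integral>p. indicator {p. F p < s} p * (\<phi> \<circ> h) p \<partial>vol) = 0"
        by (rule integral_tube_eigenfunction[OF s sm lap lev \<nu>0 C1_fun_compose[OF smh C1]])
          (rule eigenfunction_isometry_weak[OF h sm lap])
      then show ?thesis using \<open>\<kappa> \<noteq> 0\<close> \<open>level_value \<phi> s \<noteq> 0\<close> by simp
    qed
    finally show ?thesis by (simp add: tube set_lebesgue_integral_def)
  qed
  then show ?thesis using cont nz unfolding pompeiu_property_def by blast
qed

end

theorem theorem3:
  fixes M :: "('m::{t2_space, second_countable_topology}, 'n::finite) riemannian"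
    and vol :: "'m measure" and F :: "'m \<Rightarrow> real" and a b :: real
  assumes "riemannian_manifold M"
    and "compact (UNIV :: 'm set)" and "connected (UNIV :: 'm set)"
    and "riemannian_measure M vol"
    and "proper_isoparametric M F a b"
    and "radial_spectrum M F a = spectrum M"
  shows "\<forall>t\<in>zero_radii M vol F a b. \<not> pompeiu_property M vol (tube M F a t)"
proof
  fix t assume "t \<in> zero_radii M vol F a b"
  then obtain \<kappa> \<phi> where t: "0 < t" "t < focal_distance M F a b" "eigenfunction M \<kappa> \<phi>" "radial M F a \<phi>"
    "set_lebesgue_integral vol (tube M F a t) \<phi> = 0"
    unfolding zero_radii_def zero_radii_k_def by blast
  have iso: "isoparametric M F a b" using assms(5) by (simp add: proper_isoparametric_def)
  obtain A B U where AB: "open U" "{a..b} \<subseteq> U" "smooth_on U A" "smooth_on U B"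
    "grad_norm_sq_is M F (A \<circ> F)" "laplacian_is M F (B \<circ> F)"
    using iso unfolding isoparametric_def by blast
  have sub: "submanifold_codim_ge M 2 (F -` {a})" "submanifold_codim_ge M 2 (F -` {b})"
    using assms(5) by (simp_all add: proper_isoparametric_def focal_plus_def focal_minus_def)
  interpret proper_isoparametric_mfd M vol F a b A B U
  proof unfold_locales
    show "smooth_function M F" "a < b" "range F = {a..b}"
      using iso by (simp_all add: isoparametric_def)
    show "N = {}" if "open N" "N \<subseteq> F -` {a}" for N
      by (rule submanifold_empty_interior[OF sub(1) that])
    show "N = {}" if "open N" "N \<subseteq> F -` {b}" for N
      by (rule submanifold_empty_interior[OF sub(2) that])
  qed (fact assms AB)+
  show "\<not> pompeiu_property M vol (tube M F a t)" by (rule tube_not_pompeiu[OF t])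
qed

end
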